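(* Let $\mathcal{M}$ be a bounded domain or compact Riemannian manifold with boundary $\partial\mathcal{M}$ and outward unit normal $n$, let $Q=C^\infty(\mathcal{M})$, and consider the Ginzburg–Landau free energy $$\mathcal{F}(c)=\int_{\mathcal{M}}\Big(\frac{\alpha}{2}|\nabla c|^2+F(c)\Big)\,dV .$$ (i) The Allen–Cahn model $$\dot c=\alpha\Delta c-F'(c)\ \text{ in }\mathcal{M},\qquad \partial_nc=0\ \text{ on }\partial\mathcal{M}$$ follows from Onsager's variational principle with the choices $E=TQ$, $\mathcal{P}=I$ (identity), and $\mathcal{D}_c(\dot c)=\frac12\int_{\mathcal{M}}\dot c^2\,dV$. (ii) The Cahn–Hilliard model $$\dot c=\nabla\cdot(M\nabla\mu(c)),\quad \mu=-\alpha\Delta c+F'(c)\ \text{ in }\mathcal{M},\qquad \partial_nc=M\nabla\mu\cdot n=0\ \text{ on }\partial\mathcal{M}$$ follows from Onsager's variational principle with the choices $E_c=\{w\in\Gamma(T\mathcal{M}):w\cdot n=0\text{ on }\partial\mathcal{M}\}$, $\mathcal{P}_cw=-\nabla\cdot w$, and $\mathcal{D}_c(w)=\frac12\int_{\mathcal{M}}|w|^2_{M^{-1}}\,dV$.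
   Context: $\alpha>0$ is a constant, $F:\mathbb{R}\to\mathbb{R}$ is a smooth bulk free energy density, and $\Gamma(T\mathcal{M})$ denotes smooth vector fields. $M:T^*\mathcal{M}\to T\mathcal{M}$ is a smooth invertible linear mobility field (symmetric and positive definite), and $|w|_{M^{-1}}^2=w\cdot M^{-1}w$. Onsager's variational principle (OVP) for data $(Q,E,\mathcal{F},\mathcal{D},\mathcal{P})$, with $E_c$ the space of process variables at $c\in Q$ and $\mathcal{P}_c:E_c\to T_cQ=C^\infty(\mathcal{M})$ linear: a differentiable curve $t\mapsto c(t)\in Q$ is a solution if for every $t$, $\dot c(t)=\mathcal{P}_{c(t)}v(t)$, where $v(t)\in E_{c(t)}$ minimizes the Rayleighian $\mathcal{R}_c(w)=\langle d\mathcal{F}_c\,|\,\mathcal{P}_cw\rangle+\mathcal{D}_c(w)$ over $w\in E_c$ at $c=c(t)$; here $d\mathcal{F}_c$ is the differential of $\mathcal{F}$ at $c$ acting on unconstrained variations $\mathring c\in C^\infty(\mathcal{M})$. "Follows from OVP" means that every solution of OVP with the given data satisfies the stated system, including the boundary conditions. *)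

theory Defs
  imports "HOL-Analysis.Analysis"
begin

section \<open>Smooth maps\<close>

primrec Ck_on :: "nat \<Rightarrow> ('a::real_normed_vector \<Rightarrow> 'b::real_normed_vector) \<Rightarrow> 'a set \<Rightarrow> bool" where
  "Ck_on 0 f S \<longleftrightarrow> continuous_on S f"
| "Ck_on (Suc k) f S \<longleftrightarrow>
     (\<forall>x\<in>S. f differentiable (at x)) \<and> (\<forall>v. Ck_on k (\<lambda>x. frechet_derivative f (at x) v) S)"

text \<open>
  \<^const>\<open>Ck_on\<close> is meaningful on open sets only. On an arbitrary set, in particular up to the
  boundary of a half-space, smoothness is the existence of local smooth extensions.
\<close>

definition smooth_on :: "('a::real_normed_vector \<Rightarrow> 'b::real_normed_vector) \<Rightarrow> 'a set \<Rightarrow> bool" where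
  "smooth_on f S \<longleftrightarrow>
     (\<forall>x\<in>S. \<exists>U g. open U \<and> x \<in> U \<and> (\<forall>k. Ck_on k g U) \<and> (\<forall>y\<in>S \<inter> U. g y = f y))"


section \<open>The half-space\<close>

text \<open>
  The index type is well-ordered, as in the change of variables theorem for Lebesgue integrals; every
  dimension \<open>n \<ge> 1\<close> is realised by such a type. The half-space is cut out by the first coordinate.
\<close>

type_synonym 'n vect = "(real, 'n) vec"
type_synonym 'n mat = "((real, 'n) vec, 'n) vec"

definition bdir :: "'n::{finite,wellorder}" where
  "bdir = (LEAST i. True)"

definition halfspace :: "('n::{finite,wellorder} vect) set" where
  "halfspace = {x. 0 \<le> x $ bdir}"

text \<open>
  Derivatives are taken within the half-space. They are uniquely determined at every one of its
  points, are one-sided in the normal direction on its boundary, and depend only on the values of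
  the function on a relative neighbourhood in the half-space.
\<close>

abbreviation hderiv :: "('n::{finite,wellorder} vect \<Rightarrow> 'b::real_normed_vector) \<Rightarrow> 'n vect \<Rightarrow> 'n vect \<Rightarrow> 'b" where
  "hderiv f x \<equiv> frechet_derivative f (at x within halfspace)"

abbreviation hjacobian :: "('n::{finite,wellorder} vect \<Rightarrow> 'n vect) \<Rightarrow> 'n vect \<Rightarrow> 'n mat" where
  "hjacobian f x \<equiv> jacobian f (at x within halfspace)"

definition partial :: "'n::{finite,wellorder} \<Rightarrow> ('n vect \<Rightarrow> real) \<Rightarrow> 'n vect \<Rightarrow> real" where
  "partial i f x = hderiv f x (axis i 1)"

definition partials :: "'n::{finite,wellorder} list \<Rightarrow> ('n vect \<Rightarrow> real) \<Rightarrow> 'n vect \<Rightarrow> real" where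
  "partials is f = foldr partial is f"


section \<open>Compact Riemannian manifolds with boundary\<close>

text \<open>
  A chart is its domain together with its coordinate map, of which only the values on the domain
  matter. Tensor fields are given by their components: a family, indexed by the charts, of functions
  on the manifold (relevant on the domain of the chart only) that obeys the transformation law of the
  tensor type.  \<^term>\<open>gram M \<kappa> p\<close> is the Gram matrix of the metric at \<^term>\<open>p\<close> in the
  coordinates \<^term>\<open>\<kappa>\<close>.
\<close>

type_synonym ('m, 'n) chart = "'m set \<times> ('m \<Rightarrow> 'n vect)"
type_synonym ('m, 'n) vfield = "('m, 'n) chart \<Rightarrow> 'm \<Rightarrow> 'n vect"
type_synonym ('m, 'n) mfield = "('m, 'n) chart \<Rightarrow> 'm \<Rightarrow> 'n mat"

record ('m, 'n) rmanifold =
  mspace :: "'m topology"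
  atlas :: "('m, 'n::{finite,wellorder}) chart set"
  gram :: "('m, 'n::{finite,wellorder}) mfield"

definition chart_inv :: "('m, 'n::{finite,wellorder}) chart \<Rightarrow> 'n vect \<Rightarrow> 'm" where
  "chart_inv \<kappa> = inv_into (fst \<kappa>) (snd \<kappa>)"

definition is_chart :: "'m topology \<Rightarrow> ('m, 'n::{finite,wellorder}) chart \<Rightarrow> bool" where
  "is_chart X \<kappa> \<longleftrightarrow>
     openin X (fst \<kappa>) \<and>
     openin (top_of_set halfspace) (snd \<kappa> ` fst \<kappa>) \<and>
     homeomorphic_map (subtopology X (fst \<kappa>)) (top_of_set (snd \<kappa> ` fst \<kappa>)) (snd \<kappa>)"

definition transition :: "('m, 'n::{finite,wellorder}) chart \<Rightarrow> ('m, 'n) chart \<Rightarrow> 'n vect \<Rightarrow> 'n vect" where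
  "transition \<kappa> \<kappa>' = snd \<kappa>' \<circ> chart_inv \<kappa>"

definition transition_jac :: "('m, 'n::{finite,wellorder}) chart \<Rightarrow> ('m, 'n) chart \<Rightarrow> 'm \<Rightarrow> 'n mat" where
  "transition_jac \<kappa> \<kappa>' p = hjacobian (transition \<kappa> \<kappa>') (snd \<kappa> p)"

definition spd :: "'n::{finite,wellorder} mat \<Rightarrow> bool" where
  "spd A \<longleftrightarrow> transpose A = A \<and> (\<forall>x. x \<noteq> 0 \<longrightarrow> 0 < x \<bullet> (A *v x))"

definition smooth_components ::
    "('m, 'n::{finite,wellorder}) rmanifold \<Rightarrow> (('m, 'n) chart \<Rightarrow> 'm \<Rightarrow> 'b::real_normed_vector) \<Rightarrow> bool" where
  "smooth_components M T \<longleftrightarrow>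
     (\<forall>\<kappa>\<in>atlas M. smooth_on (T \<kappa> \<circ> chart_inv \<kappa>) (snd \<kappa> ` fst \<kappa>))"

definition compact_riemannian_manifold :: "('m, 'n::{finite,wellorder}) rmanifold \<Rightarrow> bool" where
  "compact_riemannian_manifold M \<longleftrightarrow>
     Hausdorff_space (mspace M) \<and> second_countable (mspace M) \<and> compact_space (mspace M) \<and>
     (\<forall>\<kappa>\<in>atlas M. is_chart (mspace M) \<kappa>) \<and>
     (\<Union>\<kappa>\<in>atlas M. fst \<kappa>) = topspace (mspace M) \<and>
     (\<forall>\<kappa>\<in>atlas M. \<forall>\<kappa>'\<in>atlas M. smooth_on (transition \<kappa> \<kappa>') (snd \<kappa> ` (fst \<kappa> \<inter> fst \<kappa>'))) \<and>
     (\<forall>\<kappa>\<in>atlas M. \<forall>p\<in>fst \<kappa>. spd (gram M \<kappa> p)) \<and>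
     (\<forall>\<kappa>\<in>atlas M. \<forall>\<kappa>'\<in>atlas M. \<forall>p\<in>fst \<kappa> \<inter> fst \<kappa>'.
        gram M \<kappa> p =
          transpose (transition_jac \<kappa> \<kappa>' p) ** gram M \<kappa>' p ** transition_jac \<kappa> \<kappa>' p) \<and>
     smooth_components M (gram M)"

definition mboundary :: "('m, 'n::{finite,wellorder}) rmanifold \<Rightarrow> 'm set" where
  "mboundary M = {p. \<exists>\<kappa>\<in>atlas M. p \<in> fst \<kappa> \<and> snd \<kappa> p $ bdir = 0}"

text \<open>The values of a smooth function off the manifold are arbitrary; nothing below depends on them.\<close>

definition C_inf :: "('m, 'n::{finite,wellorder}) rmanifold \<Rightarrow> ('m \<Rightarrow> real) set" where
  "C_inf M = {f. smooth_components M (\<lambda>\<kappa>. f)}"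

definition vector_fields :: "('m, 'n::{finite,wellorder}) rmanifold \<Rightarrow> ('m, 'n) vfield set" where
  "vector_fields M = {w. smooth_components M w \<and>
     (\<forall>\<kappa>\<in>atlas M. \<forall>\<kappa>'\<in>atlas M. \<forall>p\<in>fst \<kappa> \<inter> fst \<kappa>'. w \<kappa>' p = transition_jac \<kappa> \<kappa>' p *v w \<kappa> p)}"

text \<open>
  A field of symmetric positive definite linear maps from the cotangent to the tangent spaces, i.e. a
  contravariant 2-tensor field.
\<close>

definition mobility_field ::
    "('m, 'n::{finite,wellorder}) rmanifold \<Rightarrow> ('m, 'n) mfield \<Rightarrow> bool" where
  "mobility_field M B \<longleftrightarrow> smooth_components M B \<and>
     (\<forall>\<kappa>\<in>atlas M. \<forall>p\<in>fst \<kappa>. invertible (B \<kappa> p) \<and> spd (B \<kappa> p)) \<and>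
     (\<forall>\<kappa>\<in>atlas M. \<forall>\<kappa>'\<in>atlas M. \<forall>p\<in>fst \<kappa> \<inter> fst \<kappa>'.
        B \<kappa>' p = transition_jac \<kappa> \<kappa>' p ** B \<kappa> p ** transpose (transition_jac \<kappa> \<kappa>' p))"

text \<open>Coordinate expressions of scalars are evaluated in an arbitrarily selected chart at the point.\<close>

definition chart_at :: "('m, 'n::{finite,wellorder}) rmanifold \<Rightarrow> 'm \<Rightarrow> ('m, 'n) chart" where
  "chart_at M p = (SOME \<kappa>. \<kappa> \<in> atlas M \<and> p \<in> fst \<kappa>)"

definition ginner :: "('m, 'n::{finite,wellorder}) rmanifold \<Rightarrow> ('m, 'n) vfield \<Rightarrow> ('m, 'n) vfield \<Rightarrow> 'm \<Rightarrow> real" where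
  "ginner M u v p = (let \<kappa> = chart_at M p in u \<kappa> p \<bullet> (gram M \<kappa> p *v v \<kappa> p))"

definition mdifferential :: "('m \<Rightarrow> real) \<Rightarrow> ('m, 'n::{finite,wellorder}) vfield" where
  "mdifferential f \<kappa> p = (\<chi> i. partial i (f \<circ> chart_inv \<kappa>) (snd \<kappa> p))"

definition grad :: "('m, 'n::{finite,wellorder}) rmanifold \<Rightarrow> ('m \<Rightarrow> real) \<Rightarrow> ('m, 'n) vfield" where
  "grad M f \<kappa> p = matrix_inv (gram M \<kappa> p) *v mdifferential f \<kappa> p"

definition vol_density :: "('m, 'n::{finite,wellorder}) rmanifold \<Rightarrow> ('m, 'n) chart \<Rightarrow> 'm \<Rightarrow> real" where
  "vol_density M \<kappa> p = sqrt (det (gram M \<kappa> p))"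

definition mdiv :: "('m, 'n::{finite,wellorder}) rmanifold \<Rightarrow> ('m, 'n) vfield \<Rightarrow> 'm \<Rightarrow> real" where
  "mdiv M w p = (let \<kappa> = chart_at M p in
     (\<Sum>i\<in>UNIV. partial i ((\<lambda>q. vol_density M \<kappa> q * w \<kappa> q $ i) \<circ> chart_inv \<kappa>) (snd \<kappa> p))
       / vol_density M \<kappa> p)"

definition laplacian :: "('m, 'n::{finite,wellorder}) rmanifold \<Rightarrow> ('m \<Rightarrow> real) \<Rightarrow> 'm \<Rightarrow> real" where
  "laplacian M f = mdiv M (grad M f)"

text \<open>
  The unit vector orthogonal to the vectors tangent to the boundary (those with vanishing
  \<^term>\<open>bdir\<close>-component) and pointing out of the half-space. It is used at boundary points only.
\<close>

definition outward_normal :: "('m, 'n::{finite,wellorder}) rmanifold \<Rightarrow> ('m, 'n) vfield" where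
  "outward_normal M \<kappa> p = (THE v.
     v \<bullet> (gram M \<kappa> p *v v) = 1 \<and>
     (\<forall>u. u $ bdir = 0 \<longrightarrow> u \<bullet> (gram M \<kappa> p *v v) = 0) \<and>
     v $ bdir < 0)"

definition normal_deriv :: "('m, 'n::{finite,wellorder}) rmanifold \<Rightarrow> ('m \<Rightarrow> real) \<Rightarrow> 'm \<Rightarrow> real" where
  "normal_deriv M f p = ginner M (grad M f) (outward_normal M) p"

definition partition_of_unity ::
    "('m, 'n::{finite,wellorder}) rmanifold \<Rightarrow> ('m, 'n) chart set \<Rightarrow> (('m, 'n) chart \<Rightarrow> 'm \<Rightarrow> real) \<Rightarrow> bool" where
  "partition_of_unity M K \<rho> \<longleftrightarrow> finite K \<and> K \<subseteq> atlas M \<and>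
     (\<forall>\<kappa>\<in>K. \<rho> \<kappa> \<in> C_inf M \<and> (\<forall>p\<in>topspace (mspace M). 0 \<le> \<rho> \<kappa> p) \<and>
        (\<exists>S. compactin (mspace M) S \<and> S \<subseteq> fst \<kappa> \<and> (\<forall>p\<in>topspace (mspace M) - S. \<rho> \<kappa> p = 0))) \<and>
     (\<forall>p\<in>topspace (mspace M). (\<Sum>\<kappa>\<in>K. \<rho> \<kappa> p) = 1)"

text \<open>The integral with respect to the Riemannian volume, by a finite partition of unity.\<close>

definition mint :: "('m, 'n::{finite,wellorder}) rmanifold \<Rightarrow> ('m \<Rightarrow> real) \<Rightarrow> real" where
  "mint M f = (let (K, \<rho>) = (SOME (K, \<rho>). partition_of_unity M K \<rho>) in
     \<Sum>\<kappa>\<in>K. LINT x:(snd \<kappa> ` fst \<kappa>)|lborel.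
       ((\<lambda>q. \<rho> \<kappa> q * f q * vol_density M \<kappa> q) \<circ> chart_inv \<kappa>) x)"


section \<open>Onsager's variational principle\<close>

text \<open>
  Differentiability of a curve in \<^term>\<open>C_inf M\<close>, for the usual topology of uniform convergence of
  all derivatives on compact subsets of charts.
\<close>

definition has_curve_derivative ::
    "('m, 'n::{finite,wellorder}) rmanifold \<Rightarrow> (real \<Rightarrow> 'm \<Rightarrow> real) \<Rightarrow> ('m \<Rightarrow> real) \<Rightarrow> real \<Rightarrow> real set \<Rightarrow> bool" where
  "has_curve_derivative M c d t I \<longleftrightarrow> d \<in> C_inf M \<and>
     (\<forall>\<kappa>\<in>atlas M. \<forall>S is. compactin (mspace M) S \<and> S \<subseteq> fst \<kappa> \<longrightarrow>
        uniform_limit S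
          (\<lambda>s p. partials is ((\<lambda>q. (c s q - c t q) / (s - t)) \<circ> chart_inv \<kappa>) (snd \<kappa> p))
          (\<lambda>p. partials is (d \<circ> chart_inv \<kappa>) (snd \<kappa> p))
          (at t within I))"

text \<open>The differential is the directional (Gateaux) derivative.\<close>

definition differential :: "(('m \<Rightarrow> real) \<Rightarrow> real) \<Rightarrow> ('m \<Rightarrow> real) \<Rightarrow> ('m \<Rightarrow> real) \<Rightarrow> real" where
  "differential \<F> c h = deriv (\<lambda>\<epsilon>. \<F> (\<lambda>p. c p + \<epsilon> * h p)) 0"

definition rayleighian ::
    "(('m \<Rightarrow> real) \<Rightarrow> real) \<Rightarrow> (('m \<Rightarrow> real) \<Rightarrow> 'w \<Rightarrow> real) \<Rightarrow> (('m \<Rightarrow> real) \<Rightarrow> 'w \<Rightarrow> ('m \<Rightarrow> real))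
      \<Rightarrow> ('m \<Rightarrow> real) \<Rightarrow> 'w \<Rightarrow> real" where
  "rayleighian \<F> \<D> \<P> c w = differential \<F> c (\<P> c w) + \<D> c w"

definition OVP_solution ::
    "('m, 'n::{finite,wellorder}) rmanifold \<Rightarrow> ('m \<Rightarrow> real) set \<Rightarrow> (('m \<Rightarrow> real) \<Rightarrow> 'w set)
      \<Rightarrow> (('m \<Rightarrow> real) \<Rightarrow> real) \<Rightarrow> (('m \<Rightarrow> real) \<Rightarrow> 'w \<Rightarrow> real) \<Rightarrow> (('m \<Rightarrow> real) \<Rightarrow> 'w \<Rightarrow> ('m \<Rightarrow> real))
      \<Rightarrow> real set \<Rightarrow> (real \<Rightarrow> 'm \<Rightarrow> real) \<Rightarrow> bool" where
  "OVP_solution M Q E \<F> \<D> \<P> I c \<longleftrightarrow>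
     (\<forall>t\<in>I. c t \<in> Q) \<and>
     (\<forall>t\<in>I. \<exists>cdot v. has_curve_derivative M c cdot t I \<and>
        v \<in> E (c t) \<and>
        (\<forall>p\<in>topspace (mspace M). cdot p = \<P> (c t) v p) \<and>
        (\<forall>w\<in>E (c t). rayleighian \<F> \<D> \<P> (c t) v \<le> rayleighian \<F> \<D> \<P> (c t) w))"


section \<open>The Ginzburg--Landau energy and the two choices of data\<close>

definition ginzburg_landau ::
    "('m, 'n::{finite,wellorder}) rmanifold \<Rightarrow> real \<Rightarrow> (real \<Rightarrow> real) \<Rightarrow> ('m \<Rightarrow> real) \<Rightarrow> real" where
  "ginzburg_landau M \<alpha> F c =
     mint M (\<lambda>p. \<alpha> / 2 * ginner M (grad M c) (grad M c) p + F (c p))"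

definition AC_dissipation ::
    "('m, 'n::{finite,wellorder}) rmanifold \<Rightarrow> ('m \<Rightarrow> real) \<Rightarrow> ('m \<Rightarrow> real) \<Rightarrow> real" where
  "AC_dissipation M c w = 1 / 2 * mint M (\<lambda>p. (w p)\<^sup>2)"

definition inv_mobility_sqnorm ::
    "('m, 'n::{finite,wellorder}) rmanifold \<Rightarrow> ('m, 'n) mfield \<Rightarrow> ('m, 'n) vfield \<Rightarrow> 'm \<Rightarrow> real" where
  "inv_mobility_sqnorm M B w p =
     (let \<kappa> = chart_at M p in w \<kappa> p \<bullet> (matrix_inv (B \<kappa> p) *v w \<kappa> p))"

definition CH_dissipation ::
    "('m, 'n::{finite,wellorder}) rmanifold \<Rightarrow> ('m, 'n) mfield \<Rightarrow> ('m \<Rightarrow> real) \<Rightarrow> ('m, 'n) vfield \<Rightarrow> real" where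
  "CH_dissipation M B c w = 1 / 2 * mint M (inv_mobility_sqnorm M B w)"

definition CH_process_space ::
    "('m, 'n::{finite,wellorder}) rmanifold \<Rightarrow> ('m \<Rightarrow> real) \<Rightarrow> ('m, 'n) vfield set" where
  "CH_process_space M c =
     {w \<in> vector_fields M. \<forall>p\<in>mboundary M. ginner M w (outward_normal M) p = 0}"

definition mobility_flux ::
    "('m, 'n::{finite,wellorder}) mfield \<Rightarrow> ('m \<Rightarrow> real) \<Rightarrow> ('m, 'n) vfield" where
  "mobility_flux B \<mu> \<kappa> p = B \<kappa> p *v mdifferential \<mu> \<kappa> p"

definition chem_potential ::
    "('m, 'n::{finite,wellorder}) rmanifold \<Rightarrow> real \<Rightarrow> (real \<Rightarrow> real) \<Rightarrow> ('m \<Rightarrow> real) \<Rightarrow> 'm \<Rightarrow> real" where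
  "chem_potential M \<alpha> F c p = - \<alpha> * laplacian M c p + deriv F (c p)"


section \<open>Bounded domains\<close>

text \<open>
  The closure of a bounded domain with smooth boundary is a compact manifold with boundary, with the
  boundary-straightening diffeomorphisms as charts; the Euclidean metric is the Gram matrix of the
  inverse chart.
\<close>

definition straightening :: "('n::{finite,wellorder} vect) set \<Rightarrow> ('n vect) set \<Rightarrow> ('n vect \<Rightarrow> 'n vect) \<Rightarrow> bool" where
  "straightening \<Omega> V \<phi> \<longleftrightarrow>
     open V \<and> open (\<phi> ` V) \<and> inj_on \<phi> V \<and>
     smooth_on \<phi> V \<and> smooth_on (inv_into V \<phi>) (\<phi> ` V) \<and>
     \<phi> ` (V \<inter> \<Omega>) = \<phi> ` V \<inter> {x. 0 < x $ bdir} \<and>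
     \<phi> ` (V \<inter> frontier \<Omega>) = \<phi> ` V \<inter> {x. x $ bdir = 0}"

definition smooth_bounded_domain :: "('n::{finite,wellorder} vect) set \<Rightarrow> bool" where
  "smooth_bounded_domain \<Omega> \<longleftrightarrow>
     open \<Omega> \<and> connected \<Omega> \<and> \<Omega> \<noteq> {} \<and> bounded \<Omega> \<and>
     (\<forall>p\<in>frontier \<Omega>. \<exists>V \<phi>. p \<in> V \<and> straightening \<Omega> V \<phi>)"

definition domain_manifold :: "('n::{finite,wellorder} vect) set \<Rightarrow> ('n vect, 'n) rmanifold" where
  "domain_manifold \<Omega> = \<lparr>
     mspace = top_of_set (closure \<Omega>),
     atlas = {(V \<inter> closure \<Omega>, \<phi>) | V \<phi>. straightening \<Omega> V \<phi>},
     gram = (\<lambda>\<kappa> p. let J = hjacobian (chart_inv \<kappa>) (snd \<kappa> p) in transpose J ** J)\<rparr>"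

lemma hderiv_unique:
  fixes f :: "'n::{finite,wellorder} vect \<Rightarrow> 'b::real_normed_vector"
  assumes "(f has_derivative f') (at x within halfspace)" "(f has_derivative f'') (at x within halfspace)"
    and "x \<in> halfspace"
  shows "f' = f''"
proof (rule frechet_derivative_unique_within[OF assms(1,2)])
  fix i :: "'n vect" and e :: real
  assume i: "i \<in> Basis" and "e > 0"
  moreover have "0 \<le> i $ bdir" using i by (auto simp: Basis_vec_def axis_def)
  ultimately show "\<exists>d. 0 < \<bar>d\<bar> \<and> \<bar>d\<bar> < e \<and> x + d *\<^sub>R i \<in> halfspace"
    using assms(3) by (intro exI[of _ "e/2"]) (auto simp: halfspace_def)
qed

lemma hjacobian_eq:
  fixes f :: "'n::{finite,wellorder} vect \<Rightarrow> 'n vect"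
  assumes "(f has_derivative f') (at x within halfspace)" "x \<in> halfspace"
  shows "hjacobian f x = matrix f'"
proof -
  have "(f has_derivative hderiv f x) (at x within halfspace)"
    using assms(1) differentiableI frechet_derivative_works by blast
  then show ?thesis using hderiv_unique[OF _ assms(1,2)] by (simp add: jacobian_def)
qed

subsection \<open>Calculus of \<^const>\<open>Ck_on\<close>\<close>

lemma Ck_on_cong:
  assumes "open S" "\<And>x. x \<in> S \<Longrightarrow> f x = g x"
  shows "Ck_on k f S \<longleftrightarrow> Ck_on k g S"
  using assms
proof (induction k arbitrary: f g)
  case 0 then show ?case by (simp cong: continuous_on_cong)
next
  case (Suc k)
  have d: "(f has_derivative D) (at x) \<longleftrightarrow> (g has_derivative D) (at x)" if "x \<in> S" for x D
    using Suc.prems that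
    by (metis has_derivative_transform_within_open)
  have 1: "f differentiable (at x) \<longleftrightarrow> g differentiable (at x)" if "x \<in> S" for x
    using d[OF that] by (simp only: differentiable_def)
  have 2: "frechet_derivative f (at x) = frechet_derivative g (at x)" if "x \<in> S" for x
    using d[OF that] by (simp only: frechet_derivative_def)
  have 3: "Ck_on k (\<lambda>x. frechet_derivative f (at x) v) S \<longleftrightarrow> Ck_on k (\<lambda>x. frechet_derivative g (at x) v) S" for v
    using 2 by (intro Suc.IH Suc.prems) simp
  show ?case using 1 3 by (simp only: Ck_on.simps) blast
qed

lemma Ck_on_subset: "Ck_on k f S \<Longrightarrow> T \<subseteq> S \<Longrightarrow> Ck_on k f T"
  by (induction k arbitrary: f) (auto intro: continuous_on_subset)

lemma Ck_on_local:
  assumes "\<And>x. x \<in> S \<Longrightarrow> \<exists>U. open U \<and> x \<in> U \<and> Ck_on k f U"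
  shows "Ck_on k f S"
  using assms
proof (induction k arbitrary: f)
  case 0
  then show ?case
    by (metis Ck_on.simps(1) continuous_on_eq_continuous_at continuous_at_imp_continuous_on)
next
  case (Suc k) then show ?case by (metis Ck_on.simps(2))
qed

lemma Ck_on_SucD: "Ck_on (Suc k) f S \<Longrightarrow> Ck_on k f S"
proof (induction k arbitrary: f)
  case 0
  then show ?case
    by (auto intro!: continuous_at_imp_continuous_on differentiable_imp_continuous_within)
next
  case (Suc k) then show ?case by (metis Ck_on.simps(2))
qed

lemma Ck_on_const: "Ck_on k (\<lambda>x. c) S"
  by (induction k arbitrary: c) auto

lemma Ck_on_linear:
  assumes "bounded_linear f" shows "Ck_on k f S"
proof (cases k)
  case 0 then show ?thesis using assms by (simp add: linear_continuous_on)
next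
  case (Suc j)
  have D: "(f has_derivative f) (at x)" for x
    using assms by (rule bounded_linear_imp_has_derivative)
  have "frechet_derivative f (at x) = f" for x
    using frechet_derivative_at[OF D] by simp
  then show ?thesis using D Suc by (auto simp: Ck_on_const differentiable_def)
qed

lemma has_derivative_frechet: "f differentiable (at x) \<Longrightarrow> (f has_derivative frechet_derivative f (at x)) (at x)"
  by (simp add: frechet_derivative_works)

lemma Ck_on_add: "open S \<Longrightarrow> Ck_on k f S \<Longrightarrow> Ck_on k g S \<Longrightarrow> Ck_on k (\<lambda>x. f x + g x) S"
proof (induction k arbitrary: f g)
  case 0 then show ?case by (simp add: continuous_on_add)
next
  case (Suc k)
  have "frechet_derivative (\<lambda>x. f x + g x) (at x) v
      = frechet_derivative f (at x) v + frechet_derivative g (at x) v" if "x \<in> S" for x v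
    using Suc.prems that
    by (intro frechet_derivative_at[symmetric, THEN fun_cong] has_derivative_add has_derivative_frechet) auto
  then have "Ck_on k (\<lambda>x. frechet_derivative (\<lambda>x. f x + g x) (at x) v) S \<longleftrightarrow>
      Ck_on k (\<lambda>x. frechet_derivative f (at x) v + frechet_derivative g (at x) v) S" for v
    by (intro Ck_on_cong Suc.prems)
  then show ?case using Suc.prems by (simp add: Suc.IH)
qed

lemma Ck_on_sum:
  assumes "open S"
  shows "finite A \<Longrightarrow> (\<And>i. i \<in> A \<Longrightarrow> Ck_on k (f i) S) \<Longrightarrow> Ck_on k (\<lambda>x. \<Sum>i\<in>A. f i x) S"
proof (induction A rule: finite_induct)
  case empty show ?case by (simp add: Ck_on_const)
next
  case (insert i A) then show ?case using assms by (simp add: Ck_on_add)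
qed

lemma Ck_on_bilinear:
  assumes "bounded_bilinear \<beta>"
  shows "open S \<Longrightarrow> Ck_on k f S \<Longrightarrow> Ck_on k g S \<Longrightarrow> Ck_on k (\<lambda>x. \<beta> (f x) (g x)) S"
proof (induction k arbitrary: f g)
  case 0 then show ?case using bounded_bilinear.continuous_on[OF assms] by simp
next
  case (Suc k)
  have D: "((\<lambda>x. \<beta> (f x) (g x)) has_derivative
       (\<lambda>v. \<beta> (f x) (frechet_derivative g (at x) v) + \<beta> (frechet_derivative f (at x) v) (g x))) (at x)"
    if "x \<in> S" for x
    using Suc.prems that by (intro bounded_bilinear.FDERIV[OF assms] has_derivative_frechet) auto
  have eq: "frechet_derivative (\<lambda>x. \<beta> (f x) (g x)) (at x) v
      = \<beta> (f x) (frechet_derivative g (at x) v) + \<beta> (frechet_derivative f (at x) v) (g x)"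
    if "x \<in> S" for x v
    using fun_cong[OF frechet_derivative_at[OF D[OF that]], of v] by simp
  have "Ck_on k f S" "Ck_on k g S" using Suc.prems(2,3) by (simp_all only: Ck_on_SucD)
  then have 1: "Ck_on k (\<lambda>x. \<beta> (f x) (frechet_derivative g (at x) v) + \<beta> (frechet_derivative f (at x) v) (g x)) S" for v
    using Suc.prems by (intro Ck_on_add Suc.IH) simp_all
  have "Ck_on k (\<lambda>x. frechet_derivative (\<lambda>x. \<beta> (f x) (g x)) (at x) v) S" for v
    by (rule iffD2[OF Ck_on_cong[OF Suc.prems(1) eq] 1])
  moreover have "\<forall>x\<in>S. (\<lambda>x. \<beta> (f x) (g x)) differentiable (at x)"
    using D unfolding differentiable_def by blast
  ultimately show ?case by simp
qed

lemma Ck_on_compose: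
  fixes g :: "'a::real_normed_vector \<Rightarrow> 'b::euclidean_space" and f :: "'b \<Rightarrow> 'c::real_normed_vector"
  assumes "open S" "open T" "g ` S \<subseteq> T"
  shows "Ck_on k f T \<Longrightarrow> Ck_on k g S \<Longrightarrow> Ck_on k (f \<circ> g) S"
proof (induction k arbitrary: f)
  case 0 then show ?case using assms(3) by (metis Ck_on.simps(1) continuous_on_compose continuous_on_subset)
next
  case (Suc k)
  have D: "(f \<circ> g has_derivative frechet_derivative f (at (g x)) \<circ> frechet_derivative g (at x)) (at x)"
    if "x \<in> S" for x
    using Suc.prems that assms by (intro diff_chain_at has_derivative_frechet) auto
  have eq: "frechet_derivative (f \<circ> g) (at x) v =
      (\<Sum>b\<in>Basis. (frechet_derivative g (at x) v \<bullet> b) *\<^sub>R (((\<lambda>y. frechet_derivative f (at y) b) \<circ> g) x))"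
    if "x \<in> S" for x v
  proof -
    have lin: "linear (frechet_derivative f (at (g x)))"
      using Suc.prems that assms by (intro linear_frechet_derivative) auto
    have "frechet_derivative (f \<circ> g) (at x) v
        = frechet_derivative f (at (g x)) (\<Sum>b\<in>Basis. (frechet_derivative g (at x) v \<bullet> b) *\<^sub>R b)"
      using fun_cong[OF frechet_derivative_at[OF D[OF that]], of v] by (simp add: euclidean_representation)
    then show ?thesis by (simp add: linear_sum[OF lin] linear_scale[OF lin])
  qed
  have gk: "Ck_on k g S" using Suc.prems(2) by (rule Ck_on_SucD)
  have 1: "Ck_on k (\<lambda>x. \<Sum>b\<in>Basis. (frechet_derivative g (at x) v \<bullet> b) *\<^sub>R
      (((\<lambda>y. frechet_derivative f (at y) b) \<circ> g) x)) S" for v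
  proof (intro Ck_on_sum assms(1) finite_Basis Ck_on_bilinear[OF bounded_bilinear_scaleR]
      Ck_on_bilinear[OF bounded_bilinear_inner] Ck_on_const)
    show "Ck_on k (\<lambda>x. frechet_derivative g (at x) v) S" using Suc.prems by simp
    fix b :: 'b
    have "Ck_on k ((\<lambda>y. frechet_derivative f (at y) b) \<circ> g) S"
      using Suc.prems gk by (intro Suc.IH) simp_all
    then show "Ck_on k (\<lambda>x. ((\<lambda>y. frechet_derivative f (at y) b) \<circ> g) x) S"
      by (simp only: comp_def)
  qed
  have "Ck_on k (\<lambda>x. frechet_derivative (f \<circ> g) (at x) v) S" for v
    by (rule iffD2[OF Ck_on_cong[OF assms(1) eq] 1])
  moreover have "\<forall>x\<in>S. (f \<circ> g) differentiable (at x)"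
    using D unfolding differentiable_def by blast
  ultimately show ?case unfolding Ck_on.simps by blast
qed

lemma smooth_on_open:
  assumes "open S" shows "smooth_on f S \<longleftrightarrow> (\<forall>k. Ck_on k f S)"
proof
  assume f: "smooth_on f S"
  show "\<forall>k. Ck_on k f S"
  proof (intro allI Ck_on_local)
    fix k x assume "x \<in> S"
    then obtain U g where "open U" "x \<in> U" "Ck_on k g U" "\<forall>y\<in>S \<inter> U. g y = f y"
      using f unfolding smooth_on_def by blast
    then show "\<exists>U. open U \<and> x \<in> U \<and> Ck_on k f U"
      using \<open>x \<in> S\<close> assms Ck_on_cong[of "S \<inter> U" g f k]
      by (intro exI[of _ "S \<inter> U"]) (auto intro: Ck_on_subset)
  qed
qed (use assms in \<open>auto simp: smooth_on_def\<close>)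

lemma smooth_onI:
  assumes "open U" "S \<subseteq> U" "\<And>k. Ck_on k g U" "\<And>x. x \<in> S \<Longrightarrow> g x = f x"
  shows "smooth_on f S"
  using assms unfolding smooth_on_def by blast


subsection \<open>The manifold structure on the closure of a domain\<close>

lemma straighteningD:
  assumes "straightening \<Omega> V \<phi>"
  shows "open V" "open (\<phi> ` V)" "inj_on \<phi> V"
    and "\<And>k. Ck_on k \<phi> V" "\<And>k. Ck_on k (inv_into V \<phi>) (\<phi> ` V)"
    and "\<phi> ` (V \<inter> closure \<Omega>) = \<phi> ` V \<inter> halfspace"
    and "\<And>x. x \<in> \<phi> ` (V \<inter> closure \<Omega>) \<Longrightarrow> inv_into (V \<inter> closure \<Omega>) \<phi> x = inv_into V \<phi> x"
proof -
  show o: "open V" "open (\<phi> ` V)" and i: "inj_on \<phi> V"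
    using assms by (simp_all add: straightening_def)
  show "Ck_on k \<phi> V" "Ck_on k (inv_into V \<phi>) (\<phi> ` V)" for k
    using assms o by (simp_all add: straightening_def smooth_on_open)
  have "V \<inter> closure \<Omega> = (V \<inter> \<Omega>) \<union> (V \<inter> frontier \<Omega>)"
    by (auto simp: closure_Un_frontier)
  then have "\<phi> ` (V \<inter> closure \<Omega>) = \<phi> ` (V \<inter> \<Omega>) \<union> \<phi> ` (V \<inter> frontier \<Omega>)"
    by (simp only: image_Un)
  then show "\<phi> ` (V \<inter> closure \<Omega>) = \<phi> ` V \<inter> halfspace"
    using assms by (auto simp: straightening_def halfspace_def)
  show "inv_into (V \<inter> closure \<Omega>) \<phi> x = inv_into V \<phi> x" if "x \<in> \<phi> ` (V \<inter> closure \<Omega>)" for x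
  proof -
    from that obtain p where p: "p \<in> V \<inter> closure \<Omega>" "x = \<phi> p" by blast
    then show ?thesis using i inj_on_subset[OF i, of "V \<inter> closure \<Omega>"] by simp
  qed
qed

lemma within_halfspace_derivative:
  assumes "(g has_derivative D) (at x)" "open W" "x \<in> W" "x \<in> halfspace"
    and "\<And>y. y \<in> W \<inter> halfspace \<Longrightarrow> f y = g y"
  shows "(f has_derivative D) (at x within halfspace)"
proof -
  have "eventually (\<lambda>y. y \<in> W) (at x within halfspace)"
    using assms(2,3) by (auto simp: eventually_at_topological)
  moreover have "eventually (\<lambda>y. y \<in> halfspace) (at x within halfspace)"
    by (simp add: eventually_at_filter)
  ultimately have "\<forall>\<^sub>F y in at x within halfspace. g y = f y"
    by eventually_elim (simp add: assms(5))
  then show ?thesis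
    using has_derivative_transform_eventually[OF has_derivative_at_withinI[OF assms(1)]] assms(3-5)
    by simp
qed

lemma spd_gram:
  assumes "\<And>x. x \<noteq> 0 \<Longrightarrow> J *v x \<noteq> 0"
  shows "spd (transpose J ** (J :: 'n::{finite,wellorder} mat))"
proof -
  have "x \<bullet> ((transpose J ** J) *v x) = (J *v x) \<bullet> (J *v x)" for x
    by (simp only: matrix_vector_mul_assoc[symmetric] transpose_matrix_vector)
      (metis dot_lmul_matrix inner_commute)
  then show ?thesis using assms by (simp add: spd_def matrix_transpose_mul)
qed

lemma straightening_derivative:
  assumes "straightening \<Omega> V \<phi>" "x \<in> \<phi> ` (V \<inter> closure \<Omega>)"
  defines "D \<equiv> frechet_derivative (inv_into V \<phi>) (at x)"
  shows "(inv_into V \<phi> has_derivative D) (at x)"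
    and "hjacobian (chart_inv (V \<inter> closure \<Omega>, \<phi>)) x = matrix D"
    and "\<And>v. matrix D *v v = D v"
    and "\<And>v. v \<noteq> 0 \<Longrightarrow> D v \<noteq> 0"
proof -
  note S = straighteningD[OF assms(1)]
  have x: "x \<in> \<phi> ` V" "x \<in> halfspace" using S(6) assms(2) by auto
  show D: "(inv_into V \<phi> has_derivative D) (at x)"
    unfolding D_def using S(5)[of "Suc 0"] x(1) unfolding Ck_on.simps by (blast intro: has_derivative_frechet)
  show "hjacobian (chart_inv (V \<inter> closure \<Omega>, \<phi>)) x = matrix D"
    using S(6,7) x(2)
    by (intro hjacobian_eq within_halfspace_derivative[OF D S(2) x]) (simp_all add: chart_inv_def)
  show "matrix D *v v = D v" for v
    using D by (simp add: has_derivative_linear matrix_works)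
  show "D v \<noteq> 0" if "v \<noteq> 0" for v
  proof
    assume "D v = 0"
    let ?p = "inv_into V \<phi> x"
    have p: "?p \<in> V" using x(1) by (rule inv_into_into)
    have E: "(\<phi> has_derivative frechet_derivative \<phi> (at ?p)) (at ?p)"
      using S(4)[of "Suc 0"] p unfolding Ck_on.simps by (blast intro: has_derivative_frechet)
    have "((\<lambda>y. y) has_derivative frechet_derivative \<phi> (at ?p) \<circ> D) (at x)"
      using diff_chain_at[OF D E] S(2) x(1)
      by (rule has_derivative_transform_within_open) (simp add: f_inv_into_f)
    then have "frechet_derivative \<phi> (at ?p) \<circ> D = (\<lambda>v. v)"
      using has_derivative_unique has_derivative_ident by blast
    then have "frechet_derivative \<phi> (at ?p) (D v) = v" by (metis comp_apply)
    moreover have "frechet_derivative \<phi> (at ?p) 0 = 0"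
      using linear_0[OF has_derivative_linear[OF E]] .
    ultimately show False using \<open>D v = 0\<close> that by simp
  qed
qed

lemma straightening_transition:
  assumes "straightening \<Omega> V \<phi>" "straightening \<Omega> V' \<phi>'"
  defines "W \<equiv> \<phi> ` (V \<inter> V')" and "g \<equiv> \<phi>' \<circ> inv_into V \<phi>"
  shows "open W" "\<And>k. Ck_on k g W"
    and "\<And>x. x \<in> W \<inter> halfspace \<Longrightarrow> transition (V \<inter> closure \<Omega>, \<phi>) (V' \<inter> closure \<Omega>, \<phi>') x = g x"
    and "\<And>x. x \<in> W \<Longrightarrow> inv_into V' \<phi>' (g x) = inv_into V \<phi> x"
    and "\<phi> ` ((V \<inter> closure \<Omega>) \<inter> (V' \<inter> closure \<Omega>)) \<subseteq> W \<inter> halfspace"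
proof -
  note S = straighteningD[OF assms(1)] and S' = straighteningD[OF assms(2)]
  have "W = \<phi> ` V \<inter> inv_into V \<phi> -` V'"
    using S(3) unfolding W_def by (auto simp: inv_into_f_f)
  then show W: "open W"
    using S(5)[of 0] S(2) S'(1) by (simp add: continuous_on_open_vimage Int_commute)
  have sub: "inv_into V \<phi> ` W \<subseteq> V'" "W \<subseteq> \<phi> ` V" using S(3) by (auto simp: W_def inv_into_f_f)
  show "Ck_on k g W" for k
    unfolding g_def using Ck_on_compose[OF W S'(1) sub(1) S'(4) Ck_on_subset[OF S(5) sub(2)]] .
  show "transition (V \<inter> closure \<Omega>, \<phi>) (V' \<inter> closure \<Omega>, \<phi>') x = g x" if "x \<in> W \<inter> halfspace" for x
  proof -
    have "x \<in> \<phi> ` (V \<inter> closure \<Omega>)" using that sub(2) S(6) by auto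
    then show ?thesis using S(7) by (simp add: transition_def g_def chart_inv_def)
  qed
  show "inv_into V' \<phi>' (g x) = inv_into V \<phi> x" if "x \<in> W" for x
    using that sub(1) S'(3) by (auto simp: g_def intro: inv_into_f_f)
  show "\<phi> ` ((V \<inter> closure \<Omega>) \<inter> (V' \<inter> closure \<Omega>)) \<subseteq> W \<inter> halfspace"
    using S(6) by (auto simp: W_def)
qed

lemma straightening_interior:
  assumes "open \<Omega>" "p \<in> \<Omega>"
  shows "\<exists>V \<phi>. p \<in> V \<and> straightening \<Omega> V (\<phi> :: 'n::{finite,wellorder} vect \<Rightarrow> _)"
proof -
  obtain r where r: "r > 0" "ball p r \<subseteq> \<Omega>" using assms open_contains_ball by blast
  define a :: "'n vect" where "a = (\<chi> i. r + \<bar>p $ bdir\<bar>)"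
  let ?V = "ball p r" and ?\<phi> = "(+) a"
  have pos: "0 < x $ bdir" if "x \<in> ?\<phi> ` ?V" for x
  proof -
    from that obtain y where y: "x = a + y" "y \<in> ?V" by blast
    have "\<bar>(p - y) $ bdir\<bar> < r"
      using y(2) component_le_norm_cart[of "p - y" bdir] by (simp add: dist_norm)
    then show ?thesis by (auto simp: y(1) a_def)
  qed
  have fr: "?V \<inter> frontier \<Omega> = {}" using assms(1) r(2) by (auto simp: frontier_def interior_open)
  have inv: "inv_into ?V ?\<phi> x = - a + x" if "x \<in> ?\<phi> ` ?V" for x
  proof -
    from that obtain y where "y \<in> ?V" "x = a + y" by blast
    then show ?thesis using inv_into_f_f[of ?\<phi> ?V y] by simp
  qed
  have o: "open (?\<phi> ` ?V)" by (intro open_translation open_ball)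
  have sm: "Ck_on k ((+) b) S" if "open S" for k S and b :: "'n vect"
    using Ck_on_add[OF that Ck_on_const Ck_on_linear[OF bounded_linear_ident]] by simp
  have "smooth_on ?\<phi> ?V" using sm by (simp add: smooth_on_open)
  moreover have "smooth_on (inv_into ?V ?\<phi>) (?\<phi> ` ?V)"
    using inv by (intro smooth_onI[OF o subset_refl sm[OF o]]) simp
  moreover have "?V \<inter> \<Omega> = ?V" using r(2) by blast
  ultimately have "straightening \<Omega> ?V ?\<phi>"
    using o fr pos by (fastforce simp: straightening_def)
  then show ?thesis using r(1) by (meson centre_in_ball)
qed

lemma second_countable_euclidean: "second_countable (euclidean :: 'a::second_countable_topology topology)"
proof -
  obtain B :: "'a set set" where "countable B" "topological_basis B" using ex_countable_basis by blast
  then show ?thesis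
    unfolding second_countable_def
    by (metis open_openin topological_basisE topological_basis_open)
qed

lemma matrix_expansion:
  "(\<Sum>i\<in>UNIV. \<Sum>j\<in>UNIV. a i j *\<^sub>R axis i (axis j (1::real))) = (\<chi> i j. a i j)"
proof -
  have "(a i j *\<^sub>R axis i (axis j (1::real))) $ k $ l = (if j = l then (if i = k then a i j else 0) else 0)" for i j k l
    by (simp add: axis_def)
  then show ?thesis by (simp add: vec_eq_iff)
qed

theorem compact_riemannian_manifold_domain:
  assumes "smooth_bounded_domain \<Omega>"
  shows "compact_riemannian_manifold (domain_manifold \<Omega>)"
proof -
  let ?X = "top_of_set (closure \<Omega>)"
  let ?K = "\<lambda>V \<phi>. (V \<inter> closure \<Omega>, \<phi>)"
  have \<Omega>: "open \<Omega>" "bounded \<Omega>" using assms by (auto simp: smooth_bounded_domain_def)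
  have ex: "\<exists>V \<phi>. p \<in> V \<and> straightening \<Omega> V \<phi>" if "p \<in> closure \<Omega>" for p
  proof (cases "p \<in> \<Omega>")
    case True then show ?thesis by (rule straightening_interior[OF \<Omega>(1)])
  next
    case False
    then have "p \<in> frontier \<Omega>" using that by (simp add: closure_Un_frontier)
    then show ?thesis using assms unfolding smooth_bounded_domain_def by blast
  qed
  have at: "\<kappa> \<in> atlas (domain_manifold \<Omega>) \<longleftrightarrow> (\<exists>V \<phi>. \<kappa> = ?K V \<phi> \<and> straightening \<Omega> V \<phi>)" for \<kappa>
    by (simp add: domain_manifold_def)
  have chart: "is_chart ?X (?K V \<phi>)" if st: "straightening \<Omega> V \<phi>" for V \<phi>
  proof -
    note S = straighteningD[OF st]
    have "homeomorphic_maps (top_of_set (V \<inter> closure \<Omega>)) (top_of_set (\<phi> ` (V \<inter> closure \<Omega>))) \<phi> (inv_into (V \<inter> closure \<Omega>) \<phi>)"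
    proof -
      have i: "inj_on \<phi> (V \<inter> closure \<Omega>)" using S(3) inj_on_subset by blast
      have "continuous_on (V \<inter> closure \<Omega>) \<phi>" using S(4)[of 0] continuous_on_subset by fastforce
      moreover have "continuous_on (\<phi> ` (V \<inter> closure \<Omega>)) (inv_into (V \<inter> closure \<Omega>) \<phi>)"
        using S(5)[of 0] S(7) continuous_on_subset[of "\<phi> ` V" "inv_into V \<phi>" "\<phi> ` (V \<inter> closure \<Omega>)"]
        by (subst continuous_on_cong[OF refl]) auto
      ultimately show ?thesis
        unfolding homeomorphic_maps_def using i
        by (auto simp: inv_into_f_f f_inv_into_f inv_into_into)
    qed
    moreover have "subtopology ?X (V \<inter> closure \<Omega>) = top_of_set (V \<inter> closure \<Omega>)"
      by (simp add: subtopology_subtopology Int_absorb1)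
    moreover have "openin ?X (V \<inter> closure \<Omega>)"
      using S(1) by (metis Int_commute openin_open_Int)
    moreover have "openin (top_of_set halfspace) (\<phi> ` (V \<inter> closure \<Omega>))"
      unfolding S(6) using S(2) by (metis Int_commute openin_open_Int)
    ultimately show ?thesis by (auto simp: is_chart_def homeomorphic_map_maps)
  qed
  have tr: "smooth_on (transition (?K V \<phi>) (?K V' \<phi>')) (\<phi> ` ((V \<inter> closure \<Omega>) \<inter> (V' \<inter> closure \<Omega>)))"
    if st: "straightening \<Omega> V \<phi>" "straightening \<Omega> V' \<phi>'" for V \<phi> V' \<phi>'
    using straightening_transition[OF st]
    by (intro smooth_onI[of "\<phi> ` (V \<inter> V')" _ "\<phi>' \<circ> inv_into V \<phi>"]) (auto simp del: comp_apply)
  have gram: "gram (domain_manifold \<Omega>) (?K V \<phi>) p =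
      transpose (matrix (frechet_derivative (inv_into V \<phi>) (at (\<phi> p)))) **
        matrix (frechet_derivative (inv_into V \<phi>) (at (\<phi> p)))"
    if "straightening \<Omega> V \<phi>" "p \<in> V \<inter> closure \<Omega>" for V \<phi> p
    using straightening_derivative(2)[OF that(1) imageI[OF that(2)]]
    by (simp add: domain_manifold_def Let_def)
  have spd: "spd (gram (domain_manifold \<Omega>) (?K V \<phi>) p)"
    if st: "straightening \<Omega> V \<phi>" "p \<in> V \<inter> closure \<Omega>" for V \<phi> p
    unfolding gram[OF st]
    using straightening_derivative(3,4)[OF st(1) imageI[OF st(2)]] by (intro spd_gram) simp
  have compat: "gram (domain_manifold \<Omega>) (?K V \<phi>) p =
      transpose (transition_jac (?K V \<phi>) (?K V' \<phi>') p) ** gram (domain_manifold \<Omega>) (?K V' \<phi>') p **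
        transition_jac (?K V \<phi>) (?K V' \<phi>') p"
    if st: "straightening \<Omega> V \<phi>" "straightening \<Omega> V' \<phi>'"
      and p: "p \<in> V \<inter> closure \<Omega>" "p \<in> V' \<inter> closure \<Omega>" for V \<phi> V' \<phi>' p
  proof -
    let ?g = "\<phi>' \<circ> inv_into V \<phi>" and ?x = "\<phi> p"
    let ?D = "frechet_derivative (inv_into V \<phi>) (at ?x)"
    let ?D' = "frechet_derivative (inv_into V' \<phi>') (at (\<phi>' p))"
    let ?T = "frechet_derivative ?g (at ?x)"
    note T = straightening_transition[OF st]
    note DD = straightening_derivative[OF st(1) imageI[OF p(1)]]
    note DD' = straightening_derivative[OF st(2) imageI[OF p(2)]]
    have x: "?x \<in> \<phi> ` (V \<inter> V')" "?x \<in> halfspace" using T(5) p by auto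
    have gx: "?g ?x = \<phi>' p" using straighteningD(3)[OF st(1)] p by (simp add: inv_into_f_f)
    have g: "(?g has_derivative ?T) (at ?x)"
      using T(2)[of "Suc 0"] x(1) unfolding Ck_on.simps by (blast intro: has_derivative_frechet)
    have "(inv_into V' \<phi>' \<circ> ?g has_derivative ?D' \<circ> ?T) (at ?x)"
      using g DD'(1) unfolding gx[symmetric] by (rule diff_chain_at)
    then have "(inv_into V \<phi> has_derivative ?D' \<circ> ?T) (at ?x)"
      using T(1) x(1) by (rule has_derivative_transform_within_open) (use T(4) in auto)
    then have "?D = ?D' \<circ> ?T" using DD(1) has_derivative_unique by blast
    then have "matrix ?D = matrix ?D' ** matrix ?T"
      using g DD'(1) by (simp add: matrix_compose has_derivative_linear)
    moreover have "transition_jac (?K V \<phi>) (?K V' \<phi>') p = matrix ?T"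
      unfolding transition_jac_def snd_conv
      by (intro hjacobian_eq within_halfspace_derivative[OF g T(1) x T(3)] x(2))
    ultimately show ?thesis
      unfolding gram[OF st(1) p(1)] gram[OF st(2) p(2)]
      by (simp add: matrix_transpose_mul matrix_mul_assoc)
  qed
  have smooth: "smooth_on (gram (domain_manifold \<Omega>) (?K V \<phi>) \<circ> chart_inv (?K V \<phi>)) (\<phi> ` (V \<inter> closure \<Omega>))"
    if st: "straightening \<Omega> V \<phi>" for V \<phi>
  proof -
    note S = straighteningD[OF st]
    define G :: "'a vect \<Rightarrow> 'a mat" where
      "G = (\<lambda>x. \<Sum>i\<in>UNIV. \<Sum>j\<in>UNIV.
         (frechet_derivative (inv_into V \<phi>) (at x) (axis i 1) \<bullet>
          frechet_derivative (inv_into V \<phi>) (at x) (axis j 1)) *\<^sub>R axis i (axis j 1))"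
    have "Ck_on k (\<lambda>x. frechet_derivative (inv_into V \<phi>) (at x) v) (\<phi> ` V)" for k v
      using S(5)[of "Suc k"] by simp
    then have "Ck_on k G (\<phi> ` V)" for k
      unfolding G_def
      by (intro Ck_on_sum S(2) finite_class.finite_UNIV Ck_on_bilinear[OF bounded_bilinear_scaleR]
          Ck_on_bilinear[OF bounded_bilinear_inner] Ck_on_const)
    moreover have "G x = (gram (domain_manifold \<Omega>) (?K V \<phi>) \<circ> chart_inv (?K V \<phi>)) x"
      if x: "x \<in> \<phi> ` (V \<inter> closure \<Omega>)" for x
    proof -
      have p: "chart_inv (?K V \<phi>) x \<in> V \<inter> closure \<Omega>" "\<phi> (chart_inv (?K V \<phi>) x) = x"
        using inv_into_into[OF x] f_inv_into_f[OF x] by (simp_all add: chart_inv_def)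
      show ?thesis
        unfolding comp_apply gram[OF st p(1)] p(2) G_def matrix_expansion
        by (simp add: vec_eq_iff matrix_matrix_mult_def transpose_def matrix_def inner_vec_def)
    qed
    ultimately show ?thesis
      using S(2,6) by (intro smooth_onI[of "\<phi> ` V" _ G]) (auto simp del: comp_apply)
  qed
  have X: "mspace (domain_manifold \<Omega>) = ?X" by (simp add: domain_manifold_def)
  show ?thesis
    unfolding compact_riemannian_manifold_def smooth_components_def X
  proof (intro conjI ballI)
    show "Hausdorff_space ?X" by (simp add: Hausdorff_space_subtopology)
    show "second_countable ?X"
      by (simp add: second_countable_subtopology second_countable_euclidean)
    show "compact_space ?X"
      using \<Omega>(2) by (intro compact_space_subtopology) (simp add: compact_closure)
    show "(\<Union>\<kappa>\<in>atlas (domain_manifold \<Omega>). fst \<kappa>) = topspace ?X"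
    proof
      show "(\<Union>\<kappa>\<in>atlas (domain_manifold \<Omega>). fst \<kappa>) \<subseteq> topspace ?X"
        by (auto simp: domain_manifold_def)
      show "topspace ?X \<subseteq> (\<Union>\<kappa>\<in>atlas (domain_manifold \<Omega>). fst \<kappa>)"
      proof
        fix p assume "p \<in> topspace ?X"
        then have p: "p \<in> closure \<Omega>" by simp
        then obtain V \<phi> where "p \<in> V" "straightening \<Omega> V \<phi>" using ex by blast
        then show "p \<in> (\<Union>\<kappa>\<in>atlas (domain_manifold \<Omega>). fst \<kappa>)"
          using p at by (intro UN_I[of "?K V \<phi>"]) auto
      qed
    qed
  next
    fix \<kappa> assume "\<kappa> \<in> atlas (domain_manifold \<Omega>)"
    then obtain V \<phi> where K: "\<kappa> = ?K V \<phi>" and st: "straightening \<Omega> V \<phi>" unfolding at by blast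
    show "is_chart ?X \<kappa>" unfolding K by (rule chart[OF st])
    show "smooth_on (gram (domain_manifold \<Omega>) \<kappa> \<circ> chart_inv \<kappa>) (snd \<kappa> ` fst \<kappa>)"
      unfolding K fst_conv snd_conv by (rule smooth[OF st])
    show "spd (gram (domain_manifold \<Omega>) \<kappa> p)" if "p \<in> fst \<kappa>" for p
      using that spd[OF st] by (simp add: K)
    fix \<kappa>' assume "\<kappa>' \<in> atlas (domain_manifold \<Omega>)"
    then obtain V' \<phi>' where K': "\<kappa>' = ?K V' \<phi>'" and st': "straightening \<Omega> V' \<phi>'" unfolding at by blast
    show "smooth_on (transition \<kappa> \<kappa>') (snd \<kappa> ` (fst \<kappa> \<inter> fst \<kappa>'))"
      unfolding K K' fst_conv snd_conv by (rule tr[OF st st'])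
    show "gram (domain_manifold \<Omega>) \<kappa> p =
        transpose (transition_jac \<kappa> \<kappa>' p) ** gram (domain_manifold \<Omega>) \<kappa>' p ** transition_jac \<kappa> \<kappa>' p"
      if "p \<in> fst \<kappa> \<inter> fst \<kappa>'" for p
      unfolding K K' by (rule compat[OF st st']) (use that in \<open>auto simp: K K'\<close>)
  qed
qed

end

theory Submission
  imports Defs
begin

text \<open>
  A minimiser of the Rayleighian over a linear space of process variables is a critical point of it,
  so both parts reduce to a weak equation, from which the differential equation is read off in the
  interior and the boundary condition at the boundary.

  The differential of the energy at \<open>c\<close> in the direction \<open>h\<close> is the integral of
  \<open>\<alpha> \<nabla>c \<cdot> \<nabla>h + F'(c) h\<close>, that is, of \<open>\<alpha> div (h \<nabla>c) + h \<mu>\<close>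
  with the chemical potential \<open>\<mu> = - \<alpha> \<Delta>c + F'(c)\<close>
  (\<open>differential_by_parts\<close>). No integral over the boundary is ever formed. In a chart, the
  integral of the divergence of a compactly supported field is the integral of the normal derivative of
  its first flux component over the half-space; it vanishes if the field is tangent to the boundary,
  and it is negative if the field points inwards at some boundary point and
  outwards nowhere. These two facts do the work of the boundary integral.

  For Allen--Cahn the weak equation reads \<open>\<integral> \<alpha> div (h \<nabla>c) + h (\<mu> + v) = 0\<close> for all
  smooth \<open>h\<close>. Bumps supported in the interior give \<open>v = - \<mu>\<close>; what remains is
  \<open>\<integral> div (h \<nabla>c) = 0\<close>, and bumps at the boundary force \<open>\<nabla>c\<close> to be tangent
  (\<open>weakly_tangent\<close>).

  For Cahn--Hilliard a second integration by parts, licensed by the tangency of the test field \<open>w\<close>,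
  turns the weak equation, with the mobility \<open>B\<close>, into
  \<open>\<integral> - \<alpha> div ((div w) \<nabla>c) + w \<cdot> (d\<mu> + B\<^sup>-\<^sup>1 v) = 0\<close>. Interior test
  fields give \<open>v = - B d\<mu>\<close>, whose tangency is the second boundary condition. The remaining
  term involves \<open>\<nabla>c\<close> only through the boundary values of \<open>div w\<close>, and these are
  arbitrary although \<open>w\<close> is tangent: the first component \<open>x\<^sub>1 b\<close> has divergence
  \<open>b\<close> at the boundary (\<open>mdiv_boundary_bump\<close>).

  To be able to integrate by parts on the manifold one needs that the integral, which is defined by
  some partition of unity, is the coordinate integral for functions supported in one chart
  (\<open>mint_chart\<close>, by the change of variables theorem; \<open>partition_of_unity_exists\<close> shows
  that there is a partition to choose), and that the coordinate divergence does not depend on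
  the chart. The latter follows from the former by duality (\<open>chart_div_invariant\<close>).
\<close>

section \<open>Calculus of smooth maps on arbitrary sets\<close>

lemma smooth_onE:
  assumes "smooth_on f S" "x \<in> S"
  obtains U g where "open U" "x \<in> U" "\<forall>k. Ck_on k g U" "\<forall>y\<in>S \<inter> U. g y = f y"
proof -
  have "\<exists>U g. open U \<and> x \<in> U \<and> (\<forall>k. Ck_on k g U) \<and> (\<forall>y\<in>S \<inter> U. g y = f y)"
    using assms unfolding smooth_on_def by (rule bspec)
  then show thesis by (elim exE conjE) (rule that)
qed

lemma smooth_on_subset:
  assumes "smooth_on f S" "T \<subseteq> S" shows "smooth_on f T"
  unfolding smooth_on_def
proof
  fix x assume "x \<in> T"
  then have "x \<in> S" using assms(2) by blast
  then obtain U h where "open U" "x \<in> U" "\<forall>k. Ck_on k h U" "\<forall>y\<in>S \<inter> U. h y = f y"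
    by (rule smooth_onE[OF assms(1)])
  then show "\<exists>U h. open U \<and> x \<in> U \<and> (\<forall>k. Ck_on k h U) \<and> (\<forall>y\<in>T \<inter> U. h y = f y)"
    using assms(2) by (intro exI[of _ U] exI[of _ h]) auto
qed

lemma smooth_on_transform:
  assumes "smooth_on f S" "\<And>x. x \<in> S \<Longrightarrow> f x = g x" shows "smooth_on g S"
  unfolding smooth_on_def
proof
  fix x assume "x \<in> S"
  then obtain U h where "open U" "x \<in> U" "\<forall>k. Ck_on k h U" "\<forall>y\<in>S \<inter> U. h y = f y"
    by (rule smooth_onE[OF assms(1)])
  then show "\<exists>U h. open U \<and> x \<in> U \<and> (\<forall>k. Ck_on k h U) \<and> (\<forall>y\<in>S \<inter> U. h y = g y)"
    using assms(2) by (intro exI[of _ U] exI[of _ h]) auto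
qed

lemma smooth_on_cong:
  assumes "\<And>x. x \<in> S \<Longrightarrow> f x = g x"
  shows "smooth_on f S \<longleftrightarrow> smooth_on g S"
  using assms by (metis smooth_on_transform)

lemma smooth_on_local:
  assumes "\<And>x. x \<in> S \<Longrightarrow> \<exists>U. open U \<and> x \<in> U \<and> smooth_on f (S \<inter> U)"
  shows "smooth_on f S"
  unfolding smooth_on_def
proof
  fix x assume "x \<in> S"
  then obtain U where U: "open U" "x \<in> U" "smooth_on f (S \<inter> U)" using assms by blast
  then obtain V g where V: "open V" "x \<in> V" "\<forall>k. Ck_on k g V" "\<forall>y\<in>S \<inter> U \<inter> V. g y = f y"
    using smooth_onE[OF U(3), of x] \<open>x \<in> S\<close> by (metis IntI)
  then show "\<exists>U g. open U \<and> x \<in> U \<and> (\<forall>k. Ck_on k g U) \<and> (\<forall>y\<in>S \<inter> U. g y = f y)"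
    using U by (intro exI[of _ "U \<inter> V"] exI[of _ g]) (auto intro: Ck_on_subset)
qed

lemma smooth_on_imp_continuous_on:
  assumes "smooth_on f S" shows "continuous_on S f"
  unfolding continuous_on_eq_continuous_within
proof
  fix x assume x: "x \<in> S"
  then obtain U g where U: "open U" "x \<in> U" "Ck_on 0 g U" "\<forall>y\<in>S \<inter> U. g y = f y"
    using smooth_onE[OF assms] by metis
  then have "continuous_on (S \<inter> U) f"
    by (metis Ck_on.simps(1) continuous_on_cong continuous_on_subset inf_le2)
  then have "continuous (at x within S \<inter> U) f"
    using x U(2) by (simp add: continuous_on_eq_continuous_within)
  moreover have "at x within S = at x within (S \<inter> U)"
    using U(1,2) by (intro at_within_nhd[of x U]) auto
  ultimately show "continuous (at x within S) f" by simp
qed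

lemma smooth_on_const [intro, simp]: "smooth_on (\<lambda>x. c) S"
  unfolding smooth_on_def by (metis Ck_on_const UNIV_I open_UNIV)

lemma smooth_on_Ck: "(\<And>k. Ck_on k f UNIV) \<Longrightarrow> smooth_on f S"
  by (rule smooth_onI[of UNIV]) auto

lemma smooth_on_linear: "bounded_linear f \<Longrightarrow> smooth_on f S"
  by (rule smooth_on_Ck) (rule Ck_on_linear)

lemma smooth_on_bilinear:
  assumes "bounded_bilinear \<beta>" "smooth_on f S" "smooth_on g S"
  shows "smooth_on (\<lambda>x. \<beta> (f x) (g x)) S"
  unfolding smooth_on_def
proof
  fix x assume x: "x \<in> S"
  obtain U f' where U: "open U" "x \<in> U" "\<forall>k. Ck_on k f' U" "\<forall>y\<in>S \<inter> U. f' y = f y"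
    using smooth_onE[OF assms(2) x] .
  obtain V g' where V: "open V" "x \<in> V" "\<forall>k. Ck_on k g' V" "\<forall>y\<in>S \<inter> V. g' y = g y"
    using smooth_onE[OF assms(3) x] .
  have "Ck_on k (\<lambda>x. \<beta> (f' x) (g' x)) (U \<inter> V)" for k
    using U V by (intro Ck_on_bilinear[OF assms(1)] open_Int) (auto intro: Ck_on_subset)
  then show "\<exists>U h. open U \<and> x \<in> U \<and> (\<forall>k. Ck_on k h U) \<and> (\<forall>y\<in>S \<inter> U. h y = \<beta> (f y) (g y))"
    using U V by (intro exI[of _ "U \<inter> V"] exI[of _ "\<lambda>x. \<beta> (f' x) (g' x)"]) auto
qed

lemma smooth_on_add:
  assumes "smooth_on f S" "smooth_on g S"
  shows "smooth_on (\<lambda>x. f x + g x) S"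
  unfolding smooth_on_def
proof
  fix x assume x: "x \<in> S"
  obtain U f' where U: "open U" "x \<in> U" "\<forall>k. Ck_on k f' U" "\<forall>y\<in>S \<inter> U. f' y = f y"
    using smooth_onE[OF assms(1) x] .
  obtain V g' where V: "open V" "x \<in> V" "\<forall>k. Ck_on k g' V" "\<forall>y\<in>S \<inter> V. g' y = g y"
    using smooth_onE[OF assms(2) x] .
  have "Ck_on k (\<lambda>x. f' x + g' x) (U \<inter> V)" for k
    using U V by (intro Ck_on_add open_Int) (auto intro: Ck_on_subset)
  then show "\<exists>U h. open U \<and> x \<in> U \<and> (\<forall>k. Ck_on k h U) \<and> (\<forall>y\<in>S \<inter> U. h y = f y + g y)"
    using U V by (intro exI[of _ "U \<inter> V"] exI[of _ "\<lambda>x. f' x + g' x"]) auto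
qed

lemma smooth_on_compose:
  fixes g :: "'a::real_normed_vector \<Rightarrow> 'b::euclidean_space"
  assumes f: "smooth_on f T" and g: "smooth_on g S" and sub: "g ` S \<subseteq> T"
  shows "smooth_on (f \<circ> g) S"
  unfolding smooth_on_def
proof
  fix x assume x: "x \<in> S"
  then have gx: "g x \<in> T" using sub by blast
  obtain U g' where U: "open U" "x \<in> U" "\<forall>k. Ck_on k g' U" "\<forall>y\<in>S \<inter> U. g' y = g y"
    using smooth_onE[OF g x] .
  obtain V f' where V: "open V" "g x \<in> V" "\<forall>k. Ck_on k f' V" "\<forall>y\<in>T \<inter> V. f' y = f y"
    using smooth_onE[OF f gx] .
  let ?W = "U \<inter> g' -` V"
  have W: "open ?W" using U(1) spec[OF U(3), of 0] V(1) by (simp add: continuous_on_open_vimage Int_commute)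
  have "Ck_on k (f' \<circ> g') ?W" for k
    using U(3) V(3) by (intro Ck_on_compose[OF W V(1)]) (auto intro: Ck_on_subset)
  moreover have "x \<in> ?W" using U V x by auto
  moreover have "\<forall>y\<in>S \<inter> ?W. (f' \<circ> g') y = (f \<circ> g) y"
  proof
    fix y assume y: "y \<in> S \<inter> ?W"
    then have "g' y = g y" using U(4) by blast
    moreover have "g y \<in> T \<inter> V" using y sub calculation by auto
    ultimately show "(f' \<circ> g') y = (f \<circ> g) y" using V(4) by simp
  qed
  ultimately show "\<exists>U h. open U \<and> x \<in> U \<and> (\<forall>k. Ck_on k h U) \<and> (\<forall>y\<in>S \<inter> U. h y = (f \<circ> g) y)"
    using W by blast
qed

lemma smooth_on_linear_compose:
  fixes g :: "'a::real_normed_vector \<Rightarrow> 'b::euclidean_space"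
  assumes "bounded_linear f" "smooth_on g S" shows "smooth_on (\<lambda>x. f (g x)) S"
  using smooth_on_compose[OF smooth_on_linear[OF assms(1)] assms(2) subset_UNIV] by (simp add: comp_def)

lemma smooth_on_mult:
  fixes f g :: "'a::real_normed_vector \<Rightarrow> real"
  shows "smooth_on f S \<Longrightarrow> smooth_on g S \<Longrightarrow> smooth_on (\<lambda>x. f x * g x) S"
  by (rule smooth_on_bilinear[OF bounded_bilinear_mult])

lemma smooth_on_sum:
  "(\<And>i. i \<in> A \<Longrightarrow> smooth_on (f i) S) \<Longrightarrow> smooth_on (\<lambda>x. \<Sum>i\<in>A. f i x) S"
  by (induction A rule: infinite_finite_induct) (auto intro: smooth_on_add)

lemma smooth_on_prod:
  fixes f :: "'i \<Rightarrow> 'a::real_normed_vector \<Rightarrow> real"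
  shows "(\<And>i. i \<in> A \<Longrightarrow> smooth_on (f i) S) \<Longrightarrow> smooth_on (\<lambda>x. \<Prod>i\<in>A. f i x) S"
  by (induction A rule: infinite_finite_induct) (auto intro: smooth_on_mult)

lemma smooth_on_vec_nth:
  fixes f :: "'a::real_normed_vector \<Rightarrow> 'b::euclidean_space ^ 'n"
  shows "smooth_on f S \<Longrightarrow> smooth_on (\<lambda>x. f x $ i) S"
  by (rule smooth_on_linear_compose[OF bounded_linear_vec_nth])

lemma smooth_on_vec_lambda:
  fixes f :: "'n::finite \<Rightarrow> 'a::real_normed_vector \<Rightarrow> 'b::real_normed_vector"
  assumes "\<And>i. smooth_on (f i) S" shows "smooth_on (\<lambda>x. \<chi> i. f i x) S"
proof -
  have "bounded_linear (\<lambda>y::'b. axis i y :: 'b ^ 'n)" for i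
    by (intro bounded_linear_intro[where K=1])
      (auto simp: axis_def vec_eq_iff norm_vec_def L2_set_def if_distrib[of norm] if_distrib[of "\<lambda>x. x^2"] cong: if_cong)
  then have "bounded_bilinear (\<lambda>(c::real) (y::'b). c *\<^sub>R (axis i y :: 'b ^ 'n))" for i
    using bounded_bilinear.comp[OF bounded_bilinear_scaleR bounded_linear_ident] by blast
  then have "smooth_on (\<lambda>x. \<Sum>i\<in>UNIV. 1 *\<^sub>R (axis i (f i x) :: 'b ^ 'n)) S"
    using assms by (intro smooth_on_sum smooth_on_bilinear[where \<beta>="\<lambda>c y. c *\<^sub>R axis _ y"]) auto
  moreover have "(\<Sum>i\<in>UNIV. 1 *\<^sub>R axis i (f i x)) = (\<chi> i. f i x)" for x
    by (simp add: vec_eq_iff axis_def)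
  ultimately show ?thesis by simp
qed

lemma Ck_on_deriv:
  fixes f :: "real \<Rightarrow> real"
  assumes "open S" "\<And>x. x \<in> S \<Longrightarrow> (f has_real_derivative f' x) (at x)" "Ck_on k f' S"
  shows "Ck_on (Suc k) f S"
proof -
  have D: "frechet_derivative f (at x) v = f' x * v" if "x \<in> S" for x v
    using assms(2)[OF that] frechet_derivative_at unfolding has_field_derivative_def by metis
  have "Ck_on k (\<lambda>x. f' x * v) S" for v
    by (intro Ck_on_bilinear[OF bounded_bilinear_mult] assms(1,3) Ck_on_const)
  then have "Ck_on k (\<lambda>x. frechet_derivative f (at x) v) S" for v
    using D by (subst Ck_on_cong[OF assms(1)])
  moreover have "f differentiable (at x)" if "x \<in> S" for x
    using assms(2)[OF that] by (auto simp: differentiable_def has_field_derivative_def)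
  ultimately show ?thesis by simp
qed

text \<open>
  The exponents \<open>-1\<close> and \<open>1/2\<close> give reciprocals and square roots of positive functions.
\<close>

lemma Ck_on_powr: "Ck_on k (\<lambda>x::real. x powr a) {0<..}"
proof (induction k arbitrary: a)
  case 0 then show ?case by (auto intro!: continuous_intros)
next
  case (Suc k)
  show ?case
  proof (rule Ck_on_deriv[where f'="\<lambda>x. a * x powr (a - 1)"])
    show "Ck_on k (\<lambda>x. a * x powr (a - 1)) {0<..}"
      by (intro Ck_on_bilinear[OF bounded_bilinear_mult] Suc Ck_on_const) auto
  qed (auto intro: has_real_derivative_powr)
qed

lemma smooth_on_powr:
  fixes f :: "'a::real_normed_vector \<Rightarrow> real"
  assumes "smooth_on f S" "\<And>x. x \<in> S \<Longrightarrow> 0 < f x"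
  shows "smooth_on (\<lambda>x. f x powr a) S"
proof -
  have "smooth_on (\<lambda>x::real. x powr a) {0<..}" by (simp add: smooth_on_open Ck_on_powr)
  from smooth_on_compose[OF this assms(1)] show ?thesis using assms(2) by (auto simp: comp_def image_subset_iff)
qed

lemma smooth_on_divide:
  fixes f g :: "'a::real_normed_vector \<Rightarrow> real"
  assumes "smooth_on f S" "smooth_on g S" "\<And>x. x \<in> S \<Longrightarrow> 0 < g x"
  shows "smooth_on (\<lambda>x. f x / g x) S"
proof -
  have "smooth_on (\<lambda>x. f x * (g x powr -1)) S" by (intro smooth_on_mult smooth_on_powr assms)
  then show ?thesis using assms(3) smooth_on_cong[of S "\<lambda>x. f x * (g x powr -1)"]
    by (smt (verit) divide_inverse powr_neg_one divide_inverse_commute inverse_eq_divide mult.commute)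
qed

lemma smooth_on_sqrt:
  fixes f :: "'a::real_normed_vector \<Rightarrow> real"
  assumes "smooth_on f S" "\<And>x. x \<in> S \<Longrightarrow> 0 < f x"
  shows "smooth_on (\<lambda>x. sqrt (f x)) S"
  using smooth_on_powr[OF assms, of "1/2"] smooth_on_cong[of S "\<lambda>x. f x powr (1/2)" "\<lambda>x. sqrt (f x)"] assms(2)
  by (simp add: powr_half_sqrt less_imp_le)

lemma smooth_on_det:
  fixes A :: "'a::real_normed_vector \<Rightarrow> real ^ 'n ^ 'n"
  assumes "\<And>i j. smooth_on (\<lambda>x. A x $ i $ j) S"
  shows "smooth_on (\<lambda>x. det (A x)) S"
  unfolding det_def by (intro smooth_on_sum smooth_on_mult smooth_on_prod assms smooth_on_const)

lemma smooth_on_matrix_vector: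
  fixes A :: "'a::real_normed_vector \<Rightarrow> real ^ 'n ^ 'm"
  assumes "smooth_on A S" "smooth_on b S"
  shows "smooth_on (\<lambda>x. A x *v b x) S"
  unfolding matrix_vector_mult_def
  by (intro smooth_on_vec_lambda smooth_on_sum smooth_on_mult smooth_on_vec_nth assms)

lemma matrix_inv_mult:
  fixes A :: "real ^ 'n ^ 'n"
  assumes "invertible A"
  shows "A ** matrix_inv A = mat 1" "matrix_inv A ** A = mat 1"
  using someI_ex[OF assms[unfolded invertible_def]] by (simp_all add: matrix_inv_def)

text \<open>By Cramer's rule the solution is a quotient of determinants.\<close>

lemma smooth_on_matrix_inv:
  fixes A :: "'a::real_normed_vector \<Rightarrow> real ^ 'n ^ 'n"
  assumes "smooth_on A S" "smooth_on b S" "\<And>x. x \<in> S \<Longrightarrow> 0 < det (A x)"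
  shows "smooth_on (\<lambda>x. matrix_inv (A x) *v b x) S"
proof -
  let ?s = "\<lambda>x. \<chi> k. det (\<chi> i j. if j = k then b x $ i else A x $ i $ j) / det (A x)"
  have "smooth_on (\<lambda>x. if j = k then b x $ i else A x $ i $ j) S" for i j k
    using assms by (cases "j = k") (auto intro: smooth_on_vec_nth)
  then have "smooth_on ?s S"
    using assms(1,3)
    by (intro smooth_on_vec_lambda smooth_on_divide smooth_on_det) (auto intro: smooth_on_vec_nth)
  moreover have "matrix_inv (A x) *v b x = ?s x" if "x \<in> S" for x
  proof -
    have "invertible (A x)" using assms(3)[OF that] by (simp add: invertible_det_nz)
    then have "A x *v (matrix_inv (A x) *v b x) = b x"
      by (simp add: matrix_vector_mul_assoc matrix_inv_mult)
    then show ?thesis using assms(3)[OF that] cramer[of "A x"] by simp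
  qed
  ultimately show ?thesis using smooth_on_cong by (metis (no_types, lifting))
qed

text \<open>Continuity of the determinant along the segment from the identity, where it never vanishes.\<close>

lemma spd_det_pos:
  fixes A :: "'n::{finite,wellorder} mat"
  assumes "spd A" shows "0 < det A"
proof (rule ccontr)
  assume neg: "\<not> 0 < det A"
  let ?B = "\<lambda>t. (\<chi> i j. t * A $ i $ j + (1 - t) * (mat 1 :: 'n mat) $ i $ j)"
  have B: "?B t *v x = t *\<^sub>R (A *v x) + (1 - t) *\<^sub>R x" for t x
  proof -
    have "?B t *v x = t *\<^sub>R (A *v x) + (1 - t) *\<^sub>R ((mat 1 :: 'n mat) *v x)"
      by (simp add: vec_eq_iff matrix_vector_mult_def sum.distrib sum_distrib_left algebra_simps flip: sum.distrib)
    then show ?thesis by simp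
  qed
  have "continuous_on {0..1} (\<lambda>t. det (?B t))"
    unfolding det_def by (simp, intro continuous_intros)
  moreover have "det (?B 1) \<le> 0" using neg by simp
  moreover have "0 \<le> det (?B 0)" by (simp add: vec_lambda_eta)
  ultimately obtain t where t: "0 \<le> t" "t \<le> 1" "det (?B t) = 0"
    using IVT2'[of "\<lambda>t. det (?B t)" 1 0 0] by auto
  have "\<not> invertible (?B t)" using t(3) by (simp only: invertible_det_nz simp_thms)
  then have "\<not> (\<forall>x. ?B t *v x = 0 \<longrightarrow> x = 0)"
    by (simp only: invertible_left_inverse matrix_left_invertible_ker not_False_eq_True)
  then obtain x where x: "x \<noteq> 0" "?B t *v x = 0" by (elim not_all[THEN iffD1, THEN exE]) blast
  have "0 = x \<bullet> (?B t *v x)" using x by simp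
  also have "\<dots> = t * (x \<bullet> (A *v x)) + (1 - t) * (x \<bullet> x)"
    unfolding B by (simp add: inner_add_right)
  also have "\<dots> > 0"
  proof (cases "t = 0")
    case False
    then have "0 < t * (x \<bullet> (A *v x))" using t x assms by (simp add: spd_def)
    then show ?thesis using t by (simp add: add_pos_nonneg)
  qed (use x in simp)
  finally show False by simp
qed

section \<open>A smooth bump\<close>

text \<open>
  For \<open>m = 0\<close> this is the standard smooth function that vanishes on one half-line only; the
  factor \<open>inverse x ^ m\<close> makes the family closed under differentiation.
\<close>

definition flat :: "nat \<Rightarrow> real \<Rightarrow> real" where
  "flat m x = (if x \<le> 0 then 0 else exp (- inverse x) * inverse x ^ m)"

lemma flat_tendsto_0: "(flat m \<longlongrightarrow> 0) (at 0)"
proof -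
  have "((\<lambda>x. (inverse x) ^ m / exp (inverse x)) \<longlongrightarrow> (0::real)) (at_right 0)"
    by (rule filterlim_compose[OF tendsto_power_div_exp_0 filterlim_inverse_at_top_right])
  moreover have "\<forall>\<^sub>F x in at_right (0::real). (inverse x) ^ m / exp (inverse x) = flat m x"
    by (auto simp: flat_def exp_minus divide_inverse mult.commute eventually_at_filter)
  ultimately have "(flat m \<longlongrightarrow> 0) (at_right 0)" by (rule Lim_transform_eventually)
  moreover have "(flat m \<longlongrightarrow> 0) (at_left 0)"
    by (rule Lim_transform_eventually[OF tendsto_const]) (auto simp: flat_def eventually_at_filter)
  ultimately show ?thesis by (simp add: filterlim_split_at)
qed

lemma flat_deriv: "(flat m has_real_derivative flat (m + 2) x - real m * flat (m + 1) x) (at x)"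
proof -
  consider "x < 0" | "x = 0" | "0 < x" by linarith
  then show ?thesis
  proof cases
    case 1
    have "((\<lambda>x. 0) has_real_derivative flat (m + 2) x - real m * flat (m + 1) x) (at x)"
      using 1 by (simp add: flat_def)
    then show ?thesis
      by (rule has_field_derivative_transform_within_open[where S="{..<0}"])
        (use 1 in \<open>auto simp: flat_def\<close>)
  next
    case 2
    have "(\<lambda>h. flat m h / h) = flat (m + 1)" by (auto simp: flat_def divide_inverse)
    then show ?thesis using flat_tendsto_0[of "m + 1"] 2
      by (simp add: DERIV_def flat_def)
  next
    case 3
    have "((\<lambda>x. exp (- inverse x) * inverse x ^ m) has_real_derivative
        exp (- inverse x) * (inverse x)\<^sup>2 * inverse x ^ m
          - exp (- inverse x) * (real m * inverse x ^ (m - 1) * (inverse x)\<^sup>2)) (at x)"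
    proof -
      have i: "(inverse has_real_derivative - (inverse x)\<^sup>2) (at x)"
        using 3 DERIV_inverse[of x] by (simp add: power2_eq_square)
      have "((\<lambda>x. exp (- inverse x)) has_real_derivative exp (- inverse x) * (inverse x)\<^sup>2) (at x)"
        using DERIV_chain2[OF DERIV_exp DERIV_minus[OF i]] by simp
      from DERIV_mult[OF this DERIV_power[OF i, of m]] show ?thesis
        by (simp add: algebra_simps)
    qed
    moreover have "exp (- inverse x) * (inverse x)\<^sup>2 * inverse x ^ m
          - exp (- inverse x) * (real m * inverse x ^ (m - 1) * (inverse x)\<^sup>2)
        = flat (m + 2) x - real m * flat (m + 1) x"
      using 3 by (cases m) (simp_all add: flat_def power2_eq_square)
    ultimately have "((\<lambda>x. exp (- inverse x) * inverse x ^ m) has_real_derivative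
        flat (m + 2) x - real m * flat (m + 1) x) (at x)" by simp
    then show ?thesis
      by (rule has_field_derivative_transform_within_open[where S="{0<..}"]) (use 3 in \<open>auto simp: flat_def\<close>)
  qed
qed

lemma Ck_on_flat: "Ck_on k (flat m) UNIV"
proof (induction k arbitrary: m)
  case 0
  have "isCont (flat m) x" for x by (rule DERIV_isCont) (rule flat_deriv)
  then show ?case by (simp add: continuous_on_eq_continuous_at)
next
  case (Suc k)
  have "Ck_on k (\<lambda>x. flat (m + 2) x + (- real m) * flat (m + 1) x) UNIV"
    by (intro Ck_on_add Ck_on_bilinear[OF bounded_bilinear_mult] Suc Ck_on_const) auto
  then show ?case using flat_deriv by (intro Ck_on_deriv[where f'="\<lambda>x. flat (m + 2) x - real m * flat (m + 1) x"]) auto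
qed

definition bump :: "'a::euclidean_space \<Rightarrow> real \<Rightarrow> 'a \<Rightarrow> real" where
  "bump a r x = flat 0 (r\<^sup>2 - (x - a) \<bullet> (x - a))"

lemma smooth_bump: "smooth_on (bump a r) S"
proof -
  have "smooth_on (\<lambda>x. x + (- a)) UNIV" by (intro smooth_on_add smooth_on_const smooth_on_linear bounded_linear_ident)
  then have "smooth_on (\<lambda>x. r\<^sup>2 + (-1) * ((x - a) \<bullet> (x - a))) UNIV"
    by (intro smooth_on_add smooth_on_mult smooth_on_const smooth_on_bilinear[OF bounded_bilinear_inner]) auto
  moreover have "smooth_on (flat 0) UNIV" by (rule smooth_on_Ck) (rule Ck_on_flat)
  ultimately have "smooth_on (flat 0 \<circ> (\<lambda>x. r\<^sup>2 + (-1) * ((x - a) \<bullet> (x - a)))) UNIV"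
    by (intro smooth_on_compose) auto
  then show ?thesis by (auto simp: bump_def[abs_def] comp_def intro: smooth_on_subset)
qed

lemma bump_nonneg: "0 \<le> bump a r x" by (simp add: bump_def flat_def)

lemma bump_pos_iff: "0 < r \<Longrightarrow> 0 < bump a r x \<longleftrightarrow> dist a x < r"
  by (simp add: bump_def flat_def dist_norm norm_minus_commute not_le flip: power2_norm_eq_inner)

lemma bump_zero: "0 < r \<Longrightarrow> x \<notin> ball a r \<Longrightarrow> bump a r x = 0"
  using bump_pos_iff[of r a x] bump_nonneg[of a r x] by simp

section \<open>Derivatives in the half-space\<close>

abbreviation hopen :: "('n::{finite,wellorder} vect) set \<Rightarrow> bool" where
  "hopen W \<equiv> openin (top_of_set halfspace) W"

lemma hopen_at_within:
  assumes "hopen W" "x \<in> W" shows "at x within W = at x within halfspace"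
proof -
  obtain T where "open T" "W = halfspace \<inter> T" using assms(1) by (auto simp: openin_open)
  then show ?thesis using assms(2) by (intro at_within_nhd[of x T]) auto
qed

text \<open>
  Near each of its points a smooth function has a smooth extension to an open set, and the derivatives
  within the half-space are the derivatives of the extension; this is how one-sided derivatives inherit
  all rules of calculus.
\<close>

lemma smooth_local_extension:
  fixes W :: "('n::{finite,wellorder} vect) set" and f :: "'n vect \<Rightarrow> 'b::real_normed_vector"
  assumes f: "smooth_on f W" and W: "hopen W" and x: "x \<in> W"
  obtains U g where "open U" "x \<in> U" "U \<inter> halfspace \<subseteq> W" "\<forall>k. Ck_on k g U"
    "\<forall>y\<in>U \<inter> halfspace. f y = g y"
    "\<forall>y\<in>U \<inter> halfspace. (f has_derivative frechet_derivative g (at y)) (at y within halfspace)"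
    "\<forall>y\<in>U \<inter> halfspace. hderiv f y = frechet_derivative g (at y)"
proof -
  obtain U g where U: "open U" "x \<in> U" "\<forall>k. Ck_on k g U" "\<forall>y\<in>W \<inter> U. g y = f y"
    using smooth_onE[OF f x] .
  obtain T where T: "open T" "W = halfspace \<inter> T" using W by (auto simp: openin_open)
  let ?U = "U \<inter> T"
  have D: "(f has_derivative frechet_derivative g (at y)) (at y within halfspace)" if y: "y \<in> ?U \<inter> halfspace" for y
  proof -
    have "g differentiable (at y)" using spec[OF U(3), of "Suc 0"] y by simp
    then show ?thesis
      using U(1,4) T y by (intro within_halfspace_derivative[of g _ y ?U] has_derivative_frechet open_Int) auto
  qed
  show thesis
  proof (rule that[of ?U g])
    have "hderiv f y = frechet_derivative g (at y)" if y: "y \<in> ?U \<inter> halfspace" for y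
      using D[OF y] y hderiv_unique[of f "hderiv f y" y]
      by (metis IntD2 differentiableI frechet_derivative_works)
    then show "\<forall>y\<in>?U \<inter> halfspace. hderiv f y = frechet_derivative g (at y)" by blast
  qed (use U T x D in \<open>auto intro: Ck_on_subset\<close>)
qed

lemma smooth_has_hderiv:
  assumes "smooth_on f W" "hopen W" "x \<in> W"
  shows "(f has_derivative hderiv f x) (at x within halfspace)"
proof -
  have "x \<in> halfspace" using assms(2,3) openin_imp_subset by blast
  then show ?thesis using smooth_local_extension[OF assms] by (metis IntI)
qed

lemma smooth_on_hderiv:
  assumes f: "smooth_on f W" and W: "hopen W"
  shows "smooth_on (\<lambda>x. hderiv f x v) W"
  unfolding smooth_on_def
proof
  fix x assume x: "x \<in> W"
  have sub: "W \<subseteq> halfspace" using W openin_imp_subset by blast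
  obtain U g where U: "open U" "x \<in> U" "U \<inter> halfspace \<subseteq> W" "\<forall>k. Ck_on k g U"
    "\<forall>y\<in>U \<inter> halfspace. f y = g y"
    "\<forall>y\<in>U \<inter> halfspace. (f has_derivative frechet_derivative g (at y)) (at y within halfspace)"
    "\<forall>y\<in>U \<inter> halfspace. hderiv f y = frechet_derivative g (at y)"
    using smooth_local_extension[OF f W x] .
  have "Ck_on k (\<lambda>y. frechet_derivative g (at y) v) U" for k using spec[OF U(4), of "Suc k"] by simp
  then show "\<exists>U h. open U \<and> x \<in> U \<and> (\<forall>k. Ck_on k h U) \<and> (\<forall>y\<in>W \<inter> U. h y = hderiv f y v)"
    using U(1,2) U(7) sub by (intro exI[of _ U] exI[of _ "\<lambda>y. frechet_derivative g (at y) v"]) auto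
qed

lemma smooth_on_partial: "smooth_on f W \<Longrightarrow> hopen W \<Longrightarrow> smooth_on (partial i f) W"
  unfolding partial_def[abs_def] by (rule smooth_on_hderiv)

lemma hderiv_cong:
  assumes "hopen W" "x \<in> W" "\<And>y. y \<in> W \<Longrightarrow> f y = g y"
  shows "hderiv f x = hderiv g x"
proof -
  have "(f has_derivative D) (at x within halfspace) \<longleftrightarrow> (g has_derivative D) (at x within halfspace)" for D
    unfolding hopen_at_within[OF assms(1,2), symmetric]
    using assms(2,3) has_derivative_transform[of x W] by metis
  then show ?thesis by (simp add: frechet_derivative_def)
qed

lemma partial_cong:
  assumes "hopen W" "x \<in> W" "\<And>y. y \<in> W \<Longrightarrow> f y = g y"
  shows "partial i f x = partial i g x"
  unfolding partial_def using hderiv_cong[OF assms] by simp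

lemma partials_cong:
  assumes "hopen W" "\<And>y. y \<in> W \<Longrightarrow> f y = g y"
  shows "x \<in> W \<Longrightarrow> partials is f x = partials is g x"
proof (induction "is" arbitrary: x)
  case Nil then show ?case using assms(2) by (simp add: partials_def)
next
  case (Cons i "is")
  then show ?case unfolding partials_def by (auto intro: partial_cong[OF assms(1)])
qed

lemma partial_eqI:
  assumes "(f has_derivative D) (at x within halfspace)" "x \<in> halfspace"
  shows "partial i f x = D (axis i 1)"
proof -
  have "(f has_derivative hderiv f x) (at x within halfspace)"
    using assms(1) differentiableI frechet_derivative_works by blast
  then show ?thesis using hderiv_unique[OF _ assms] by (simp add: partial_def)
qed

lemma partial_const [simp]: "x \<in> halfspace \<Longrightarrow> partial i (\<lambda>x. c) x = 0"
  by (rule partial_eqI[OF has_derivative_const])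

lemma partial_add:
  assumes "smooth_on f W" "smooth_on g W" "hopen W" "x \<in> W"
  shows "partial i (\<lambda>x. f x + g x) x = partial i f x + partial i g x"
proof -
  have "x \<in> halfspace" using assms(3,4) openin_imp_subset by blast
  then show ?thesis
    unfolding partial_def[of i f] partial_def[of i g] using assms
    by (intro partial_eqI[of _ "\<lambda>v. hderiv f x v + hderiv g x v"] has_derivative_add smooth_has_hderiv[where W=W])
qed

lemma partial_mult:
  assumes "smooth_on f W" "smooth_on g W" "hopen W" "x \<in> W"
  shows "partial i (\<lambda>x. f x * g x) x = f x * partial i g x + partial i f x * g x"
proof -
  have "x \<in> halfspace" using assms(3,4) openin_imp_subset by blast
  then show ?thesis
    unfolding partial_def[of i f] partial_def[of i g] using assms
    by (intro partial_eqI[of _ "\<lambda>v. f x * hderiv g x v + hderiv f x v * g x"] has_derivative_mult smooth_has_hderiv[where W=W])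
qed

lemma partial_cmult:
  assumes "smooth_on f W" "hopen W" "x \<in> W"
  shows "partial i (\<lambda>x. c * f x) x = c * partial i f x"
proof -
  have "x \<in> halfspace" using assms openin_imp_subset by blast
  then show ?thesis using partial_mult[OF smooth_on_const assms, of i c] by simp
qed

lemma hderiv_expand:
  fixes f :: "'n::{finite,wellorder} vect \<Rightarrow> 'b::real_normed_vector"
  assumes "smooth_on f W" "hopen W" "x \<in> W"
  shows "hderiv f x v = (\<Sum>i\<in>UNIV. v $ i *\<^sub>R hderiv f x (axis i 1))"
proof -
  have l: "linear (hderiv f x)" using has_derivative_linear[OF smooth_has_hderiv[OF assms]] .
  have "hderiv f x v = hderiv f x (\<Sum>i\<in>UNIV. v $ i *\<^sub>R axis i 1)"
    using basis_expansion[of v] by (simp add: scalar_mult_eq_scaleR)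
  then show ?thesis by (simp add: linear_sum[OF l] linear_scale[OF l])
qed

lemma hderiv_partials:
  fixes f :: "'n::{finite,wellorder} vect \<Rightarrow> real"
  assumes "smooth_on f W" "hopen W" "x \<in> W"
  shows "hderiv f x v = (\<Sum>i\<in>UNIV. v $ i * partial i f x)"
  using hderiv_expand[OF assms, of v] by (simp add: partial_def)

lemma hjacobian_mult:
  fixes T :: "'n::{finite,wellorder} vect \<Rightarrow> 'n vect"
  assumes "smooth_on T W" "hopen W" "x \<in> W"
  shows "hjacobian T x *v v = hderiv T x v"
  using has_derivative_linear[OF smooth_has_hderiv[OF assms]]
  by (simp add: jacobian_def matrix_works)

lemma smooth_on_hjacobian:
  fixes T :: "'n::{finite,wellorder} vect \<Rightarrow> 'n vect"
  assumes "smooth_on T W" "hopen W" shows "smooth_on (hjacobian T) W"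
  unfolding jacobian_def[abs_def] matrix_def
  by (intro smooth_on_vec_lambda smooth_on_vec_nth smooth_on_hderiv assms)

lemma hderiv_compose:
  fixes T :: "'n::{finite,wellorder} vect \<Rightarrow> 'n vect" and f :: "'n vect \<Rightarrow> 'b::real_normed_vector"
  assumes T: "smooth_on T W" "hopen W" and f: "smooth_on f W'" "hopen W'"
    and sub: "T ` W \<subseteq> W'" and x: "x \<in> W"
  shows "hderiv (f \<circ> T) x v = hderiv f (T x) (hderiv T x v)"
proof -
  have TH: "T ` W \<subseteq> halfspace" and xH: "x \<in> halfspace"
    using sub f(2) T(2) x openin_imp_subset by blast+
  have "(T has_derivative hderiv T x) (at x within W)"
    using smooth_has_hderiv[OF T x] by (simp add: hopen_at_within[OF T(2) x])
  moreover have "(f has_derivative hderiv f (T x)) (at (T x) within T ` W)"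
    using smooth_has_hderiv[OF f, of "T x"] sub x TH has_derivative_subset by blast
  ultimately have "(f \<circ> T has_derivative hderiv f (T x) \<circ> hderiv T x) (at x within W)"
    by (rule diff_chain_within)
  then have D: "(f \<circ> T has_derivative hderiv f (T x) \<circ> hderiv T x) (at x within halfspace)"
    by (simp add: hopen_at_within[OF T(2) x])
  then have "(f \<circ> T has_derivative hderiv (f \<circ> T) x) (at x within halfspace)"
    using differentiableI frechet_derivative_works by blast
  from hderiv_unique[OF this D xH] show ?thesis by simp
qed

lemma partial_compose:
  fixes T :: "'n::{finite,wellorder} vect \<Rightarrow> 'n vect" and f :: "'n vect \<Rightarrow> real"
  assumes "smooth_on T W" "hopen W" "smooth_on f W'" "hopen W'" "T ` W \<subseteq> W'" "x \<in> W"
  shows "partial i (f \<circ> T) x = (\<Sum>j\<in>UNIV. hjacobian T x $ j $ i * partial j f (T x))"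
proof -
  have "partial i (f \<circ> T) x = hderiv f (T x) (hderiv T x (axis i 1))"
    unfolding partial_def by (rule hderiv_compose[OF assms])
  also have "\<dots> = (\<Sum>j\<in>UNIV. hderiv T x (axis i 1) $ j * partial j f (T x))"
    using assms by (intro hderiv_partials[OF assms(3,4)]) auto
  finally show ?thesis by (simp add: jacobian_def matrix_def)
qed

text \<open>The derivative along a direction in which one may move both ways vanishes at a minimum.\<close>

lemma hderiv_bdir_at_boundary:
  fixes T :: "'n::{finite,wellorder} vect \<Rightarrow> 'n vect"
  assumes T: "smooth_on T W" "hopen W" "T ` W \<subseteq> halfspace"
    and x: "x \<in> W" "T x $ bdir = 0" and u: "0 < x $ bdir \<or> u $ bdir = 0"
  shows "hderiv T x u $ bdir = 0"
proof -
  have xH: "x \<in> halfspace" using T(2) x(1) openin_imp_subset by blast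
  obtain U where U: "open U" "x \<in> U" "U \<inter> halfspace \<subseteq> W"
    using T(2) x(1) by (auto simp: openin_open)
  have c: "((\<lambda>s. x + s *\<^sub>R u) \<longlongrightarrow> x) (at 0)" by (auto intro!: tendsto_eq_intros)
  then have "\<forall>\<^sub>F s in at 0. x + s *\<^sub>R u \<in> U" using U(1,2) by (rule topological_tendstoD)
  moreover have "\<forall>\<^sub>F s in at 0. x + s *\<^sub>R u \<in> halfspace"
  proof (cases "u $ bdir = 0")
    case True then show ?thesis using xH by (simp add: halfspace_def)
  next
    case False
    then have "x \<in> {x. 0 < x $ bdir}" using u by simp
    moreover have "open {x::'n vect. 0 < x $ bdir}" by (rule open_halfspace_component_gt_cart)
    ultimately have "\<forall>\<^sub>F s in at 0. x + s *\<^sub>R u \<in> {x. 0 < x $ bdir}" using topological_tendstoD[OF c] by blast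
    then show ?thesis by eventually_elim (simp add: halfspace_def)
  qed
  ultimately have "\<forall>\<^sub>F s in at 0. x + s *\<^sub>R u \<in> W" by eventually_elim (use U(3) in auto)
  then obtain d where d: "d > 0" "\<And>s. s \<noteq> 0 \<Longrightarrow> \<bar>s\<bar> < d \<Longrightarrow> x + s *\<^sub>R u \<in> W"
    unfolding eventually_at by (auto simp: dist_real_def)
  have W: "x + s *\<^sub>R u \<in> W" if "\<bar>s\<bar> < d" for s using d(2)[of s] x(1) that by (cases "s = 0") auto
  let ?I = "{-d<..<d}"
  have "((\<lambda>s. x + s *\<^sub>R u) has_derivative (\<lambda>s. s *\<^sub>R u)) (at 0 within ?I)"
    by (auto intro!: derivative_eq_intros)
  moreover have "(T has_derivative hderiv T x) (at (x + 0 *\<^sub>R u) within (\<lambda>s. x + s *\<^sub>R u) ` ?I)"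
  proof -
    have "(\<lambda>s. x + s *\<^sub>R u) ` ?I \<subseteq> halfspace" using W T(2) openin_imp_subset by fastforce
    then show ?thesis using smooth_has_hderiv[OF T(1,2) x(1)] has_derivative_subset by simp blast
  qed
  ultimately have "(T \<circ> (\<lambda>s. x + s *\<^sub>R u) has_derivative hderiv T x \<circ> (\<lambda>s. s *\<^sub>R u)) (at 0 within ?I)"
    by (rule diff_chain_within)
  then have "(T \<circ> (\<lambda>s. x + s *\<^sub>R u) has_derivative hderiv T x \<circ> (\<lambda>s. s *\<^sub>R u)) (at 0)"
    using d(1) by (simp add: at_within_open[of 0 ?I])
  then have "((\<lambda>s. (T \<circ> (\<lambda>s. x + s *\<^sub>R u)) s $ bdir) has_derivative (\<lambda>s. (hderiv T x \<circ> (\<lambda>s. s *\<^sub>R u)) s $ bdir)) (at 0)"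
    by (rule bounded_linear.has_derivative[OF bounded_linear_vec_nth])
  moreover have "(\<lambda>s. (hderiv T x \<circ> (\<lambda>s. s *\<^sub>R u)) s $ bdir) = (*) (hderiv T x u $ bdir)"
    using linear_scale[OF has_derivative_linear[OF smooth_has_hderiv[OF T(1,2) x(1)]]] by (auto simp: fun_eq_iff)
  ultimately have D: "((\<lambda>s. T (x + s *\<^sub>R u) $ bdir) has_real_derivative hderiv T x u $ bdir) (at 0)"
    by (simp add: has_field_derivative_def comp_def)
  show ?thesis
  proof (rule DERIV_local_min[OF D d(1)], intro allI impI)
    fix s assume "\<bar>0 - s\<bar> < d"
    then have "T (x + s *\<^sub>R u) \<in> halfspace" using W[of s] T(3) by auto
    then show "T (x + 0 *\<^sub>R u) $ bdir \<le> T (x + s *\<^sub>R u) $ bdir" using x(2) by (simp add: halfspace_def)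
  qed
qed

section \<open>Integrating derivatives over the half-space\<close>

lemma set_integral_compact_support:
  fixes f :: "'a::euclidean_space \<Rightarrow> real"
  assumes "compact C" "C \<subseteq> W" "continuous_on C f" "\<And>x. x \<in> W \<Longrightarrow> x \<notin> C \<Longrightarrow> f x = 0"
  shows "set_integrable lborel W f" "(LINT x:W|lborel. f x) = (LINT x:C|lborel. f x)"
proof -
  have eq: "indicator W x *\<^sub>R f x = indicator C x *\<^sub>R f x" for x
    using assms(2,4) by (auto simp: indicator_def)
  show "set_integrable lborel W f"
    unfolding set_integrable_def eq using assms(1,3) by (rule borel_integrable_compact)
  show "(LINT x:W|lborel. f x) = (LINT x:C|lborel. f x)"
    unfolding set_lebesgue_integral_def eq ..
qed

lemma set_integral_pos:
  fixes f :: "'n::{finite,wellorder} vect \<Rightarrow> real"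
  assumes int: "set_integrable lborel W f" and nonneg: "\<And>x. x \<in> W \<Longrightarrow> 0 \<le> f x"
    and box: "cbox a b \<subseteq> W" and ab: "\<And>i. a $ i < b $ i" and \<delta>: "0 \<le> \<delta>" "\<And>x. x \<in> cbox a b \<Longrightarrow> \<delta> \<le> f x"
  shows "\<delta> * (\<Prod>i\<in>UNIV. b $ i - a $ i) \<le> (LINT x:W|lborel. f x)"
proof -
  have ne: "cbox a b \<noteq> {}" using ab by (simp add: interval_ne_empty_cart less_imp_le)
  have "(LINT x:cbox a b|lborel. \<delta>) \<le> (LINT x:W|lborel. f x)"
    unfolding set_lebesgue_integral_def
  proof (rule integral_mono)
    show "integrable lborel (\<lambda>x. indicator (cbox a b) x *\<^sub>R \<delta>)"
      by (intro borel_integrable_compact) auto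
    show "integrable lborel (\<lambda>x. indicator W x *\<^sub>R f x)" using int by (simp add: set_integrable_def)
    show "indicator (cbox a b) x *\<^sub>R \<delta> \<le> indicator W x *\<^sub>R f x" for x
      using nonneg[of x] box \<delta> by (auto simp: indicator_def)
  qed
  also have "(LINT x:cbox a b|lborel. \<delta>) = \<delta> * measure lborel (cbox a b)"
    by (simp add: set_lebesgue_integral_def)
  finally show ?thesis using content_cbox_cart[OF ne] by simp
qed

lemma lborel_integral_shift:
  fixes f :: "'a::euclidean_space \<Rightarrow> real"
  assumes "f \<in> borel_measurable borel"
  shows "(LINT x|lborel. f (c + x)) = (LINT x|lborel. f x)"
proof -
  have "(LINT x|lborel. f x) = (LINT x|distr lborel borel ((+) c). f x)" by (simp add: lborel_distr_plus)
  also have "\<dots> = (LINT x|lborel. f (c + x))" by (rule integral_distr) (use assms in auto)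
  finally show ?thesis ..
qed

lemma box_in_ball:
  fixes x :: "'n::{finite,wellorder} vect"
  assumes "0 < r"
  obtains s where "0 < s" "\<And>y. (\<And>i. \<bar>y $ i - x $ i\<bar> \<le> s) \<Longrightarrow> dist x y < r"
proof
  let ?s = "r / (2 * real CARD('n))"
  show "0 < ?s" using assms by simp
  fix y :: "'n vect" assume y: "\<And>i. \<bar>y $ i - x $ i\<bar> \<le> ?s"
  have "norm (y - x) \<le> (\<Sum>i\<in>UNIV. \<bar>(y - x) $ i\<bar>)" by (rule norm_le_l1_cart)
  also have "\<dots> \<le> (\<Sum>i\<in>(UNIV :: 'n set). ?s)" using y by (intro sum_mono) simp
  also have "\<dots> < r" using assms by simp
  finally show "dist x y < r" by (simp add: dist_norm norm_minus_commute)
qed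

lemma norm_axis_one: "norm (axis i (1::real) :: real ^ 'n) = 1"
  by (simp add: norm_eq_1 inner_axis_axis)

lemma prod_split_bdir:
  fixes f :: "'n::{finite,wellorder} \<Rightarrow> real"
  shows "(\<Prod>i\<in>UNIV. f i) = f bdir * (\<Prod>i\<in>UNIV - {bdir}. f i)"
  by (rule prod.remove) auto

text \<open>
  Integrals of partial derivatives over the half-space are computed by differentiating the translates of
  the function under the integral. This treats all dimensions at once and avoids writing the half-space
  as a product.
\<close>

locale compactly_supported =
  fixes \<psi> :: "'n::{finite,wellorder} vect \<Rightarrow> real" and C :: "('n vect) set"
  assumes smooth: "smooth_on \<psi> halfspace"
    and C: "compact C" "C \<subseteq> halfspace"
    and supp: "\<And>x. x \<in> halfspace \<Longrightarrow> x \<notin> C \<Longrightarrow> \<psi> x = 0"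
begin

lemma hopen_halfspace: "hopen (halfspace :: ('n vect) set)"
  using openin_topspace[of "top_of_set halfspace"] by simp

lemma closed_halfspace: "closed (halfspace :: ('n vect) set)"
  unfolding halfspace_def by (rule closed_halfspace_component_ge_cart)

lemma continuous: "continuous_on halfspace \<psi>"
  using smooth by (rule smooth_on_imp_continuous_on)

lemma continuous_partial: "continuous_on halfspace (partial i \<psi>)"
  using smooth_on_partial[OF smooth hopen_halfspace] by (rule smooth_on_imp_continuous_on)

lemma partial_supp: "x \<in> halfspace \<Longrightarrow> x \<notin> C \<Longrightarrow> partial i \<psi> x = 0"
proof -
  assume x: "x \<in> halfspace" "x \<notin> C"
  have "hopen (halfspace - C)" using C(1) by (auto simp: openin_open compact_imp_closed open_Compl intro!: exI[of _ "- C"])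
  then have "partial i \<psi> x = partial i (\<lambda>x. 0) x" by (rule partial_cong) (use x supp in auto)
  then show ?thesis using x by simp
qed

text \<open>
  The constant dominates the difference quotients, and bounds a function vanishing at the boundary by
  the distance from it.
\<close>

lemma Lipschitz:
  obtains B where "0 \<le> B" "\<And>x y. x \<in> halfspace \<Longrightarrow> y \<in> halfspace \<Longrightarrow> \<bar>\<psi> x - \<psi> y\<bar> \<le> B * norm (x - y)"
proof -
  let ?G = "\<lambda>x. \<Sum>i\<in>UNIV. \<bar>partial i \<psi> x\<bar>"
  have "continuous_on C ?G"
    using continuous_on_subset[OF continuous_partial C(2)] by (intro continuous_intros)
  then have "bounded (?G ` C)" using C(1) compact_continuous_image compact_imp_bounded by blast
  then obtain B where B: "\<And>x. x \<in> C \<Longrightarrow> ?G x \<le> B" unfolding bounded_real by fastforce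
  let ?B = "max B 0"
  have GB: "?G x \<le> ?B" if "x \<in> halfspace" for x
  proof (cases "x \<in> C")
    case True then show ?thesis using B by (simp add: max.coboundedI1)
  next
    case False then show ?thesis using partial_supp[OF that] by simp
  qed
  have "\<bar>\<psi> x - \<psi> y\<bar> \<le> ?B * norm (x - y)" if "x \<in> halfspace" "y \<in> halfspace" for x y
  proof -
    have "norm (\<psi> x - \<psi> y) \<le> ?B * norm (x - y)"
    proof (rule differentiable_bound[where S=halfspace and f'="hderiv \<psi>"])
      have "convex {x::'n vect. axis bdir 1 \<bullet> x \<ge> 0}" by (rule convex_halfspace_ge)
      then show "convex (halfspace :: ('n vect) set)" by (simp add: halfspace_def inner_axis')
      fix z :: "'n vect" assume z: "z \<in> halfspace"
      show "(\<psi> has_derivative hderiv \<psi> z) (at z within halfspace)"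
        by (rule smooth_has_hderiv[OF smooth hopen_halfspace z])
      show "onorm (hderiv \<psi> z) \<le> ?B"
      proof (rule onorm_le)
        fix v
        have "norm (hderiv \<psi> z v) \<le> (\<Sum>i\<in>UNIV. \<bar>v $ i * partial i \<psi> z\<bar>)"
          unfolding hderiv_partials[OF smooth hopen_halfspace z] by (simp add: sum_abs)
        also have "\<dots> \<le> (\<Sum>i\<in>UNIV. norm v * \<bar>partial i \<psi> z\<bar>)"
          by (intro sum_mono) (simp add: abs_mult component_le_norm_cart mult_right_mono)
        also have "\<dots> = ?G z * norm v" by (simp add: sum_distrib_left mult.commute)
        also have "\<dots> \<le> ?B * norm v" by (intro mult_right_mono GB z) simp
        finally show "norm (hderiv \<psi> z v) \<le> ?B * norm v" .
      qed
    qed (use that in auto)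
    then show ?thesis by simp
  qed
  then show thesis by (intro that[of ?B]) auto
qed

lemma shift_halfspace: "x \<in> halfspace \<Longrightarrow> 0 \<le> t \<Longrightarrow> x + t *\<^sub>R axis i 1 \<in> halfspace"
  by (auto simp: halfspace_def axis_def)

lemma quotient_tendsto_partial:
  assumes x: "x \<in> halfspace"
  shows "(\<lambda>n. (\<psi> (x + (1 / Suc n) *\<^sub>R axis i 1) - \<psi> x) * Suc n) \<longlonglongrightarrow> partial i \<psi> x"
proof -
  let ?l = "\<lambda>s::real. x + s *\<^sub>R axis i 1"
  have "(?l has_derivative (\<lambda>s. s *\<^sub>R axis i 1)) (at 0 within {0..})"
    by (auto intro!: derivative_eq_intros)
  moreover have "(\<psi> has_derivative hderiv \<psi> x) (at (?l 0) within ?l ` {0..})"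
  proof -
    have "?l ` {0..} \<subseteq> halfspace" using shift_halfspace[OF x] by auto
    then show ?thesis using smooth_has_hderiv[OF smooth hopen_halfspace x] has_derivative_subset by simp blast
  qed
  ultimately have "(\<psi> \<circ> ?l has_derivative hderiv \<psi> x \<circ> (\<lambda>s. s *\<^sub>R axis i 1)) (at 0 within {0..})"
    by (rule diff_chain_within)
  moreover have "hderiv \<psi> x \<circ> (\<lambda>s. s *\<^sub>R axis i 1) = (*) (partial i \<psi> x)"
    using linear_scale[OF has_derivative_linear[OF smooth_has_hderiv[OF smooth hopen_halfspace x]]]
    by (auto simp: partial_def fun_eq_iff)
  ultimately have "((\<psi> \<circ> ?l) has_real_derivative partial i \<psi> x) (at 0 within {0..})"
    by (simp add: has_field_derivative_def)
  then have "((\<lambda>s. (\<psi> (?l s) - \<psi> x) / s) \<longlongrightarrow> partial i \<psi> x) (at 0 within {0..})"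
    by (simp add: has_field_derivative_iff)
  moreover have "filterlim (\<lambda>n. 1 / real (Suc n)) (at 0 within {0..}) sequentially"
    unfolding filterlim_at using LIMSEQ_inverse_real_of_nat by (simp add: inverse_eq_divide)
  ultimately have "(\<lambda>n. (\<psi> (?l (1 / Suc n)) - \<psi> x) / (1 / Suc n)) \<longlonglongrightarrow> partial i \<psi> x"
    by (rule filterlim_compose)
  then show ?thesis by simp
qed

lemma integral_quotient_tendsto:
  "(\<lambda>n. LINT x:halfspace|lborel. (\<psi> (x + (1 / Suc n) *\<^sub>R axis i 1) - \<psi> x) * Suc n)
     \<longlonglongrightarrow> (LINT x:halfspace|lborel. partial i \<psi> x)"
proof -
  obtain B where B: "0 \<le> B" "\<And>x y. x \<in> halfspace \<Longrightarrow> y \<in> halfspace \<Longrightarrow> \<bar>\<psi> x - \<psi> y\<bar> \<le> B * norm (x - y)"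
    using Lipschitz by blast
  obtain R where R: "\<And>x. x \<in> C \<Longrightarrow> norm x \<le> R" using compact_imp_bounded[OF C(1)] bounded_iff by metis
  let ?h = "\<lambda>n x. x + (1 / real (Suc n)) *\<^sub>R axis i (1::real)"
  let ?s = "\<lambda>n x. indicator halfspace x *\<^sub>R ((\<psi> (?h n x) - \<psi> x) * Suc n)"
  \<comment> \<open>The translations have length at most 1, so the quotients live in a slightly larger ball.\<close>
  let ?w = "\<lambda>x::'n vect. indicator (cball 0 (R + 1)) x *\<^sub>R B"
  have H: "?h n x \<in> halfspace" if "x \<in> halfspace" for n x using shift_halfspace[OF that] by simp
  have H_meas: "halfspace \<in> sets (borel :: 'n vect measure)" using closed_halfspace by (rule borel_closed)
  show ?thesis
    unfolding set_lebesgue_integral_def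
  proof (rule integral_dominated_convergence[where w="?w"])
    show "(\<lambda>x. indicator halfspace x *\<^sub>R partial i \<psi> x) \<in> borel_measurable lborel"
      using borel_measurable_continuous_on_indicator[OF H_meas continuous_partial] by simp
    show "?s n \<in> borel_measurable lborel" for n
    proof -
      have "continuous_on halfspace (\<lambda>x. \<psi> (?h n x))"
        by (rule continuous_on_compose2[OF continuous]) (use H in \<open>auto intro!: continuous_intros\<close>)
      then have "continuous_on halfspace (\<lambda>x. (\<psi> (?h n x) - \<psi> x) * Suc n)"
        by (intro continuous_intros continuous)
      from borel_measurable_continuous_on_indicator[OF H_meas this] show ?thesis by simp
    qed
    show "integrable lborel ?w" by (intro borel_integrable_compact) auto
    show "AE x in lborel. (\<lambda>n. ?s n x) \<longlonglongrightarrow> indicator halfspace x *\<^sub>R partial i \<psi> x"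
      using quotient_tendsto_partial by (auto simp: indicator_def)
    show "AE x in lborel. norm (?s n x) \<le> ?w x" for n
    proof (intro AE_I2)
      fix x :: "'n vect"
      show "norm (?s n x) \<le> ?w x"
      proof (cases "x \<in> halfspace")
        case True
        have nh: "norm (?h n x - x) = 1 / Suc n" by (simp add: norm_axis_one)
        show ?thesis
        proof (cases "norm x \<le> R + 1")
          case inside: True
          have "\<bar>\<psi> (?h n x) - \<psi> x\<bar> \<le> B * (1 / Suc n)" using B(2)[OF H[OF True] True, of n] nh by simp
          then have "\<bar>\<psi> (?h n x) - \<psi> x\<bar> * Suc n \<le> B" by (simp add: field_simps)
          then show ?thesis using True inside by (simp add: abs_mult)
        next
          case False
          have "norm x \<le> norm (?h n x) + 1 / Suc n" using norm_triangle_sub[of x "?h n x"] nh by (simp add: norm_minus_commute)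
          moreover have "1 / real (Suc n) \<le> 1" by simp
          ultimately have "R < norm (?h n x)" using False by linarith
          moreover have "R < norm x" using False by linarith
          ultimately have "\<psi> (?h n x) = 0" "\<psi> x = 0" using R supp[OF H[OF True]] supp[OF True] by force+
          then show ?thesis using B(1) by simp
        qed
      qed (use B(1) in simp)
    qed
  qed
qed

lemma integral_shift:
  assumes "0 \<le> t"
  shows "(LINT x:halfspace|lborel. \<psi> (x + t *\<^sub>R axis i 1)) =
    (LINT x:{x. t * axis i 1 $ bdir \<le> x $ bdir}|lborel. \<psi> x)"
proof -
  let ?A = "{x::'n vect. t * axis i 1 $ bdir \<le> x $ bdir}"
  let ?f = "\<lambda>x. indicator ?A x *\<^sub>R \<psi> x"
  have "closed ?A" by (rule closed_halfspace_component_ge_cart)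
  moreover have "?A \<subseteq> halfspace" using assms by (auto simp: halfspace_def axis_def split: if_splits)
  ultimately have "?f \<in> borel_measurable borel"
    using continuous_on_subset[OF continuous] borel_closed borel_measurable_continuous_on_indicator by blast
  from lborel_integral_shift[OF this, of "t *\<^sub>R axis i 1"]
  show ?thesis by (simp add: set_lebesgue_integral_def halfspace_def indicator_def add.commute)
qed

lemma integrable_part:
  assumes "A \<subseteq> halfspace" "closed A" shows "set_integrable lborel A \<psi>"
proof (rule set_integral_compact_support(1)[of "A \<inter> C"])
  show "continuous_on (A \<inter> C) \<psi>"
    by (rule continuous_on_subset[OF continuous]) (use assms(1) in auto)
qed (use C(1) supp assms in \<open>auto intro: closed_Int_compact\<close>)

lemma integral_quotient:
  assumes "0 < t"
  shows "(LINT x:halfspace|lborel. (\<psi> (x + t *\<^sub>R axis i 1) - \<psi> x) * d) =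
    ((LINT x:{x. t * axis i 1 $ bdir \<le> x $ bdir}|lborel. \<psi> x) - (LINT x:halfspace|lborel. \<psi> x)) * d"
proof -
  let ?A = "{x::'n vect. t * axis i 1 $ bdir \<le> x $ bdir}"
  let ?f = "\<lambda>x. indicator ?A x *\<^sub>R \<psi> x"
  have A: "closed ?A" "?A \<subseteq> halfspace" 
    using assms by (auto simp: halfspace_def axis_def closed_halfspace_component_ge_cart split: if_splits)
  have "integrable lborel ?f" using integrable_part[OF A(2,1)] by (simp add: set_integrable_def)
  then have "integrable (distr lborel borel ((+) (t *\<^sub>R axis i 1))) ?f" by (simp add: lborel_distr_plus)
  then have "integrable lborel (\<lambda>x. ?f (t *\<^sub>R axis i 1 + x))"
    using borel_measurable_integrable[OF \<open>integrable lborel ?f\<close>] by (subst (asm) integrable_distr_eq) auto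
  then have 1: "set_integrable lborel halfspace (\<lambda>x. \<psi> (x + t *\<^sub>R axis i 1))"
    by (simp add: set_integrable_def halfspace_def indicator_def add.commute)
  have 2: "set_integrable lborel halfspace \<psi>" by (intro integrable_part closed_halfspace) auto
  have "(LINT x:halfspace|lborel. (\<psi> (x + t *\<^sub>R axis i 1) - \<psi> x) * d) =
      (LINT x:halfspace|lborel. \<psi> (x + t *\<^sub>R axis i 1) - \<psi> x) * d"
    by (rule set_integral_mult_left)
  also have "\<dots> = ((LINT x:halfspace|lborel. \<psi> (x + t *\<^sub>R axis i 1)) - (LINT x:halfspace|lborel. \<psi> x)) * d"
    using set_integral_diff(2)[OF 1 2] by simp
  finally show ?thesis using integral_shift[of t i] assms by simp
qed

lemma integral_partial_tangential:
  assumes "i \<noteq> bdir" shows "(LINT x:halfspace|lborel. partial i \<psi> x) = 0"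
proof -
  have "(LINT x:halfspace|lborel. (\<psi> (x + (1 / Suc n) *\<^sub>R axis i 1) - \<psi> x) * Suc n) = 0" for n
    using assms by (subst integral_quotient) (simp_all add: axis_def halfspace_def)
  then have "(\<lambda>n. 0) \<longlonglongrightarrow> (LINT x:halfspace|lborel. partial i \<psi> x)"
    using integral_quotient_tendsto[of i] by (simp only:)
  then show ?thesis using LIMSEQ_unique[OF tendsto_const] by metis
qed

text \<open>
  Translating in the normal direction loses a slab at the boundary; the integrated difference quotient is
  minus the integral over the slab divided by its width.
\<close>

lemma slab_tendsto:
  "(\<lambda>n. (LINT x:{x. 0 \<le> x $ bdir \<and> x $ bdir \<le> 1 / Suc n}|lborel. \<psi> x) * Suc n)
     \<longlonglongrightarrow> - (LINT x:halfspace|lborel. partial bdir \<psi> x)"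
proof -
  have "(LINT x:halfspace|lborel. (\<psi> (x + (1 / Suc n) *\<^sub>R axis bdir 1) - \<psi> x) * Suc n) =
      - ((LINT x:{x. 0 \<le> x $ bdir \<and> x $ bdir \<le> 1 / Suc n}|lborel. \<psi> x) * Suc n)" for n
  proof -
    define t where "t = 1 / real (Suc n)"
    have t0: "0 < t" by (simp add: t_def)
    let ?t = t
    let ?A = "{x::'n vect. ?t \<le> x $ bdir}" and ?S = "{x::'n vect. 0 \<le> x $ bdir \<and> x $ bdir \<le> ?t}"
    have AE: "AE x in lborel. (x::'n vect) \<notin> {x. x $ bdir = ?t}"
    proof (rule AE_not_in)
      have "negligible {x::'n vect. axis bdir 1 \<bullet> x = ?t}" by (intro negligible_hyperplane) (simp add: axis_eq_0_iff)
      moreover have "{x::'n vect. axis bdir 1 \<bullet> x = ?t} = {x. x $ bdir = ?t}"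
        by (simp add: inner_axis' )
      moreover have "closed {x::'n vect. x $ bdir = ?t}" by (intro closed_Collect_eq continuous_intros)
      ultimately show "{x::'n vect. x $ bdir = ?t} \<in> null_sets lborel"
        by (simp add: negligible_iff_null_sets null_sets_completion_iff borel_closed)
    qed
    have A: "closed ?A" "?A \<subseteq> halfspace"
      using t0 by (auto simp: halfspace_def closed_halfspace_component_ge_cart)
    have S: "closed ?S" "?S \<subseteq> halfspace"
      by (auto simp: halfspace_def intro!: closed_Collect_conj closed_halfspace_component_ge_cart closed_halfspace_component_le_cart)
    have "(LINT x:halfspace|lborel. \<psi> x) = (LINT x|lborel. indicator ?A x *\<^sub>R \<psi> x + indicator ?S x *\<^sub>R \<psi> x)"
      unfolding set_lebesgue_integral_def
    proof (rule integral_cong_AE)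
      show "AE x in lborel. indicator halfspace x *\<^sub>R \<psi> x = indicator ?A x *\<^sub>R \<psi> x + indicator ?S x *\<^sub>R \<psi> x"
        using AE
      proof eventually_elim
        case (elim x)
        show ?case using elim t0 by (auto simp: indicator_def halfspace_def)
      qed
    qed (use integrable_part[OF A(2,1)] integrable_part[OF S(2,1)] integrable_part[OF subset_refl closed_halfspace]
          in \<open>auto simp: set_integrable_def intro!: borel_measurable_integrable\<close>)
    also have "\<dots> = (LINT x:?A|lborel. \<psi> x) + (LINT x:?S|lborel. \<psi> x)"
      using integrable_part[OF A(2,1)] integrable_part[OF S(2,1)]
      unfolding set_integrable_def set_lebesgue_integral_def by (rule Bochner_Integration.integral_add)
    finally show ?thesis
      unfolding t_def[symmetric] using t0 by (subst integral_quotient) (simp_all add: algebra_simps)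
  qed
  then have "(\<lambda>n. - ((LINT x:{x. 0 \<le> x $ bdir \<and> x $ bdir \<le> 1 / Suc n}|lborel. \<psi> x) * Suc n))
     \<longlonglongrightarrow> (LINT x:halfspace|lborel. partial bdir \<psi> x)"
    using integral_quotient_tendsto[of bdir] by simp
  from tendsto_minus[OF this] show ?thesis by simp
qed

text \<open>
  A slab of width \<open>t\<close> at the boundary meets the support in volume \<open>O(t)\<close>, and there the function
  is itself \<open>O(t)\<close>; so its mean over the slab tends to 0.
\<close>

lemma integral_partial_zero:
  assumes zero: "\<And>x. x $ bdir = 0 \<Longrightarrow> \<psi> x = 0"
  shows "(LINT x:halfspace|lborel. partial bdir \<psi> x) = 0"
proof -
  obtain B where B: "0 \<le> B" "\<And>x y. x \<in> halfspace \<Longrightarrow> y \<in> halfspace \<Longrightarrow> \<bar>\<psi> x - \<psi> y\<bar> \<le> B * norm (x - y)"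
    using Lipschitz by blast
  obtain R where R: "\<And>x. x \<in> C \<Longrightarrow> norm x \<le> R" using compact_imp_bounded[OF C(1)] bounded_iff by metis
  let ?K = "\<Prod>i\<in>UNIV - {bdir::'n}. 2 * max R 0"
  have bound: "\<bar>(LINT x:{x. 0 \<le> x $ bdir \<and> x $ bdir \<le> t}|lborel. \<psi> x)\<bar> \<le> B * t * (t * ?K)" if t: "0 \<le> t" for t
  proof -
    let ?S = "{x::'n vect. 0 \<le> x $ bdir \<and> x $ bdir \<le> t}"
    let ?a = "(\<chi> i. if i = bdir then 0 else - max R 0) :: 'n vect"
    let ?b = "(\<chi> i. if i = bdir then t else max R 0) :: 'n vect"
    have S: "closed ?S" "?S \<subseteq> halfspace"
      by (auto simp: halfspace_def intro!: closed_Collect_conj closed_halfspace_component_ge_cart closed_halfspace_component_le_cart)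
    have "\<bar>LINT x:?S|lborel. \<psi> x\<bar> \<le> (LINT x:cbox ?a ?b|lborel. B * t)"
      unfolding set_lebesgue_integral_def real_norm_def[symmetric]
    proof (rule order_trans[OF integral_norm_bound integral_mono])
      show "integrable lborel (\<lambda>x. norm (indicator ?S x *\<^sub>R \<psi> x))"
        using integrable_part[OF S(2,1)] by (simp add: set_integrable_def)
      show "integrable lborel (\<lambda>x. indicator (cbox ?a ?b) x *\<^sub>R (B * t))"
        by (intro borel_integrable_compact) auto
      fix x :: "'n vect"
      show "norm (indicator ?S x *\<^sub>R \<psi> x) \<le> indicator (cbox ?a ?b) x *\<^sub>R (B * t)"
      proof (cases "x \<in> ?S \<and> x \<in> C")
        case False
        then have "indicator ?S x *\<^sub>R \<psi> x = 0" using supp S(2) by (auto simp: indicator_def)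
        moreover have "0 \<le> indicator (cbox ?a ?b) x *\<^sub>R (B * t)" using B(1) t by simp
        ultimately show ?thesis by (simp only: norm_zero)
      next
        case True
        let ?y = "x - (x $ bdir) *\<^sub>R axis bdir 1"
        have y: "?y $ bdir = 0" "norm (x - ?y) \<le> t" using True by (auto simp: norm_axis_one)
        have "\<bar>\<psi> x\<bar> \<le> B * norm (x - ?y)"
          using B(2)[of x ?y] zero[of ?y] y(1) True S(2) by (auto simp: halfspace_def)
        also have "\<dots> \<le> B * t" using y(2) B(1) by (rule mult_left_mono)
        finally have "\<bar>\<psi> x\<bar> \<le> B * t" .
        moreover have "x \<in> cbox ?a ?b"
        proof -
          have "\<bar>x $ i\<bar> \<le> max R 0" for i using R[of x] True component_le_norm_cart[of x i] by linarith
          then have "- max R 0 \<le> x $ i" "x $ i \<le> max R 0" for i by (metis abs_le_iff minus_le_iff)+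
          then show ?thesis using True by (auto simp: mem_box_cart)
        qed
        ultimately show ?thesis using True by simp
      qed
    qed
    also have "\<dots> = B * t * measure lborel (cbox ?a ?b)" by (simp add: set_lebesgue_integral_def)
    also have "measure lborel (cbox ?a ?b) = t * ?K"
    proof -
      have "cbox ?a ?b \<noteq> {}" using t by (auto simp: interval_ne_empty_cart)
      then show ?thesis by (simp add: content_cbox_cart prod_split_bdir)
    qed
    finally show ?thesis .
  qed
  have "(\<lambda>n. B * ?K * (1 / Suc n)) \<longlonglongrightarrow> B * ?K * 0"
    using LIMSEQ_inverse_real_of_nat by (intro tendsto_mult tendsto_const) (simp add: inverse_eq_divide)
  then have lim: "(\<lambda>n. B * ?K * (1 / Suc n)) \<longlonglongrightarrow> 0" by (simp only: mult_zero_right)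
  have "(\<lambda>n. (LINT x:{x. 0 \<le> x $ bdir \<and> x $ bdir \<le> 1 / Suc n}|lborel. \<psi> x) * Suc n) \<longlonglongrightarrow> 0"
  proof (rule Lim_null_comparison[OF eventuallyI lim])
    fix n
    have "\<bar>(LINT x:{x. 0 \<le> x $ bdir \<and> x $ bdir \<le> 1 / Suc n}|lborel. \<psi> x)\<bar> * Suc n
        \<le> B * (1 / Suc n) * ((1 / Suc n) * ?K) * Suc n"
      by (intro mult_right_mono bound) auto
    also have "\<dots> = B * ?K * (1 / Suc n)" by simp
    finally show "norm ((LINT x:{x. 0 \<le> x $ bdir \<and> x $ bdir \<le> 1 / Suc n}|lborel. \<psi> x) * Suc n) \<le> B * ?K * (1 / Suc n)"
      by (simp add: abs_mult)
  qed
  from LIMSEQ_unique[OF slab_tendsto this] show ?thesis by simp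
qed

text \<open>
  Near \<open>x0\<close> the function is bounded below on boxes of width \<open>t\<close> in the normal direction and of
  fixed size in the others, so its mean over the slab stays away from 0.
\<close>

lemma integral_partial_negative:
  assumes nonneg: "\<And>x. x \<in> halfspace \<Longrightarrow> 0 \<le> \<psi> x" and x0: "x0 $ bdir = 0" "0 < \<psi> x0"
  shows "(LINT x:halfspace|lborel. partial bdir \<psi> x) < 0"
proof -
  have x0H: "x0 \<in> halfspace" using x0(1) by (simp add: halfspace_def)
  obtain r where r: "0 < r" "\<And>y. y \<in> halfspace \<Longrightarrow> dist y x0 < r \<Longrightarrow> dist (\<psi> y) (\<psi> x0) < \<psi> x0 / 2"
    using continuous x0H x0(2) unfolding continuous_on_iff by (metis half_gt_zero)
  obtain s where s: "0 < s" "\<And>y. (\<And>i. \<bar>y $ i - x0 $ i\<bar> \<le> s) \<Longrightarrow> dist x0 y < r"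
    using box_in_ball[OF r(1)] by blast
  let ?K = "\<Prod>i\<in>UNIV - {bdir::'n}. 2 * s"
  have K: "0 < ?K" using s(1) by (intro prod_pos) auto
  have bound: "\<psi> x0 / 2 * ?K \<le> (LINT x:{x. 0 \<le> x $ bdir \<and> x $ bdir \<le> 1 / Suc n}|lborel. \<psi> x) * Suc n"
    if n: "1 / real (Suc n) \<le> s" for n
  proof -
    let ?t = "1 / real (Suc n)"
    have t: "0 < ?t" by simp
    let ?S = "{x::'n vect. 0 \<le> x $ bdir \<and> x $ bdir \<le> ?t}"
    let ?a = "(\<chi> i. if i = bdir then 0 else x0 $ i - s) :: 'n vect"
    let ?b = "(\<chi> i. if i = bdir then ?t else x0 $ i + s) :: 'n vect"
    have S: "closed ?S" "?S \<subseteq> halfspace"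
      by (auto simp: halfspace_def intro!: closed_Collect_conj closed_halfspace_component_ge_cart closed_halfspace_component_le_cart)
    have "\<psi> x0 / 2 * (\<Prod>i\<in>UNIV. ?b $ i - ?a $ i) \<le> (LINT x:?S|lborel. \<psi> x)"
    proof (rule set_integral_pos)
      show "set_integrable lborel ?S \<psi>" using integrable_part[OF S(2,1)] .
      show "0 \<le> \<psi> x" if "x \<in> ?S" for x using that S(2) nonneg by blast
      have box: "(if i = bdir then 0 else x0 $ i - s) \<le> x $ i \<and> x $ i \<le> (if i = bdir then ?t else x0 $ i + s)"
        if "x \<in> cbox ?a ?b" for x i using that by (simp add: mem_box_cart del: of_nat_Suc)
      show sub: "cbox ?a ?b \<subseteq> ?S" using box[of _ bdir] by auto
      show "?a $ i < ?b $ i" for i using s(1) t by simp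
      show "0 \<le> \<psi> x0 / 2" using x0(2) by simp
      fix x assume x: "x \<in> cbox ?a ?b"
      have "\<bar>x $ i - x0 $ i\<bar> \<le> s" for i
        using box[OF x, of i] n x0(1) s(1) by (cases "i = bdir") (auto simp del: of_nat_Suc)
      then have "dist x x0 < r" using s(2)[of x] by (simp add: dist_commute)
      then have "\<bar>\<psi> x - \<psi> x0\<bar> < \<psi> x0 / 2" using r(2)[of x] sub S(2) x by (auto simp: dist_real_def)
      then show "\<psi> x0 / 2 \<le> \<psi> x" by linarith
    qed
    moreover have "(\<Prod>i\<in>UNIV. ?b $ i - ?a $ i) = ?t * ?K" by (simp add: prod_split_bdir)
    ultimately have "\<psi> x0 / 2 * (?t * ?K) \<le> (LINT x:?S|lborel. \<psi> x)" by metis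
    then have "\<psi> x0 / 2 * (?t * ?K) * Suc n \<le> (LINT x:?S|lborel. \<psi> x) * Suc n"
      by (rule mult_right_mono) simp
    moreover have "a * ((1 / real (Suc n)) * k) * real (Suc n) = a * k" for a k :: real by simp
    ultimately show ?thesis by metis
  qed
  obtain N where N: "inverse (real (Suc N)) < s" using reals_Archimedean[OF s(1)] by blast
  have "\<psi> x0 / 2 * ?K \<le> - (LINT x:halfspace|lborel. partial bdir \<psi> x)"
  proof (rule LIMSEQ_le_const[OF slab_tendsto], intro exI allI impI bound)
    fix n assume "N \<le> n"
    then have "1 / real (Suc n) \<le> 1 / real (Suc N)" by (simp add: frac_le)
    then show "1 / real (Suc n) \<le> s" using N by (simp add: inverse_eq_divide)
  qed
  moreover have "0 < \<psi> x0 / 2 * ?K" using K x0(2) by simp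
  ultimately show ?thesis by linarith
qed

end

section \<open>Linear algebra of positive definite matrices\<close>

lemma inner_transpose:
  fixes A :: "real ^ 'n ^ 'm"
  shows "(transpose A *v u) \<bullet> v = u \<bullet> (A *v v)"
  by (simp only: transpose_matrix_vector dot_lmul_matrix)

lemma spd_invertible: "spd A \<Longrightarrow> invertible A"
  using spd_det_pos[of A] by (simp add: invertible_det_nz)

lemma matrix_inv_cancel:
  fixes A :: "real ^ 'n ^ 'n"
  assumes "invertible A"
  shows "A *v (matrix_inv A *v x) = x" "matrix_inv A *v (A *v x) = x"
  using matrix_inv_mult[OF assms] by (simp_all add: matrix_vector_mul_assoc)

lemma matrix_inv_eqI:
  fixes A :: "real ^ 'n ^ 'n"
  assumes "invertible A" "A *v x = y" shows "matrix_inv A *v y = x"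
  using matrix_inv_cancel(2)[OF assms(1), of x] assms(2) by simp

lemma spd_inner_commute:
  fixes A :: "'n::{finite,wellorder} mat"
  assumes "spd A" shows "x \<bullet> (A *v y) = y \<bullet> (A *v x)"
proof -
  have "transpose A = A" using assms by (simp add: spd_def)
  then show ?thesis using inner_transpose[of A x y] by (metis inner_commute)
qed

lemma spd_inv_inner_commute:
  fixes A :: "'n::{finite,wellorder} mat"
  assumes "spd A" shows "x \<bullet> (matrix_inv A *v y) = y \<bullet> (matrix_inv A *v x)"
  using spd_inner_commute[OF assms, of "matrix_inv A *v x" "matrix_inv A *v y"]
  by (simp add: matrix_inv_cancel[OF spd_invertible[OF assms]] inner_commute)

lemma spd_inv_pos:
  fixes A :: "'n::{finite,wellorder} mat"
  assumes "spd A" "x \<noteq> 0" shows "0 < x \<bullet> (matrix_inv A *v x)"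
proof -
  let ?y = "matrix_inv A *v x"
  have x: "A *v ?y = x" using matrix_inv_cancel[OF spd_invertible[OF assms(1)]] by simp
  then have "?y \<noteq> 0" using assms(2) by force
  then have "0 < ?y \<bullet> (A *v ?y)" using assms(1) by (simp add: spd_def)
  then show ?thesis using x by (simp add: inner_commute)
qed

text \<open>
  The outward normal is a negative multiple of the gradient of the first coordinate, so pairing with it
  reads off the first component of a vector.
\<close>

lemma normal_unique:
  fixes G :: "'n::{finite,wellorder} mat"
  assumes G: "spd G"
  defines "P \<equiv> \<lambda>v. v \<bullet> (G *v v) = 1 \<and> (\<forall>u. u $ bdir = 0 \<longrightarrow> u \<bullet> (G *v v) = 0) \<and> v $ bdir < 0"
  obtains s where "0 < s" "G *v (THE v. P v) = - s *\<^sub>R axis bdir 1"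
proof -
  let ?e = "axis bdir 1 :: 'n vect"
  let ?g = "matrix_inv G *v ?e"
  define a where "a = ?e \<bullet> ?g"
  note inv = matrix_inv_cancel[OF spd_invertible[OF G]]
  have a: "0 < a" unfolding a_def using spd_inv_pos[OF G, of ?e] by (simp add: axis_eq_0_iff)
  have gb: "?g $ bdir = a" by (simp add: a_def inner_axis')
  let ?n = "- (1 / sqrt a) *\<^sub>R ?g"
  have Gn: "G *v ?n = - (1 / sqrt a) *\<^sub>R ?e" by (simp only: matrix_vector_mult_scaleR inv)
  have "P ?n"
    unfolding P_def Gn
  proof (intro conjI allI impI)
    show "?n \<bullet> (- (1 / sqrt a) *\<^sub>R ?e) = 1"
    proof -
      have "?n \<bullet> (- (1 / sqrt a) *\<^sub>R ?e) = a / (sqrt a * sqrt a)" using gb by (simp add: inner_axis)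
      also have "\<dots> = 1" using a by (simp only: real_sqrt_mult_self abs_of_pos) simp
      finally show ?thesis .
    qed
    show "u \<bullet> (- (1 / sqrt a) *\<^sub>R ?e) = 0" if "u $ bdir = 0" for u using that by (simp add: inner_axis)
    show "?n $ bdir < 0" using a gb by simp
  qed
  moreover have "v = ?n" if v: "P v" for v
  proof -
    let ?c = "(G *v v) $ bdir"
    have "(G *v v) $ i = 0" if "i \<noteq> bdir" for i
    proof -
      have "axis i 1 \<bullet> (G *v v) = 0" using v that unfolding P_def by (auto simp: axis_def)
      then show ?thesis by (simp add: inner_axis')
    qed
    then have Gv: "G *v v = ?c *\<^sub>R ?e" by (simp add: vec_eq_iff axis_def)
    then have vc: "v = ?c *\<^sub>R ?g" using inv(2)[of v] by (metis matrix_vector_mult_scaleR)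
    have "v $ bdir = ?c * a" using gb by (subst vc) simp
    moreover have "v \<bullet> (G *v v) = ?c * v $ bdir" by (subst Gv) (simp add: inner_axis)
    ultimately have ca: "?c * ?c * a = 1" and neg: "?c * a < 0" using v unfolding P_def by (simp_all add: mult.assoc)
    have c0: "?c < 0" using neg a by (simp add: mult_less_0_iff)
    have "(- ?c)\<^sup>2 = 1 / a" using ca a by (simp add: power2_eq_square field_simps)
    then have "- ?c = sqrt (1 / a)" using c0 by (metis less_imp_le neg_0_le_iff_le real_sqrt_unique)
    then have "?c = - (1 / sqrt a)" by (simp add: real_sqrt_divide)
    then show ?thesis using vc by simp
  qed
  ultimately have "(THE v. P v) = ?n" by (rule the_equality)
  then show thesis using Gn a by (intro that[of "1 / sqrt a"]) simp_all
qed

section \<open>Charts and tensor fields\<close>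

lemma smooth_components_cong:
  assumes "\<And>\<kappa> p. \<kappa> \<in> atlas M \<Longrightarrow> p \<in> fst \<kappa> \<Longrightarrow> T \<kappa> p = T' \<kappa> p"
  shows "smooth_components M T \<longleftrightarrow> smooth_components M T'"
  unfolding smooth_components_def
  using assms by (intro ball_cong smooth_on_cong refl) (auto simp: chart_inv_def inv_into_into)

locale riemannian =
  fixes M :: "('m, 'n::{finite,wellorder}) rmanifold"
  assumes manifold: "compact_riemannian_manifold M"
begin

abbreviation img :: "('m, 'n) chart \<Rightarrow> ('n vect) set" where
  "img \<kappa> \<equiv> snd \<kappa> ` fst \<kappa>"

abbreviation overlap :: "('m, 'n) chart \<Rightarrow> ('m, 'n) chart \<Rightarrow> ('n vect) set" where
  "overlap \<kappa> \<kappa>' \<equiv> snd \<kappa> ` (fst \<kappa> \<inter> fst \<kappa>')"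

lemma manifold_facts:
  shows "Hausdorff_space (mspace M)" "compact_space (mspace M)"
    "\<forall>\<kappa>\<in>atlas M. is_chart (mspace M) \<kappa>" "(\<Union>\<kappa>\<in>atlas M. fst \<kappa>) = topspace (mspace M)"
    "\<forall>\<kappa>\<in>atlas M. \<forall>\<kappa>'\<in>atlas M. smooth_on (transition \<kappa> \<kappa>') (overlap \<kappa> \<kappa>')"
    "\<forall>\<kappa>\<in>atlas M. \<forall>p\<in>fst \<kappa>. spd (gram M \<kappa> p)"
    "\<forall>\<kappa>\<in>atlas M. \<forall>\<kappa>'\<in>atlas M. \<forall>p\<in>fst \<kappa> \<inter> fst \<kappa>'. gram M \<kappa> p =
      transpose (transition_jac \<kappa> \<kappa>' p) ** gram M \<kappa>' p ** transition_jac \<kappa> \<kappa>' p"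
    "smooth_components M (gram M)"
proof -
  note a = manifold[unfolded compact_riemannian_manifold_def]
  note b = a[THEN conjunct2, THEN conjunct2]
  note c = b[THEN conjunct2, THEN conjunct2]
  note d = c[THEN conjunct2, THEN conjunct2]
  from a show "Hausdorff_space (mspace M)" by (rule conjunct1)
  from b show "compact_space (mspace M)" by (rule conjunct1)
  from b[THEN conjunct2] show "\<forall>\<kappa>\<in>atlas M. is_chart (mspace M) \<kappa>" by (rule conjunct1)
  from c show "(\<Union>\<kappa>\<in>atlas M. fst \<kappa>) = topspace (mspace M)" by (rule conjunct1)
  from c[THEN conjunct2]
  show "\<forall>\<kappa>\<in>atlas M. \<forall>\<kappa>'\<in>atlas M. smooth_on (transition \<kappa> \<kappa>') (overlap \<kappa> \<kappa>')" by (rule conjunct1)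
  from d show "\<forall>\<kappa>\<in>atlas M. \<forall>p\<in>fst \<kappa>. spd (gram M \<kappa> p)" by (rule conjunct1)
  from d[THEN conjunct2] show "\<forall>\<kappa>\<in>atlas M. \<forall>\<kappa>'\<in>atlas M. \<forall>p\<in>fst \<kappa> \<inter> fst \<kappa>'. gram M \<kappa> p =
      transpose (transition_jac \<kappa> \<kappa>' p) ** gram M \<kappa>' p ** transition_jac \<kappa> \<kappa>' p" by (rule conjunct1)
  from d[THEN conjunct2] show "smooth_components M (gram M)" by (rule conjunct2)
qed

lemma chart: "\<kappa> \<in> atlas M \<Longrightarrow> is_chart (mspace M) \<kappa>"
  using manifold_facts(3) by blast

lemma openin_domain: "\<kappa> \<in> atlas M \<Longrightarrow> openin (mspace M) (fst \<kappa>)"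
  using chart by (simp add: is_chart_def)

lemma domain_subset: "\<kappa> \<in> atlas M \<Longrightarrow> fst \<kappa> \<subseteq> topspace (mspace M)"
  using openin_domain openin_subset by blast

lemma topspace_domain: "\<kappa> \<in> atlas M \<Longrightarrow> topspace (subtopology (mspace M) (fst \<kappa>)) = fst \<kappa>"
  using domain_subset by (simp add: Int_absorb1)

lemma chart_ex: "p \<in> topspace (mspace M) \<Longrightarrow> \<exists>\<kappa>. \<kappa> \<in> atlas M \<and> p \<in> fst \<kappa>"
  using manifold_facts(4) by blast

lemma chart_at:
  assumes "p \<in> topspace (mspace M)" shows "chart_at M p \<in> atlas M" "p \<in> fst (chart_at M p)"
  using someI_ex[OF chart_ex[OF assms]] by (simp_all add: chart_at_def)

lemma chart_homeomorphic:
  "\<kappa> \<in> atlas M \<Longrightarrow> homeomorphic_map (subtopology (mspace M) (fst \<kappa>)) (top_of_set (img \<kappa>)) (snd \<kappa>)"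
  using chart by (simp add: is_chart_def)

lemma chart_inj: "\<kappa> \<in> atlas M \<Longrightarrow> inj_on (snd \<kappa>) (fst \<kappa>)"
  using homeomorphic_imp_injective_map[OF chart_homeomorphic] topspace_domain by metis

lemma chart_inv_snd: "\<kappa> \<in> atlas M \<Longrightarrow> p \<in> fst \<kappa> \<Longrightarrow> chart_inv \<kappa> (snd \<kappa> p) = p"
  by (simp add: chart_inv_def chart_inj)

lemma chart_inv_in: "x \<in> img \<kappa> \<Longrightarrow> chart_inv \<kappa> x \<in> fst \<kappa>"
  by (simp add: chart_inv_def inv_into_into)

lemma snd_chart_inv: "x \<in> img \<kappa> \<Longrightarrow> snd \<kappa> (chart_inv \<kappa> x) = x"
  by (simp add: chart_inv_def f_inv_into_f)

lemma hopen_img: "\<kappa> \<in> atlas M \<Longrightarrow> hopen (img \<kappa>)"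
  using chart by (simp add: is_chart_def)

lemma hopen_image:
  assumes "\<kappa> \<in> atlas M" "openin (mspace M) U" "U \<subseteq> fst \<kappa>"
  shows "hopen (snd \<kappa> ` U)"
proof -
  have "openin (subtopology (mspace M) (fst \<kappa>)) U"
    using assms openin_domain by (simp add: openin_open_subtopology)
  then have "openin (top_of_set (img \<kappa>)) (snd \<kappa> ` U)"
    using homeomorphic_imp_open_map[OF chart_homeomorphic[OF assms(1)]] by (simp add: open_map_def)
  then show ?thesis using hopen_img[OF assms(1)] by (rule openin_trans)
qed

lemma hopen_overlap: "\<kappa> \<in> atlas M \<Longrightarrow> \<kappa>' \<in> atlas M \<Longrightarrow> hopen (overlap \<kappa> \<kappa>')"
  by (intro hopen_image openin_Int openin_domain) auto

lemma img_halfspace: "\<kappa> \<in> atlas M \<Longrightarrow> img \<kappa> \<subseteq> halfspace"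
  using hopen_img openin_imp_subset by blast

lemma compact_image:
  assumes "\<kappa> \<in> atlas M" "compactin (mspace M) S" "S \<subseteq> fst \<kappa>"
  shows "compact (snd \<kappa> ` S)"
proof -
  have "compactin (subtopology (mspace M) (fst \<kappa>)) S" using assms by (simp add: compactin_subtopology)
  then have "compactin (top_of_set (img \<kappa>)) (snd \<kappa> ` S)"
    using image_compactin homeomorphic_imp_continuous_map[OF chart_homeomorphic[OF assms(1)]] by blast
  then show ?thesis by (simp add: compactin_subtopology)
qed

lemma compactin_chart_inv:
  assumes \<kappa>: "\<kappa> \<in> atlas M" and K: "compact K" "K \<subseteq> img \<kappa>"
  shows "compactin (mspace M) (chart_inv \<kappa> ` K)" "chart_inv \<kappa> ` K \<subseteq> fst \<kappa>"
proof -
  show "chart_inv \<kappa> ` K \<subseteq> fst \<kappa>" using K(2) chart_inv_in by blast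
  obtain g where g: "homeomorphic_maps (subtopology (mspace M) (fst \<kappa>)) (top_of_set (img \<kappa>)) (snd \<kappa>) g"
    using chart_homeomorphic[OF \<kappa>] homeomorphic_map_maps by blast
  then have gc: "continuous_map (top_of_set (img \<kappa>)) (subtopology (mspace M) (fst \<kappa>)) g"
    and gi: "\<And>p. p \<in> fst \<kappa> \<Longrightarrow> g (snd \<kappa> p) = p"
    using topspace_domain[OF \<kappa>] by (simp_all add: homeomorphic_maps_def)
  have "compactin (top_of_set (img \<kappa>)) K" using K by (simp add: compactin_subtopology)
  from image_compactin[OF this gc] have "compactin (mspace M) (g ` K)" by (simp add: compactin_subtopology)
  moreover have "g ` K = chart_inv \<kappa> ` K"
  proof (rule image_cong[OF refl])
    fix x assume "x \<in> K"
    then obtain p where "p \<in> fst \<kappa>" "x = snd \<kappa> p" using K(2) by blast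
    then show "g x = chart_inv \<kappa> x" using gi chart_inv_snd[OF \<kappa>] by simp
  qed
  ultimately show "compactin (mspace M) (chart_inv \<kappa> ` K)" by simp
qed

lemma closedin_compactin: "compactin (mspace M) S \<Longrightarrow> closedin (mspace M) S"
  by (rule compactin_imp_closedin[OF manifold_facts(1)])

subsection \<open>Transition maps\<close>

lemma smooth_transition:
  "\<kappa> \<in> atlas M \<Longrightarrow> \<kappa>' \<in> atlas M \<Longrightarrow> smooth_on (transition \<kappa> \<kappa>') (overlap \<kappa> \<kappa>')"
  using manifold_facts(5) by blast

lemma transition_snd: "\<kappa> \<in> atlas M \<Longrightarrow> p \<in> fst \<kappa> \<Longrightarrow> transition \<kappa> \<kappa>' (snd \<kappa> p) = snd \<kappa>' p"
  by (simp add: transition_def chart_inv_snd)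

lemma transition_image:
  "\<kappa> \<in> atlas M \<Longrightarrow> U \<subseteq> fst \<kappa> \<Longrightarrow> transition \<kappa> \<kappa>' ` snd \<kappa> ` U = snd \<kappa>' ` U"
  unfolding image_image by (intro image_cong) (auto simp: transition_snd)

lemma jac_mult:
  assumes "\<kappa> \<in> atlas M" "\<kappa>' \<in> atlas M" "p \<in> fst \<kappa> \<inter> fst \<kappa>'"
  shows "transition_jac \<kappa> \<kappa>' p *v v = hderiv (transition \<kappa> \<kappa>') (snd \<kappa> p) v"
  unfolding transition_jac_def
  using assms by (intro hjacobian_mult[where W="overlap \<kappa> \<kappa>'"] smooth_transition hopen_overlap) auto

lemma gram_spd: "\<kappa> \<in> atlas M \<Longrightarrow> p \<in> fst \<kappa> \<Longrightarrow> spd (gram M \<kappa> p)"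
  using manifold_facts(6) by blast

lemma gram_transform:
  "\<kappa> \<in> atlas M \<Longrightarrow> \<kappa>' \<in> atlas M \<Longrightarrow> p \<in> fst \<kappa> \<inter> fst \<kappa>' \<Longrightarrow>
    gram M \<kappa> p = transpose (transition_jac \<kappa> \<kappa>' p) ** gram M \<kappa>' p ** transition_jac \<kappa> \<kappa>' p"
  using manifold_facts(7) by blast

lemma smooth_gram: "\<kappa> \<in> atlas M \<Longrightarrow> smooth_on (gram M \<kappa> \<circ> chart_inv \<kappa>) (img \<kappa>)"
  using manifold_facts(8) unfolding smooth_components_def by blast

lemma vol_density_pos: "\<kappa> \<in> atlas M \<Longrightarrow> p \<in> fst \<kappa> \<Longrightarrow> 0 < vol_density M \<kappa> p"
  using spd_det_pos[OF gram_spd] by (simp add: vol_density_def)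

lemma vol_density_transform:
  assumes "\<kappa> \<in> atlas M" "\<kappa>' \<in> atlas M" "p \<in> fst \<kappa> \<inter> fst \<kappa>'"
  shows "vol_density M \<kappa> p = \<bar>det (transition_jac \<kappa> \<kappa>' p)\<bar> * vol_density M \<kappa>' p"
  unfolding vol_density_def gram_transform[OF assms]
  by (simp add: det_mul real_sqrt_mult mult.commute mult.left_commute flip: power2_eq_square)

text \<open>
  The transformation law of the metric already forces invertibility, because the volume density is
  positive in both charts.
\<close>

lemma jac_invertible:
  assumes "\<kappa> \<in> atlas M" "\<kappa>' \<in> atlas M" "p \<in> fst \<kappa> \<inter> fst \<kappa>'"
  shows "invertible (transition_jac \<kappa> \<kappa>' p)"
  using vol_density_transform[OF assms] vol_density_pos[of \<kappa> p] assms by (auto simp: invertible_det_nz)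

lemma smooth_vol_density:
  assumes "\<kappa> \<in> atlas M" shows "smooth_on (vol_density M \<kappa> \<circ> chart_inv \<kappa>) (img \<kappa>)"
proof -
  have "smooth_on (\<lambda>x. sqrt (det ((gram M \<kappa> \<circ> chart_inv \<kappa>) x))) (img \<kappa>)"
    using spd_det_pos[OF gram_spd[OF assms chart_inv_in]]
    by (intro smooth_on_sqrt smooth_on_det smooth_on_vec_nth smooth_gram[OF assms]) auto
  then show ?thesis by (simp add: vol_density_def comp_def)
qed

lemma jac_cocycle:
  assumes \<kappa>: "\<kappa> \<in> atlas M" "\<kappa>' \<in> atlas M" "\<mu> \<in> atlas M" and p: "p \<in> fst \<kappa> \<inter> fst \<kappa>' \<inter> fst \<mu>"
  shows "transition_jac \<kappa> \<mu> p = transition_jac \<kappa>' \<mu> p ** transition_jac \<kappa> \<kappa>' p"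
proof -
  let ?U = "fst \<kappa> \<inter> fst \<kappa>' \<inter> fst \<mu>"
  have U: "openin (mspace M) ?U" using \<kappa> by (intro openin_Int openin_domain)
  have W: "hopen (snd \<kappa> ` ?U)" "hopen (snd \<kappa>' ` ?U)" using \<kappa> U by (auto intro: hopen_image)
  have "hderiv (transition \<kappa> \<mu>) (snd \<kappa> p) = hderiv (transition \<kappa>' \<mu> \<circ> transition \<kappa> \<kappa>') (snd \<kappa> p)"
    using p \<kappa> by (intro hderiv_cong[OF W(1)]) (auto simp: transition_snd)
  moreover have "hderiv (transition \<kappa>' \<mu> \<circ> transition \<kappa> \<kappa>') (snd \<kappa> p) v =
      hderiv (transition \<kappa>' \<mu>) (transition \<kappa> \<kappa>' (snd \<kappa> p)) (hderiv (transition \<kappa> \<kappa>') (snd \<kappa> p) v)" for v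
  proof (rule hderiv_compose[OF _ W(1) _ W(2)])
    show "smooth_on (transition \<kappa> \<kappa>') (snd \<kappa> ` ?U)"
      by (rule smooth_on_subset[OF smooth_transition]) (use \<kappa> in auto)
    show "smooth_on (transition \<kappa>' \<mu>) (snd \<kappa>' ` ?U)"
      by (rule smooth_on_subset[OF smooth_transition]) (use \<kappa> in auto)
    show "transition \<kappa> \<kappa>' ` snd \<kappa> ` ?U \<subseteq> snd \<kappa>' ` ?U" using \<kappa> by (subst transition_image) auto
  qed (use p in auto)
  ultimately have "transition_jac \<kappa> \<mu> p *v v = (transition_jac \<kappa>' \<mu> p ** transition_jac \<kappa> \<kappa>' p) *v v" for v
    using \<kappa> p by (simp add: jac_mult transition_snd flip: matrix_vector_mul_assoc)
  then show ?thesis by (simp add: matrix_eq)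
qed

lemma jac_self:
  assumes \<kappa>: "\<kappa> \<in> atlas M" "p \<in> fst \<kappa>" shows "transition_jac \<kappa> \<kappa> p = mat 1"
proof -
  have "transition_jac \<kappa> \<kappa> p ** transition_jac \<kappa> \<kappa> p = transition_jac \<kappa> \<kappa> p"
    using jac_cocycle[of \<kappa> \<kappa> \<kappa> p] assms by simp
  then show ?thesis
    using matrix_inv_mult[OF jac_invertible[of \<kappa> \<kappa> p]] assms
    by (metis Int_iff matrix_mul_assoc matrix_mul_rid)
qed

lemma smooth_jac:
  assumes "\<kappa> \<in> atlas M" "\<kappa>' \<in> atlas M"
  shows "smooth_on (transition_jac \<kappa> \<kappa>' \<circ> chart_inv \<kappa>) (overlap \<kappa> \<kappa>')"
proof -
  have "smooth_on (hjacobian (transition \<kappa> \<kappa>')) (overlap \<kappa> \<kappa>')"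
    by (intro smooth_on_hjacobian smooth_transition hopen_overlap assms)
  then show ?thesis
    by (rule smooth_on_transform) (use assms in \<open>auto simp: transition_jac_def chart_inv_snd\<close>)
qed

lemma smooth_transport:
  fixes f :: "'m \<Rightarrow> 'b::real_normed_vector"
  assumes \<kappa>: "\<kappa> \<in> atlas M" "\<kappa>' \<in> atlas M" and f: "smooth_on (f \<circ> chart_inv \<kappa>') (overlap \<kappa>' \<kappa>)"
  shows "smooth_on (f \<circ> chart_inv \<kappa>) (overlap \<kappa> \<kappa>')"
proof -
  have "smooth_on ((f \<circ> chart_inv \<kappa>') \<circ> transition \<kappa> \<kappa>') (overlap \<kappa> \<kappa>')"
    using f smooth_transition[OF \<kappa>] by (rule smooth_on_compose) (subst transition_image[OF \<kappa>(1)], auto)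
  then show ?thesis
    by (rule smooth_on_transform) (use \<kappa> in \<open>auto simp: transition_snd chart_inv_snd\<close>)
qed

subsection \<open>The boundary\<close>

text \<open>
  A transition map sending an interior point to the boundary would have a minimum of its first
  component there, so its Jacobian would have a zero row.
\<close>

lemma boundary_invariant:
  assumes \<kappa>: "\<kappa> \<in> atlas M" "\<kappa>' \<in> atlas M" and p: "p \<in> fst \<kappa> \<inter> fst \<kappa>'" and b: "snd \<kappa>' p $ bdir = 0"
  shows "snd \<kappa> p $ bdir = 0"
proof (rule ccontr)
  assume "snd \<kappa> p $ bdir \<noteq> 0"
  moreover have "snd \<kappa> p \<in> halfspace" using img_halfspace[OF \<kappa>(1)] p by blast
  ultimately have pos: "0 < snd \<kappa> p $ bdir" by (simp add: halfspace_def)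
  have zero: "(transition_jac \<kappa> \<kappa>' p *v u) $ bdir = 0" for u
    unfolding jac_mult[OF \<kappa> p]
  proof (rule hderiv_bdir_at_boundary[OF smooth_transition[OF \<kappa>] hopen_overlap[OF \<kappa>]])
    show "transition \<kappa> \<kappa>' ` overlap \<kappa> \<kappa>' \<subseteq> halfspace"
      using img_halfspace[OF \<kappa>(2)] by (subst transition_image[OF \<kappa>(1)]) auto
  qed (use p \<kappa> b pos in \<open>auto simp: transition_snd\<close>)
  have "(transition_jac \<kappa> \<kappa>' p *v (matrix_inv (transition_jac \<kappa> \<kappa>' p) *v axis bdir 1)) $ bdir = 1"
    by (simp add: matrix_inv_cancel[OF jac_invertible[OF \<kappa> p]])
  then show False using zero by simp
qed

text \<open>
  Along the boundary the first component of the transition map vanishes identically, hence so do its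
  tangential derivatives.
\<close>

lemma boundary_tangent:
  assumes \<kappa>: "\<kappa> \<in> atlas M" "\<kappa>' \<in> atlas M" and p: "p \<in> fst \<kappa> \<inter> fst \<kappa>'" and b: "snd \<kappa> p $ bdir = 0"
    and u: "u $ bdir = 0"
  shows "(transition_jac \<kappa> \<kappa>' p *v u) $ bdir = 0"
  unfolding jac_mult[OF \<kappa> p]
proof (rule hderiv_bdir_at_boundary[OF smooth_transition[OF \<kappa>] hopen_overlap[OF \<kappa>]])
  show "transition \<kappa> \<kappa>' ` overlap \<kappa> \<kappa>' \<subseteq> halfspace"
    using img_halfspace[OF \<kappa>(2)] by (subst transition_image[OF \<kappa>(1)]) auto
  show "transition \<kappa> \<kappa>' (snd \<kappa> p) $ bdir = 0"
    using boundary_invariant[OF \<kappa>(2,1) _ b] p \<kappa> by (simp add: transition_snd Int_commute)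
qed (use p u in auto)

lemma mboundary_coordinate:
  assumes "p \<in> mboundary M" "\<kappa> \<in> atlas M" "p \<in> fst \<kappa>" shows "snd \<kappa> p $ bdir = 0"
  using assms boundary_invariant unfolding mboundary_def by blast

lemma mboundary_topspace: "p \<in> mboundary M \<Longrightarrow> p \<in> topspace (mspace M)"
  using domain_subset unfolding mboundary_def by blast

lemma ginner_normal:
  assumes "p \<in> topspace (mspace M)"
  shows "ginner M w (outward_normal M) p = 0 \<longleftrightarrow> w (chart_at M p) p $ bdir = 0"
proof -
  obtain s where s: "0 < s" "gram M (chart_at M p) p *v outward_normal M (chart_at M p) p = - s *\<^sub>R axis bdir 1"
    unfolding outward_normal_def by (rule normal_unique[OF gram_spd[OF chart_at[OF assms]]])
  then show ?thesis by (simp add: ginner_def inner_axis)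
qed

subsection \<open>Scalar and vector fields\<close>

lemma C_infD: "f \<in> C_inf M \<Longrightarrow> \<kappa> \<in> atlas M \<Longrightarrow> smooth_on (f \<circ> chart_inv \<kappa>) (img \<kappa>)"
  by (simp add: C_inf_def smooth_components_def)

lemma C_infI: "(\<And>\<kappa>. \<kappa> \<in> atlas M \<Longrightarrow> smooth_on (f \<circ> chart_inv \<kappa>) (img \<kappa>)) \<Longrightarrow> f \<in> C_inf M"
  by (simp add: C_inf_def smooth_components_def)

lemma C_inf_cong: "(\<And>p. p \<in> topspace (mspace M) \<Longrightarrow> f p = g p) \<Longrightarrow> f \<in> C_inf M \<longleftrightarrow> g \<in> C_inf M"
  unfolding C_inf_def mem_Collect_eq using domain_subset by (intro smooth_components_cong) blast

lemma C_inf_const: "(\<lambda>p. a) \<in> C_inf M"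
  by (rule C_infI) (simp add: comp_def)

lemma C_inf_add: "f \<in> C_inf M \<Longrightarrow> g \<in> C_inf M \<Longrightarrow> (\<lambda>p. f p + g p) \<in> C_inf M"
  using smooth_on_add[OF C_infD C_infD] by (intro C_infI) (simp add: comp_def)

lemma C_inf_mult: "f \<in> C_inf M \<Longrightarrow> g \<in> C_inf M \<Longrightarrow> (\<lambda>p. f p * g p) \<in> C_inf M"
  using smooth_on_mult[OF C_infD C_infD] by (intro C_infI) (simp add: comp_def)

lemma C_inf_compose:
  fixes G :: "real \<Rightarrow> real"
  assumes "smooth_on G UNIV" "f \<in> C_inf M" shows "(\<lambda>p. G (f p)) \<in> C_inf M"
  using smooth_on_compose[OF assms(1) C_infD[OF assms(2)] subset_UNIV] by (intro C_infI) (simp add: comp_def)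

lemma vector_fieldD:
  assumes "w \<in> vector_fields M"
  shows "\<kappa> \<in> atlas M \<Longrightarrow> smooth_on (w \<kappa> \<circ> chart_inv \<kappa>) (img \<kappa>)"
    and "\<kappa> \<in> atlas M \<Longrightarrow> \<kappa>' \<in> atlas M \<Longrightarrow> p \<in> fst \<kappa> \<inter> fst \<kappa>' \<Longrightarrow> w \<kappa>' p = transition_jac \<kappa> \<kappa>' p *v w \<kappa> p"
  using assms unfolding vector_fields_def smooth_components_def mem_Collect_eq by blast+

lemma mdifferential_transform:
  assumes f: "f \<in> C_inf M" and \<kappa>: "\<kappa> \<in> atlas M" "\<kappa>' \<in> atlas M" and p: "p \<in> fst \<kappa> \<inter> fst \<kappa>'"
  shows "mdifferential f \<kappa> p = transpose (transition_jac \<kappa> \<kappa>' p) *v mdifferential f \<kappa>' p"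
proof -
  have "partial i (f \<circ> chart_inv \<kappa>) (snd \<kappa> p) =
      (\<Sum>j\<in>UNIV. transition_jac \<kappa> \<kappa>' p $ j $ i * partial j (f \<circ> chart_inv \<kappa>') (snd \<kappa>' p))" for i
  proof -
    have "partial i (f \<circ> chart_inv \<kappa>) (snd \<kappa> p) = partial i ((f \<circ> chart_inv \<kappa>') \<circ> transition \<kappa> \<kappa>') (snd \<kappa> p)"
      using p \<kappa> by (intro partial_cong[OF hopen_overlap[OF \<kappa>]]) (auto simp: transition_snd chart_inv_snd)
    also have "\<dots> = (\<Sum>j\<in>UNIV. hjacobian (transition \<kappa> \<kappa>') (snd \<kappa> p) $ j $ i *
        partial j (f \<circ> chart_inv \<kappa>') (transition \<kappa> \<kappa>' (snd \<kappa> p)))"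
    proof (rule partial_compose[OF smooth_transition[OF \<kappa>] hopen_overlap[OF \<kappa>] C_infD[OF f \<kappa>(2)] hopen_img[OF \<kappa>(2)]])
      show "transition \<kappa> \<kappa>' ` overlap \<kappa> \<kappa>' \<subseteq> img \<kappa>'" by (subst transition_image[OF \<kappa>(1)]) auto
    qed (use p in auto)
    finally show ?thesis using p \<kappa> by (simp add: transition_jac_def transition_snd)
  qed
  then show ?thesis by (simp add: mdifferential_def vec_eq_iff matrix_vector_mult_def transpose_def)
qed

lemma smooth_mdifferential:
  assumes "f \<in> C_inf M" "\<kappa> \<in> atlas M"
  shows "smooth_on (mdifferential f \<kappa> \<circ> chart_inv \<kappa>) (img \<kappa>)"
proof -
  have "smooth_on (\<lambda>x. \<chi> i. partial i (f \<circ> chart_inv \<kappa>) x) (img \<kappa>)"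
    by (intro smooth_on_vec_lambda smooth_on_partial C_infD hopen_img assms)
  then show ?thesis
    by (rule smooth_on_transform) (simp add: mdifferential_def snd_chart_inv)
qed

lemma mdifferential_pairing:
  assumes f: "f \<in> C_inf M" and w: "w \<in> vector_fields M"
    and \<kappa>: "\<kappa> \<in> atlas M" "\<kappa>' \<in> atlas M" and p: "p \<in> fst \<kappa> \<inter> fst \<kappa>'"
  shows "mdifferential f \<kappa> p \<bullet> w \<kappa> p = mdifferential f \<kappa>' p \<bullet> w \<kappa>' p"
  unfolding mdifferential_transform[OF f \<kappa> p] vector_fieldD(2)[OF w \<kappa> p] by (rule inner_transpose)

lemma grad_vector_field:
  assumes f: "f \<in> C_inf M" shows "grad M f \<in> vector_fields M"
  unfolding vector_fields_def smooth_components_def mem_Collect_eq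
proof (intro conjI ballI)
  fix \<kappa> assume \<kappa>: "\<kappa> \<in> atlas M"
  have "smooth_on (\<lambda>x. matrix_inv ((gram M \<kappa> \<circ> chart_inv \<kappa>) x) *v (mdifferential f \<kappa> \<circ> chart_inv \<kappa>) x) (img \<kappa>)"
    using spd_det_pos[OF gram_spd[OF \<kappa> chart_inv_in]]
    by (intro smooth_on_matrix_inv smooth_gram smooth_mdifferential \<kappa> f) auto
  then show "smooth_on (grad M f \<kappa> \<circ> chart_inv \<kappa>) (img \<kappa>)" by (simp add: grad_def comp_def)
  fix \<kappa>' p assume \<kappa>': "\<kappa>' \<in> atlas M" and p: "p \<in> fst \<kappa> \<inter> fst \<kappa>'"
  let ?J = "transition_jac \<kappa> \<kappa>' p"
  let ?u = "grad M f \<kappa> p"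
  have "gram M \<kappa> p *v ?u = mdifferential f \<kappa> p"
    using p \<kappa> by (simp add: grad_def matrix_inv_cancel spd_invertible gram_spd)
  then have "transpose ?J *v (gram M \<kappa>' p *v (?J *v ?u)) = transpose ?J *v mdifferential f \<kappa>' p"
    unfolding gram_transform[OF \<kappa> \<kappa>' p] mdifferential_transform[OF f \<kappa> \<kappa>' p]
    by (simp add: matrix_vector_mul_assoc matrix_mul_assoc)
  then have "gram M \<kappa>' p *v (?J *v ?u) = mdifferential f \<kappa>' p"
    using matrix_inv_cancel(2)[OF transpose_invertible[OF jac_invertible[OF \<kappa> \<kappa>' p]]] by metis
  then show "grad M f \<kappa>' p = ?J *v ?u"
    using matrix_inv_eqI[OF spd_invertible[OF gram_spd[OF \<kappa>']]] p by (simp add: grad_def)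
qed

lemma ginner_grad:
  assumes f: "f \<in> C_inf M" and w: "w \<in> vector_fields M" and \<kappa>: "\<kappa> \<in> atlas M" and p: "p \<in> fst \<kappa>"
  shows "ginner M (grad M f) w p = mdifferential f \<kappa> p \<bullet> w \<kappa> p"
proof -
  let ?k = "chart_at M p"
  have pt: "p \<in> topspace (mspace M)" using domain_subset[OF \<kappa>] p by blast
  have "ginner M (grad M f) w p = mdifferential f ?k p \<bullet> w ?k p"
  proof -
    note G = gram_spd[OF chart_at[OF pt]]
    have "grad M f ?k p \<bullet> (gram M ?k p *v w ?k p) = w ?k p \<bullet> (gram M ?k p *v grad M f ?k p)"
      by (rule spd_inner_commute[OF G])
    then show ?thesis
      by (simp add: ginner_def Let_def grad_def matrix_inv_cancel[OF spd_invertible[OF G]] inner_commute)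
  qed
  then show ?thesis using mdifferential_pairing[OF f w chart_at(1)[OF pt] \<kappa>] chart_at(2)[OF pt] p by simp
qed

end

section \<open>Functions supported in one chart\<close>

context riemannian begin

text \<open>
  A compact set is closed, so off it the function vanishes on an open set.
\<close>

lemma smooth_zero_extension:
  fixes T :: "'m \<Rightarrow> 'b::real_normed_vector"
  assumes \<kappa>: "\<kappa> \<in> atlas M" "\<kappa>' \<in> atlas M" and S: "compactin (mspace M) S" "S \<subseteq> fst \<kappa>"
    and T: "smooth_on (T \<circ> chart_inv \<kappa>') (overlap \<kappa>' \<kappa>)"
    and zero: "\<And>p. p \<in> fst \<kappa>' \<Longrightarrow> p \<notin> S \<Longrightarrow> T p = 0"
  shows "smooth_on (T \<circ> chart_inv \<kappa>') (img \<kappa>')"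
proof (rule smooth_on_local)
  fix x assume "x \<in> img \<kappa>'"
  then obtain p where p: "p \<in> fst \<kappa>'" "x = snd \<kappa>' p" by blast
  let ?V = "fst \<kappa>' - S"
  have V: "openin (mspace M) ?V"
    using openin_diff[OF openin_domain[OF \<kappa>(2)] closedin_compactin[OF S(1)]] .
  show "\<exists>U. open U \<and> x \<in> U \<and> smooth_on (T \<circ> chart_inv \<kappa>') (img \<kappa>' \<inter> U)"
  proof (cases "p \<in> S")
    case True
    obtain U where U: "open U" "overlap \<kappa>' \<kappa> = halfspace \<inter> U"
      using hopen_overlap[OF \<kappa>(2,1)] by (auto simp: openin_open)
    moreover have "x \<in> overlap \<kappa>' \<kappa>" using p True S(2) by blast
    moreover have "img \<kappa>' \<inter> U \<subseteq> overlap \<kappa>' \<kappa>" using U(2) img_halfspace[OF \<kappa>(2)] by blast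
    ultimately show ?thesis using smooth_on_subset[OF T] by blast
  next
    case False
    obtain U where U: "open U" "snd \<kappa>' ` ?V = halfspace \<inter> U"
      using hopen_image[OF \<kappa>(2) V] by (auto simp: openin_open)
    have "x \<in> U" using p False U(2) by blast
    moreover have "smooth_on (T \<circ> chart_inv \<kappa>') (img \<kappa>' \<inter> U)"
    proof (rule smooth_on_transform[OF smooth_on_const[of 0]])
      fix y assume "y \<in> img \<kappa>' \<inter> U"
      then have "y \<in> snd \<kappa>' ` ?V" using U(2) img_halfspace[OF \<kappa>(2)] by blast
      then show "0 = (T \<circ> chart_inv \<kappa>') y" using zero chart_inv_snd[OF \<kappa>(2)] by auto
    qed
    ultimately show ?thesis using U(1) by blast
  qed
qed

definition lift_fun :: "('m, 'n) chart \<Rightarrow> ('n vect \<Rightarrow> real) \<Rightarrow> 'm \<Rightarrow> real" where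
  "lift_fun \<kappa> g p = (if p \<in> fst \<kappa> then g (snd \<kappa> p) else 0)"

text \<open>
  The transformation law forces the components in the other charts.
\<close>

definition lift_field :: "('m, 'n) chart \<Rightarrow> ('n vect \<Rightarrow> 'n vect) \<Rightarrow> ('m, 'n) vfield" where
  "lift_field \<kappa> X \<kappa>' p = (if p \<in> fst \<kappa> then transition_jac \<kappa> \<kappa>' p *v X (snd \<kappa> p) else 0)"

lemma lift_fun_zero:
  assumes "\<kappa> \<in> atlas M" "\<And>x. x \<in> img \<kappa> \<Longrightarrow> x \<notin> K \<Longrightarrow> g x = 0" "p \<notin> chart_inv \<kappa> ` K"
  shows "lift_fun \<kappa> g p = 0"
  using assms by (auto simp: lift_fun_def) (metis chart_inv_snd image_eqI)

lemma lift_field_zero: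
  assumes "\<kappa> \<in> atlas M" "\<And>x. x \<in> img \<kappa> \<Longrightarrow> x \<notin> K \<Longrightarrow> X x = 0" "p \<notin> chart_inv \<kappa> ` K"
  shows "lift_field \<kappa> X \<kappa>' p = 0"
proof (cases "p \<in> fst \<kappa>")
  case True
  then have "snd \<kappa> p \<notin> K" using assms(1,3) chart_inv_snd by (metis image_eqI)
  then show ?thesis using assms(2)[of "snd \<kappa> p"] True by (simp add: lift_field_def)
qed (simp add: lift_field_def)

lemma lift_fun_C_inf:
  assumes \<kappa>: "\<kappa> \<in> atlas M" and g: "smooth_on g (img \<kappa>)"
    and K: "compact K" "K \<subseteq> img \<kappa>" "\<And>x. x \<in> img \<kappa> \<Longrightarrow> x \<notin> K \<Longrightarrow> g x = 0"
  shows "lift_fun \<kappa> g \<in> C_inf M"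
proof (rule C_infI)
  fix \<kappa>' assume \<kappa>': "\<kappa>' \<in> atlas M"
  show "smooth_on (lift_fun \<kappa> g \<circ> chart_inv \<kappa>') (img \<kappa>')"
  proof (rule smooth_zero_extension[OF \<kappa> \<kappa>' compactin_chart_inv[OF \<kappa> K(1,2)]])
    have "smooth_on (g \<circ> transition \<kappa>' \<kappa>) (overlap \<kappa>' \<kappa>)"
      using g smooth_transition[OF \<kappa>' \<kappa>] by (rule smooth_on_compose) (subst transition_image[OF \<kappa>'], auto)
    then show "smooth_on (lift_fun \<kappa> g \<circ> chart_inv \<kappa>') (overlap \<kappa>' \<kappa>)"
      by (rule smooth_on_transform) (use \<kappa>' in \<open>auto simp: lift_fun_def transition_snd chart_inv_snd\<close>)
    show "lift_fun \<kappa> g p = 0" if "p \<notin> chart_inv \<kappa> ` K" for p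
      using lift_fun_zero[OF \<kappa> K(3) that] .
  qed
qed

lemma lift_field_vector_field:
  assumes \<kappa>: "\<kappa> \<in> atlas M" and X: "smooth_on X (img \<kappa>)"
    and K: "compact K" "K \<subseteq> img \<kappa>" "\<And>x. x \<in> img \<kappa> \<Longrightarrow> x \<notin> K \<Longrightarrow> X x = 0"
  shows "lift_field \<kappa> X \<in> vector_fields M"
  unfolding vector_fields_def smooth_components_def mem_Collect_eq
proof (intro conjI ballI)
  fix \<kappa>' assume \<kappa>': "\<kappa>' \<in> atlas M"
  show "smooth_on (lift_field \<kappa> X \<kappa>' \<circ> chart_inv \<kappa>') (img \<kappa>')"
  proof (rule smooth_zero_extension[OF \<kappa> \<kappa>' compactin_chart_inv[OF \<kappa> K(1,2)]])
    have 1: "smooth_on (X \<circ> transition \<kappa>' \<kappa>) (overlap \<kappa>' \<kappa>)"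
      using X smooth_transition[OF \<kappa>' \<kappa>] by (rule smooth_on_compose) (subst transition_image[OF \<kappa>'], auto)
    have 2: "smooth_on (transition_jac \<kappa> \<kappa>' \<circ> chart_inv \<kappa>') (overlap \<kappa>' \<kappa>)"
      by (rule smooth_transport[OF \<kappa>' \<kappa> smooth_jac[OF \<kappa> \<kappa>']])
    have "smooth_on (\<lambda>x. (transition_jac \<kappa> \<kappa>' \<circ> chart_inv \<kappa>') x *v (X \<circ> transition \<kappa>' \<kappa>) x) (overlap \<kappa>' \<kappa>)"
      by (intro smooth_on_matrix_vector 1 2)
    then show "smooth_on (lift_field \<kappa> X \<kappa>' \<circ> chart_inv \<kappa>') (overlap \<kappa>' \<kappa>)"
      by (rule smooth_on_transform) (use \<kappa>' in \<open>auto simp: lift_field_def transition_snd chart_inv_snd\<close>)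
    show "lift_field \<kappa> X \<kappa>' p = 0" if "p \<notin> chart_inv \<kappa> ` K" for p
      by (rule lift_field_zero[OF \<kappa> K(3) that])
  qed
  fix \<mu> p assume \<mu>: "\<mu> \<in> atlas M" and p: "p \<in> fst \<kappa>' \<inter> fst \<mu>"
  show "lift_field \<kappa> X \<mu> p = transition_jac \<kappa>' \<mu> p *v lift_field \<kappa> X \<kappa>' p"
    using jac_cocycle[OF \<kappa> \<kappa>' \<mu>, of p] p by (simp add: lift_field_def matrix_vector_mul_assoc)
qed

lemma lift_field_chart: "\<kappa> \<in> atlas M \<Longrightarrow> p \<in> fst \<kappa> \<Longrightarrow> lift_field \<kappa> X \<kappa> p = X (snd \<kappa> p)"
  by (simp add: lift_field_def jac_self)

lemma cball_in_hopen:
  assumes "hopen W" "x \<in> W"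
  obtains r where "0 < r" "cball x r \<inter> halfspace \<subseteq> W"
proof -
  obtain U where U: "open U" "W = halfspace \<inter> U" using assms(1) by (auto simp: openin_open)
  then obtain r where "0 < r" "cball x r \<subseteq> U" using assms(2) open_contains_cball by blast
  then show thesis using U(2) that by blast
qed

lemma compact_cball_halfspace: "compact (cball x r \<inter> (halfspace :: ('n vect) set))"
  unfolding halfspace_def by (intro compact_Int_closed compact_cball closed_halfspace_component_ge_cart)

lemma bump_zero_off: "0 < r \<Longrightarrow> y \<in> halfspace \<Longrightarrow> y \<notin> cball x r \<inter> halfspace \<Longrightarrow> bump x r y = 0"
  by (rule bump_zero) auto

lemma lift_bump_C_inf:
  assumes "\<kappa> \<in> atlas M" "0 < r" "cball x r \<inter> halfspace \<subseteq> img \<kappa>"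
  shows "lift_fun \<kappa> (bump x r) \<in> C_inf M"
  using assms img_halfspace[OF assms(1)]
  by (intro lift_fun_C_inf[OF _ smooth_bump compact_cball_halfspace] bump_zero_off) auto

subsection \<open>Partitions of unity\<close>

lemma C_inf_sum: "(\<And>i. i \<in> A \<Longrightarrow> f i \<in> C_inf M) \<Longrightarrow> (\<lambda>p. \<Sum>i\<in>A. f i p) \<in> C_inf M"
  by (induction A rule: infinite_finite_induct) (auto intro: C_inf_const C_inf_add)

lemma C_inf_divide:
  assumes "f \<in> C_inf M" "g \<in> C_inf M" "\<And>p. p \<in> topspace (mspace M) \<Longrightarrow> 0 < g p"
  shows "(\<lambda>p. f p / g p) \<in> C_inf M"
proof (rule C_infI)
  fix \<kappa> assume \<kappa>: "\<kappa> \<in> atlas M"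
  have "smooth_on (\<lambda>x. (f \<circ> chart_inv \<kappa>) x / (g \<circ> chart_inv \<kappa>) x) (img \<kappa>)"
    using C_infD[OF assms(1) \<kappa>] C_infD[OF assms(2) \<kappa>]
  proof (rule smooth_on_divide)
    fix x assume "x \<in> img \<kappa>"
    then have "chart_inv \<kappa> x \<in> topspace (mspace M)" using chart_inv_in domain_subset[OF \<kappa>] by blast
    then show "0 < (g \<circ> chart_inv \<kappa>) x" using assms(3) by simp
  qed
  then show "smooth_on ((\<lambda>p. f p / g p) \<circ> chart_inv \<kappa>) (img \<kappa>)" by (simp add: comp_def)
qed

text \<open>
  Finitely many bumps are jointly positive; they are divided by their sum and grouped by the chart in
  which they live, since one function is wanted for each chart.
\<close>

lemma partition_of_unity_exists: "\<exists>K \<rho>. partition_of_unity M K \<rho>"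
proof -
  let ?X = "mspace M"
  have "\<exists>r. 0 < r \<and> cball (snd (chart_at M p) p) r \<inter> halfspace \<subseteq> img (chart_at M p)"
    if p: "p \<in> topspace ?X" for p
    using cball_in_hopen[OF hopen_img[OF chart_at(1)[OF p]], of "snd (chart_at M p) p"] chart_at(2)[OF p] by blast
  then obtain r where r: "\<And>p. p \<in> topspace ?X \<Longrightarrow> 0 < r p"
    "\<And>p. p \<in> topspace ?X \<Longrightarrow> cball (snd (chart_at M p) p) (r p) \<inter> halfspace \<subseteq> img (chart_at M p)"
    by metis
  define b where "b p = lift_fun (chart_at M p) (bump (snd (chart_at M p) p) (r p))" for p
  define S where "S p = chart_inv (chart_at M p) ` (cball (snd (chart_at M p) p) (r p) \<inter> halfspace)" for p
  define U where "U p = {q \<in> topspace (subtopology ?X (fst (chart_at M p))).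
      snd (chart_at M p) q \<in> img (chart_at M p) \<inter> ball (snd (chart_at M p) p) (r p)}" for p
  have b_C: "b p \<in> C_inf M" if "p \<in> topspace ?X" for p
    unfolding b_def using chart_at[OF that] r[OF that] by (intro lift_bump_C_inf) auto
  have b_nonneg: "0 \<le> b p q" for p q by (simp add: b_def lift_fun_def bump_nonneg)
  have S: "compactin ?X (S p)" "S p \<subseteq> fst (chart_at M p)" if "p \<in> topspace ?X" for p
    unfolding S_def by (intro compactin_chart_inv chart_at compact_cball_halfspace r that)+
  have b_zero: "b p q = 0" if "p \<in> topspace ?X" "q \<notin> S p" for p q
    using that(2) unfolding b_def S_def
    by (intro lift_fun_zero[OF chart_at(1)[OF that(1)]])
      (use r(1)[OF that(1)] img_halfspace[OF chart_at(1)[OF that(1)]] in \<open>auto intro!: bump_zero\<close>)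
  have U_open: "openin ?X (U p)" if p: "p \<in> topspace ?X" for p
  proof -
    have "openin (subtopology ?X (fst (chart_at M p))) (U p)"
      unfolding U_def
      by (rule openin_continuous_map_preimage[OF homeomorphic_imp_continuous_map[OF chart_homeomorphic]])
        (auto simp: chart_at[OF p])
    then show ?thesis using openin_domain[OF chart_at(1)[OF p]] by (simp add: openin_open_subtopology)
  qed
  have U_pos: "0 < b p q" if "p \<in> topspace ?X" "q \<in> U p" for p q
    using that r(1)[OF that(1)] by (auto simp: b_def U_def lift_fun_def bump_pos_iff)
  have "topspace ?X \<subseteq> \<Union> (U ` topspace ?X)"
  proof
    fix p assume p: "p \<in> topspace ?X"
    then have "p \<in> U p" using chart_at[OF p] r(1)[OF p] by (simp add: U_def)
    then show "p \<in> \<Union> (U ` topspace ?X)" using p by blast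
  qed
  moreover have "compactin ?X (topspace ?X)" using manifold_facts(2) by (simp add: compact_space_def)
  ultimately have "\<exists>\<F>. finite \<F> \<and> \<F> \<subseteq> U ` topspace ?X \<and> topspace ?X \<subseteq> \<Union> \<F>"
    using U_open by (intro compactinD) auto
  then obtain \<F> where \<F>: "finite \<F>" "\<F> \<subseteq> U ` topspace ?X" "topspace ?X \<subseteq> \<Union> \<F>"
    by blast
  then obtain A where A: "A \<subseteq> topspace ?X" "finite A" "topspace ?X \<subseteq> \<Union> (U ` A)"
    using finite_subset_image[OF \<F>(1,2)] by metis
  define \<sigma> where "\<sigma> q = (\<Sum>p\<in>A. b p q)" for q
  have \<sigma>_C: "\<sigma> \<in> C_inf M" unfolding \<sigma>_def[abs_def] using A(1) b_C by (intro C_inf_sum) auto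
  have \<sigma>_pos: "0 < \<sigma> q" if "q \<in> topspace ?X" for q
  proof -
    from A(3) that have "q \<in> \<Union> (U ` A)" by (rule subsetD)
    then obtain p where p: "p \<in> A" "q \<in> U p" by blast
    have "0 < b p q" using U_pos p A(1) by blast
    also have "\<dots> \<le> \<sigma> q" unfolding \<sigma>_def using p A(2) b_nonneg by (intro member_le_sum) auto
    finally show ?thesis .
  qed
  define \<rho> where "\<rho> \<kappa> q = (\<Sum>p | p \<in> A \<and> chart_at M p = \<kappa>. b p q) / \<sigma> q" for \<kappa> q
  have "partition_of_unity M (chart_at M ` A) \<rho>"
    unfolding partition_of_unity_def
  proof (intro conjI ballI)
    show "finite (chart_at M ` A)" using A(2) by simp
    show "chart_at M ` A \<subseteq> atlas M" using A(1) chart_at by blast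
    fix \<kappa> assume "\<kappa> \<in> chart_at M ` A"
    show "\<rho> \<kappa> \<in> C_inf M"
      unfolding \<rho>_def[abs_def] using A(1) b_C by (intro C_inf_divide C_inf_sum \<sigma>_C \<sigma>_pos) auto
    show "0 \<le> \<rho> \<kappa> q" if "q \<in> topspace ?X" for q
      unfolding \<rho>_def using \<sigma>_pos[OF that] b_nonneg by (intro divide_nonneg_pos sum_nonneg) auto
    let ?S = "\<Union> (S ` {p \<in> A. chart_at M p = \<kappa>})"
    have "compactin ?X ?S" using A S by (intro compactin_Union) auto
    moreover have "?S \<subseteq> fst \<kappa>" using S(2) A(1) by blast
    moreover have "\<rho> \<kappa> q = 0" if "q \<notin> ?S" for q
      unfolding \<rho>_def using that A(1) b_zero by (subst sum.neutral) auto
    ultimately show "\<exists>S. compactin ?X S \<and> S \<subseteq> fst \<kappa> \<and> (\<forall>p\<in>topspace ?X - S. \<rho> \<kappa> p = 0)" by blast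
  next
    fix q assume q: "q \<in> topspace ?X"
    have "(\<Sum>\<kappa>\<in>chart_at M ` A. \<rho> \<kappa> q) = (\<Sum>\<kappa>\<in>chart_at M ` A. \<Sum>p | p \<in> A \<and> chart_at M p = \<kappa>. b p q) / \<sigma> q"
      by (simp add: \<rho>_def sum_divide_distrib)
    also have "\<dots> = \<sigma> q / \<sigma> q" unfolding \<sigma>_def using sum.image_gen[OF A(2), of "\<lambda>p. b p q" "chart_at M"] by simp
    finally show "(\<Sum>\<kappa>\<in>chart_at M ` A. \<rho> \<kappa> q) = 1" using \<sigma>_pos[OF q] by simp
  qed
  then show ?thesis by blast
qed

subsection \<open>The integral as a positive functional on continuous functions\<close>

abbreviation weighted :: "('m, 'n) chart \<Rightarrow> ('m \<Rightarrow> real) \<Rightarrow> 'n vect \<Rightarrow> real" where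
  "weighted \<kappa> f \<equiv> (\<lambda>q. f q * vol_density M \<kappa> q) \<circ> chart_inv \<kappa>"

definition mcont :: "('m \<Rightarrow> real) \<Rightarrow> bool" where
  "mcont f \<longleftrightarrow> (\<forall>\<kappa>\<in>atlas M. continuous_on (img \<kappa>) (f \<circ> chart_inv \<kappa>))"

lemma C_inf_mcont: "f \<in> C_inf M \<Longrightarrow> mcont f"
  unfolding mcont_def using C_infD smooth_on_imp_continuous_on by blast

lemma mcont_add: "mcont f \<Longrightarrow> mcont g \<Longrightarrow> mcont (\<lambda>p. f p + g p)"
  unfolding mcont_def comp_def by (auto intro: continuous_on_add)

lemma mcont_mult: "mcont f \<Longrightarrow> mcont g \<Longrightarrow> mcont (\<lambda>p. f p * g p)"
  unfolding mcont_def comp_def by (auto intro: continuous_on_mult)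

lemma mcont_const: "mcont (\<lambda>p. a)"
  by (simp add: mcont_def comp_def)

definition pou where "pou = (SOME (K, \<rho>). partition_of_unity M K \<rho>)"

lemma pou: "partition_of_unity M (fst pou) (snd pou)"
proof -
  have "\<exists>x. case x of (K, \<rho>) \<Rightarrow> partition_of_unity M K \<rho>" using partition_of_unity_exists by simp
  from someI_ex[OF this] have "case pou of (K, \<rho>) \<Rightarrow> partition_of_unity M K \<rho>" unfolding pou_def .
  then show ?thesis by (cases pou) simp
qed

lemma mint_pou: "mint M f = (\<Sum>\<kappa>\<in>fst pou. LINT x:img \<kappa>|lborel.
    weighted \<kappa> (\<lambda>q. snd pou \<kappa> q * f q) x)"
  by (simp add: mint_def pou_def case_prod_beta Let_def)

lemma pou_facts:
  shows "finite (fst pou)" "\<kappa> \<in> fst pou \<Longrightarrow> \<kappa> \<in> atlas M" "\<kappa> \<in> fst pou \<Longrightarrow> snd pou \<kappa> \<in> C_inf M"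
    "\<kappa> \<in> fst pou \<Longrightarrow> p \<in> topspace (mspace M) \<Longrightarrow> 0 \<le> snd pou \<kappa> p"
    "p \<in> topspace (mspace M) \<Longrightarrow> (\<Sum>\<kappa>\<in>fst pou. snd pou \<kappa> p) = 1"
    "\<kappa> \<in> fst pou \<Longrightarrow> \<exists>S. compactin (mspace M) S \<and> S \<subseteq> fst \<kappa> \<and> (\<forall>p\<in>topspace (mspace M) - S. snd pou \<kappa> p = 0)"
  using pou unfolding partition_of_unity_def by blast+

lemma mcont_vol:
  assumes "mcont f" "\<kappa> \<in> atlas M"
  shows "continuous_on (img \<kappa>) (weighted \<kappa> f)"
proof -
  have "continuous_on (img \<kappa>) (\<lambda>x. (f \<circ> chart_inv \<kappa>) x * (vol_density M \<kappa> \<circ> chart_inv \<kappa>) x)"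
    using assms smooth_on_imp_continuous_on[OF smooth_vol_density[OF assms(2)]]
    by (intro continuous_on_mult) (auto simp: mcont_def)
  then show ?thesis by (simp add: comp_def)
qed

lemma chart_integral:
  assumes \<kappa>: "\<kappa> \<in> atlas M" and f: "mcont f"
    and S: "compactin (mspace M) S" "S \<subseteq> fst \<kappa>" "\<And>p. p \<in> fst \<kappa> \<Longrightarrow> p \<notin> S \<Longrightarrow> f p = 0"
  shows "set_integrable lborel (img \<kappa>) (weighted \<kappa> f)"
    and "(LINT x:img \<kappa>|lborel. weighted \<kappa> f x) =
      (LINT x:snd \<kappa> ` S|lborel. weighted \<kappa> f x)"
proof -
  have C: "compact (snd \<kappa> ` S)" "snd \<kappa> ` S \<subseteq> img \<kappa>" using compact_image[OF \<kappa> S(1,2)] S(2) by auto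
  have c: "continuous_on (snd \<kappa> ` S) (weighted \<kappa> f)"
    using mcont_vol[OF f \<kappa>] C(2) by (rule continuous_on_subset)
  have z: "weighted \<kappa> f x = 0" if "x \<in> img \<kappa>" "x \<notin> snd \<kappa> ` S" for x
  proof -
    have "chart_inv \<kappa> x \<notin> S" using that snd_chart_inv by (metis image_eqI)
    then show ?thesis using S(3)[OF chart_inv_in[OF that(1)]] by simp
  qed
  show "set_integrable lborel (img \<kappa>) (weighted \<kappa> f)"
    by (rule set_integral_compact_support(1)[OF C c]) (rule z)
  show "(LINT x:img \<kappa>|lborel. weighted \<kappa> f x) =
      (LINT x:snd \<kappa> ` S|lborel. weighted \<kappa> f x)"
    by (rule set_integral_compact_support(2)[OF C c]) (rule z)
qed

lemma pou_integrable:
  assumes "\<kappa> \<in> fst pou" "mcont f"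
  shows "set_integrable lborel (img \<kappa>) (weighted \<kappa> (\<lambda>q. snd pou \<kappa> q * f q))"
proof -
  obtain S where "compactin (mspace M) S" "S \<subseteq> fst \<kappa>" "\<forall>p\<in>topspace (mspace M) - S. snd pou \<kappa> p = 0"
    using pou_facts(6)[OF assms(1)] by blast
  then show ?thesis
    using chart_integral(1)[OF pou_facts(2)[OF assms(1)] mcont_mult[OF C_inf_mcont[OF pou_facts(3)[OF assms(1)]] assms(2)], of S]
      domain_subset[OF pou_facts(2)[OF assms(1)]] by force
qed

lemma set_integral_eqI:
  fixes f g :: "'a::euclidean_space \<Rightarrow> real"
  assumes "\<And>x. x \<in> A \<Longrightarrow> f x = g x"
  shows "(LINT x:A|lborel. f x) = (LINT x:A|lborel. g x)"
  unfolding set_lebesgue_integral_def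
  by (rule Bochner_Integration.integral_cong) (use assms in \<open>auto simp: indicator_def\<close>)

lemma mint_cong:
  assumes "\<And>p. p \<in> topspace (mspace M) \<Longrightarrow> f p = g p" shows "mint M f = mint M g"
  unfolding mint_pou
proof (intro sum.cong refl set_integral_eqI)
  fix \<kappa> x assume "\<kappa> \<in> fst pou" "x \<in> img \<kappa>"
  then have "chart_inv \<kappa> x \<in> topspace (mspace M)"
    using chart_inv_in domain_subset[OF pou_facts(2)] by blast
  then show "weighted \<kappa> (\<lambda>q. snd pou \<kappa> q * f q) x =
      weighted \<kappa> (\<lambda>q. snd pou \<kappa> q * g q) x"
    using assms by simp
qed

lemma mint_add:
  assumes "mcont f" "mcont g" shows "mint M (\<lambda>p. f p + g p) = mint M f + mint M g"
  unfolding mint_pou sum.distrib[symmetric]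
proof (intro sum.cong refl)
  fix \<kappa> assume \<kappa>: "\<kappa> \<in> fst pou"
  show "(LINT x:img \<kappa>|lborel. weighted \<kappa> (\<lambda>q. snd pou \<kappa> q * (f q + g q)) x) =
      (LINT x:img \<kappa>|lborel. weighted \<kappa> (\<lambda>q. snd pou \<kappa> q * f q) x) +
      (LINT x:img \<kappa>|lborel. weighted \<kappa> (\<lambda>q. snd pou \<kappa> q * g q) x)"
    unfolding set_integral_add(2)[OF pou_integrable[OF \<kappa> assms(1)] pou_integrable[OF \<kappa> assms(2)], symmetric]
    by (intro set_integral_eqI) (simp add: algebra_simps)
qed

lemma mint_cmult: "mint M (\<lambda>p. a * f p) = a * mint M f"
  unfolding mint_pou sum_distrib_left set_integral_mult_right[symmetric]
  by (intro sum.cong refl set_integral_eqI) (simp add: mult_ac)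

lemma mint_zero:
  assumes "\<And>p. p \<in> topspace (mspace M) \<Longrightarrow> f p = 0" shows "mint M f = 0"
proof -
  have "mint M f = mint M (\<lambda>p. 0 * f p)" by (rule mint_cong) (simp add: assms)
  also have "\<dots> = 0 * mint M f" by (rule mint_cmult)
  finally show ?thesis by simp
qed

lemma mint_mono:
  assumes "mcont f" "mcont g" "\<And>p. p \<in> topspace (mspace M) \<Longrightarrow> f p \<le> g p"
  shows "mint M f \<le> mint M g"
  unfolding mint_pou
proof (intro sum_mono set_integral_mono pou_integrable assms(1,2))
  fix \<kappa> x assume \<kappa>: "\<kappa> \<in> fst pou" and x: "x \<in> img \<kappa>"
  have "chart_inv \<kappa> x \<in> topspace (mspace M)"
    using chart_inv_in[OF x] domain_subset[OF pou_facts(2)[OF \<kappa>]] by blast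
  then show "weighted \<kappa> (\<lambda>q. snd pou \<kappa> q * f q) x \<le>
      weighted \<kappa> (\<lambda>q. snd pou \<kappa> q * g q) x"
    using assms(3) pou_facts(4)[OF \<kappa>] vol_density_pos[OF pou_facts(2)[OF \<kappa>] chart_inv_in[OF x]]
    unfolding comp_apply by (intro mult_right_mono mult_left_mono) (auto intro: less_imp_le)
qed auto

lemma mint_abs_bound:
  assumes "mcont f" "\<And>p. p \<in> topspace (mspace M) \<Longrightarrow> \<bar>f p\<bar> \<le> a"
  shows "\<bar>mint M f\<bar> \<le> a * mint M (\<lambda>p. 1)"
proof -
  have "mint M f \<le> mint M (\<lambda>p. a * 1)" "mint M (\<lambda>p. - a * 1) \<le> mint M f"
    using assms by (intro mint_mono mcont_const; force)+
  then show ?thesis unfolding mint_cmult by linarith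
qed

lemma mcont_bounded:
  assumes "mcont f" obtains a where "0 \<le> a" "\<And>p. p \<in> topspace (mspace M) \<Longrightarrow> \<bar>f p\<bar> \<le> a"
proof -
  obtain S where S: "\<And>\<kappa>. \<kappa> \<in> fst pou \<Longrightarrow> compactin (mspace M) (S \<kappa>)" "\<And>\<kappa>. \<kappa> \<in> fst pou \<Longrightarrow> S \<kappa> \<subseteq> fst \<kappa>"
    "\<And>\<kappa> p. \<kappa> \<in> fst pou \<Longrightarrow> p \<in> topspace (mspace M) - S \<kappa> \<Longrightarrow> snd pou \<kappa> p = 0"
    using pou_facts(6) by metis
  have "bounded (\<Union>\<kappa>\<in>fst pou. (f \<circ> chart_inv \<kappa>) ` snd \<kappa> ` S \<kappa>)"
  proof (intro bounded_UN pou_facts(1) ballI compact_imp_bounded compact_continuous_image)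
    fix \<kappa> assume \<kappa>: "\<kappa> \<in> fst pou"
    show "compact (snd \<kappa> ` S \<kappa>)" by (rule compact_image[OF pou_facts(2) S(1,2)]) (rule \<kappa>)+
    have "continuous_on (img \<kappa>) (f \<circ> chart_inv \<kappa>)" using assms pou_facts(2)[OF \<kappa>] by (simp add: mcont_def)
    then show "continuous_on (snd \<kappa> ` S \<kappa>) (f \<circ> chart_inv \<kappa>)"
      by (rule continuous_on_subset) (use S(2)[OF \<kappa>] in auto)
  qed
  then obtain a where a: "\<forall>y\<in>(\<Union>\<kappa>\<in>fst pou. (f \<circ> chart_inv \<kappa>) ` snd \<kappa> ` S \<kappa>). \<bar>y\<bar> \<le> a"
    unfolding bounded_real by blast
  have "\<bar>f p\<bar> \<le> max a 0" if p: "p \<in> topspace (mspace M)" for p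
  proof -
    have "\<exists>\<kappa>\<in>fst pou. snd pou \<kappa> p \<noteq> 0"
    proof (rule ccontr)
      assume "\<not> (\<exists>\<kappa>\<in>fst pou. snd pou \<kappa> p \<noteq> 0)"
      then have "(\<Sum>\<kappa>\<in>fst pou. snd pou \<kappa> p) = 0" by (intro sum.neutral) auto
      then show False using pou_facts(5)[OF p] by simp
    qed
    then obtain \<kappa> where \<kappa>: "\<kappa> \<in> fst pou" "snd pou \<kappa> p \<noteq> 0" by blast
    have pS: "p \<in> S \<kappa>" using S(3)[OF \<kappa>(1), of p] \<kappa>(2) p by blast
    then have "p \<in> fst \<kappa>" using S(2)[OF \<kappa>(1)] by blast
    then have "f p = (f \<circ> chart_inv \<kappa>) (snd \<kappa> p)" by (simp add: chart_inv_snd[OF pou_facts(2)[OF \<kappa>(1)]])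
    then have "f p \<in> (\<Union>\<kappa>\<in>fst pou. (f \<circ> chart_inv \<kappa>) ` snd \<kappa> ` S \<kappa>)"
      using pS by (intro UN_I[OF \<kappa>(1)] image_eqI[OF _ imageI[OF pS]])
    from bspec[OF a this] show ?thesis by simp
  qed
  then show thesis using that[of "max a 0"] by simp
qed

end

text \<open>
  Restricting to a compact set makes both integrands integrable for continuity reasons alone.
\<close>

lemma compact_change_of_variables:
  fixes g :: "'n::{finite,wellorder} vect \<Rightarrow> 'n vect" and f h :: "'n vect \<Rightarrow> real"
  assumes S: "compact S" and g: "\<And>x. x \<in> S \<Longrightarrow> (g has_derivative g' x) (at x within S)" "inj_on g S"
    and gS: "compact (g ` S)" and f: "continuous_on (g ` S) f"
    and h: "continuous_on S h" "\<And>x. x \<in> S \<Longrightarrow> h x = \<bar>det (matrix (g' x))\<bar> * f (g x)"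
  shows "(LINT x:S|lborel. h x) = (LINT y:g ` S|lborel. f y)"
proof -
  have int_f: "set_integrable lborel (g ` S) f" and int_h: "set_integrable lborel S h"
    using borel_integrable_compact[OF gS f] borel_integrable_compact[OF S h(1)] by (simp_all add: set_integrable_def)
  have "f absolutely_integrable_on (g ` S)"
    using int_f unfolding set_integrable_def by (metis borel_measurable_integrable integrable_completion)
  then have "(\<lambda>y. vec (f y) :: real ^ 1) absolutely_integrable_on (g ` S) \<and>
      integral (g ` S) (\<lambda>y. vec (f y) :: real ^ 1) = vec (integral (g ` S) f)"
    by (simp add: absolutely_integrable_on_1_iff integral_on_1_eq)
  then have "integral S (\<lambda>x. \<bar>det (matrix (g' x))\<bar> *\<^sub>R (vec (f (g x)) :: real ^ 1)) = vec (integral (g ` S) f)"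
    using has_absolute_integral_change_of_variables[OF _ g, of "\<lambda>y. vec (f y)" "vec (integral (g ` S) f)"]
      S lmeasurable_compact[OF S] by blast
  then have "integral S (\<lambda>x. \<bar>det (matrix (g' x))\<bar> * f (g x)) = integral (g ` S) f"
    by (simp add: integral_on_1_eq vec_eq_iff)
  moreover have "integral S h = integral S (\<lambda>x. \<bar>det (matrix (g' x))\<bar> * f (g x))"
    by (intro integral_cong h(2))
  ultimately show ?thesis
    using set_borel_integral_eq_integral(2)[OF int_f] set_borel_integral_eq_integral(2)[OF int_h] by simp
qed

context riemannian begin

lemma chart_change:
  assumes \<kappa>: "\<kappa> \<in> atlas M" "\<kappa>' \<in> atlas M" and f: "mcont f"
    and S: "compactin (mspace M) S" "S \<subseteq> fst \<kappa>" "S \<subseteq> fst \<kappa>'"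
    and zero: "\<And>p. p \<in> topspace (mspace M) \<Longrightarrow> p \<notin> S \<Longrightarrow> f p = 0"
  shows "(LINT x:img \<kappa>|lborel. weighted \<kappa> f x) =
    (LINT x:img \<kappa>'|lborel. weighted \<kappa>' f x)"
proof -
  let ?F = "\<lambda>\<kappa>. weighted \<kappa> f"
  have z: "f p = 0" if "\<mu> \<in> atlas M" "p \<in> fst \<mu>" "p \<notin> S" for p \<mu>
    using zero that domain_subset by blast
  have im: "transition \<kappa> \<kappa>' ` snd \<kappa> ` S = snd \<kappa>' ` S" by (rule transition_image[OF \<kappa>(1) S(2)])
  have "(LINT x:snd \<kappa> ` S|lborel. ?F \<kappa> x) = (LINT y:transition \<kappa> \<kappa>' ` snd \<kappa> ` S|lborel. ?F \<kappa>' y)"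
  proof (rule compact_change_of_variables[where g'="\<lambda>x. hderiv (transition \<kappa> \<kappa>') x"])
    show "compact (snd \<kappa> ` S)" by (rule compact_image[OF \<kappa>(1) S(1,2)])
    show "compact (transition \<kappa> \<kappa>' ` snd \<kappa> ` S)" unfolding im by (rule compact_image[OF \<kappa>(2) S(1,3)])
    show "continuous_on (snd \<kappa> ` S) (?F \<kappa>)"
      by (rule continuous_on_subset[OF mcont_vol[OF f \<kappa>(1)]]) (use S in auto)
    show "continuous_on (transition \<kappa> \<kappa>' ` snd \<kappa> ` S) (?F \<kappa>')"
      unfolding im by (rule continuous_on_subset[OF mcont_vol[OF f \<kappa>(2)]]) (use S in auto)
    show "inj_on (transition \<kappa> \<kappa>') (snd \<kappa> ` S)"
    proof (rule inj_onI)
      fix x y assume "x \<in> snd \<kappa> ` S" "y \<in> snd \<kappa> ` S" and eq: "transition \<kappa> \<kappa>' x = transition \<kappa> \<kappa>' y"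
      then obtain p q where pq: "p \<in> S" "q \<in> S" "x = snd \<kappa> p" "y = snd \<kappa> q" by blast
      then have "snd \<kappa>' p = snd \<kappa>' q" using eq S(2) transition_snd[OF \<kappa>(1)] by (metis subsetD)
      then have "p = q" using inj_onD[OF chart_inj[OF \<kappa>(2)]] pq S(3) by blast
      then show "x = y" using pq by simp
    qed
    fix x assume "x \<in> snd \<kappa> ` S"
    then obtain p where p: "p \<in> S" "x = snd \<kappa> p" by blast
    have "(transition \<kappa> \<kappa>' has_derivative hderiv (transition \<kappa> \<kappa>') x) (at x within halfspace)"
      using p S by (intro smooth_has_hderiv[OF smooth_transition[OF \<kappa>] hopen_overlap[OF \<kappa>]]) auto
    then show "(transition \<kappa> \<kappa>' has_derivative hderiv (transition \<kappa> \<kappa>') x) (at x within snd \<kappa> ` S)"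
      by (rule has_derivative_subset) (use S(2) img_halfspace[OF \<kappa>(1)] in auto)
    have "p \<in> fst \<kappa>" "p \<in> fst \<kappa>'" using p S by auto
    then show "?F \<kappa> x = \<bar>det (matrix (hderiv (transition \<kappa> \<kappa>') x))\<bar> * ?F \<kappa>' (transition \<kappa> \<kappa>' x)"
      using vol_density_transform[OF \<kappa>, of p] \<kappa>
      by (simp add: p(2) chart_inv_snd transition_snd transition_jac_def jacobian_def)
  qed
  moreover have "(LINT x:img \<kappa>|lborel. ?F \<kappa> x) = (LINT x:snd \<kappa> ` S|lborel. ?F \<kappa> x)"
    by (rule chart_integral(2)[OF \<kappa>(1) f S(1,2)]) (rule z[OF \<kappa>(1)])
  moreover have "(LINT x:img \<kappa>'|lborel. ?F \<kappa>' x) = (LINT x:snd \<kappa>' ` S|lborel. ?F \<kappa>' x)"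
    by (rule chart_integral(2)[OF \<kappa>(2) f S(1,3)]) (rule z[OF \<kappa>(2)])
  ultimately show ?thesis unfolding im by (simp only:)
qed

text \<open>
  After a change of variables to the chart \<open>\<kappa>\<close> the functions of the partition of unity add up to 1,
  so the choice of the partition becomes invisible.
\<close>

lemma mint_chart:
  assumes \<kappa>: "\<kappa> \<in> atlas M" and f: "mcont f" and S: "compactin (mspace M) S" "S \<subseteq> fst \<kappa>"
    and zero: "\<And>p. p \<in> topspace (mspace M) \<Longrightarrow> p \<notin> S \<Longrightarrow> f p = 0"
  shows "mint M f = (LINT x:img \<kappa>|lborel. weighted \<kappa> f x)"
proof -
  let ?F = "\<lambda>\<mu>. weighted \<kappa> (\<lambda>q. snd pou \<mu> q * f q)"
  have cont: "mcont (\<lambda>q. snd pou \<mu> q * f q)" if "\<mu> \<in> fst pou" for \<mu>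
    by (intro mcont_mult C_inf_mcont pou_facts f that)
  have "(LINT x:img \<mu>|lborel. weighted \<mu> (\<lambda>q. snd pou \<mu> q * f q) x) =
      (LINT x:img \<kappa>|lborel. ?F \<mu> x)" if \<mu>: "\<mu> \<in> fst pou" for \<mu>
  proof -
    obtain T where T: "compactin (mspace M) T" "T \<subseteq> fst \<mu>" "\<forall>p\<in>topspace (mspace M) - T. snd pou \<mu> p = 0"
      using pou_facts(6)[OF \<mu>] by blast
    have "compactin (mspace M) (S \<inter> T)"
      using closed_Int_compactin[OF closedin_compactin[OF S(1)] T(1)] .
    then show ?thesis
      by (rule chart_change[OF pou_facts(2)[OF \<mu>] \<kappa> cont[OF \<mu>]]) (use S T zero in auto)
  qed
  then have "mint M f = (\<Sum>\<mu>\<in>fst pou. LINT x:img \<kappa>|lborel. ?F \<mu> x)"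
    unfolding mint_pou by (intro sum.cong refl)
  also have "\<dots> = (LINT x:img \<kappa>|lborel. \<Sum>\<mu>\<in>fst pou. ?F \<mu> x)"
  proof -
    have "set_integrable lborel (img \<kappa>) (?F \<mu>)" if "\<mu> \<in> fst pou" for \<mu>
      by (rule chart_integral(1)[OF \<kappa> cont[OF that] S]) (use zero domain_subset[OF \<kappa>] in auto)
    then show ?thesis
      unfolding set_lebesgue_integral_def set_integrable_def scaleR_sum_right
      by (subst Bochner_Integration.integral_sum) auto
  qed
  also have "\<dots> = (LINT x:img \<kappa>|lborel. weighted \<kappa> f x)"
  proof (rule set_integral_eqI)
    fix x assume "x \<in> img \<kappa>"
    then have p: "chart_inv \<kappa> x \<in> topspace (mspace M)" using chart_inv_in domain_subset[OF \<kappa>] by blast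
    have "(\<Sum>\<mu>\<in>fst pou. ?F \<mu> x) = (\<Sum>\<mu>\<in>fst pou. snd pou \<mu> (chart_inv \<kappa> x)) *
        weighted \<kappa> f x"
      by (simp add: sum_distrib_right mult.assoc)
    then show "(\<Sum>\<mu>\<in>fst pou. ?F \<mu> x) = weighted \<kappa> f x"
      using pou_facts(5)[OF p] by simp
  qed
  finally show ?thesis .
qed

end

section \<open>The divergence\<close>

text \<open>
  At the boundary, which the test functions do not reach, the claim follows by continuity.
\<close>

lemma fundamental_lemma:
  fixes h :: "'n::{finite,wellorder} vect \<Rightarrow> real"
  assumes W: "hopen W" and h: "continuous_on W h"
    and test: "\<And>x r. 0 < r \<Longrightarrow> cball x r \<subseteq> W \<Longrightarrow> (\<And>y. y \<in> cball x r \<Longrightarrow> 0 < y $ bdir) \<Longrightarrow>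
      (LINT y:cball x r|lborel. bump x r y * h y) = 0"
    and x: "x \<in> W"
  shows "h x = 0"
proof -
  have interior: "h z = 0" if z: "z \<in> W" "0 < z $ bdir" for z
  proof (rule ccontr)
    assume nz: "h z \<noteq> 0"
    obtain U where U: "open U" "W = halfspace \<inter> U" using W by (auto simp: openin_open)
    let ?V = "U \<inter> {y. 0 < y $ bdir}"
    have V: "open ?V" "?V \<subseteq> W" "z \<in> ?V"
      using U z by (auto simp: halfspace_def intro!: open_Int open_halfspace_component_gt_cart)
    obtain e where e: "0 < e" "\<And>y. y \<in> W \<Longrightarrow> dist y z < e \<Longrightarrow> dist (h y) (h z) < \<bar>h z\<bar> / 2"
      using h z(1) nz unfolding continuous_on_iff by (metis half_gt_zero zero_less_abs_iff)
    obtain d where d: "0 < d" "cball z d \<subseteq> ?V" using V(1,3) open_contains_cball by blast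
    define r where "r = min d (e / 2)"
    have r: "0 < r" "cball z r \<subseteq> ?V" "r < e" using e(1) d by (auto simp: r_def)
    have inW: "cball z r \<subseteq> W" using r(2) V(2) by blast
    \<comment> \<open>The sign makes the integrand nonnegative, and positive at the centre.\<close>
    let ?g = "\<lambda>y. sgn (h z) * (bump z r y * h y)"
    have sg: "0 < sgn (h z) * h y" if "y \<in> cball z r" for y
    proof -
      have "dist (h y) (h z) < \<bar>h z\<bar> / 2"
        using that r(3) inW by (intro e(2)) (auto simp: dist_commute subset_iff)
      then show ?thesis using nz by (auto simp: dist_real_def sgn_real_def abs_if split: if_splits)
    qed
    have cont: "continuous_on (cball z r) ?g"
      using r(2) V(2) by (intro continuous_intros smooth_on_imp_continuous_on[OF smooth_bump] continuous_on_subset[OF h]) auto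
    have gz: "0 < ?g z"
    proof -
      have "0 < bump z r z" using r(1) by (simp add: bump_pos_iff)
      moreover have "0 < sgn (h z) * h z" using sg r(1) by simp
      ultimately show ?thesis using mult_pos_pos mult.left_commute by metis
    qed
    then obtain d' where d': "0 < d'" "\<And>y. y \<in> cball z r \<Longrightarrow> dist y z < d' \<Longrightarrow> dist (?g y) (?g z) < ?g z / 2"
      using cont r(1) unfolding continuous_on_iff by (metis centre_in_cball half_gt_zero less_imp_le)
    have "0 < min r d'" using r(1) d'(1) by simp
    then obtain s where s: "0 < s" "\<And>y. (\<And>i. \<bar>y $ i - z $ i\<bar> \<le> s) \<Longrightarrow> dist z y < min r d'"
      by (rule box_in_ball) blast
    let ?a = "(\<chi> i. z $ i - s) :: 'n vect" and ?b = "(\<chi> i. z $ i + s) :: 'n vect"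
    have box: "dist z y < min r d'" if "y \<in> cbox ?a ?b" for y
      using that by (intro s(2)) (auto simp: mem_box_cart abs_le_iff algebra_simps)
    have le: "?g z / 2 * (\<Prod>i\<in>UNIV. ?b $ i - ?a $ i) \<le> (LINT y:cball z r|lborel. ?g y)"
    proof (rule set_integral_pos)
      show "set_integrable lborel (cball z r) ?g"
        using borel_integrable_compact[OF compact_cball cont] by (simp add: set_integrable_def)
      show "0 \<le> ?g y" if "y \<in> cball z r" for y
        using mult_nonneg_nonneg[OF bump_nonneg[of z r y] less_imp_le[OF sg[OF that]]]
        by (simp only: mult.left_commute)
      show "cbox ?a ?b \<subseteq> cball z r" using box by fastforce
      show "?a $ i < ?b $ i" for i using s(1) by simp
      show "0 \<le> ?g z / 2" using gz by simp
      show "?g z / 2 \<le> ?g y" if "y \<in> cbox ?a ?b" for y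
      proof -
        have half: "b / 2 \<le> a" if "dist a b < b / 2" for a b :: real
          using that unfolding dist_real_def by linarith
        show ?thesis using box[OF that] by (intro half d'(2)) (auto simp: dist_commute)
      qed
    qed
    have zero: "(LINT y:cball z r|lborel. ?g y) = sgn (h z) * 0"
    proof -
      have "(LINT y:cball z r|lborel. bump z r y * h y) = 0" by (rule test[OF r(1) inW]) (use r(2) in auto)
      then show ?thesis by (simp only: set_integral_mult_right)
    qed
    have "0 < (\<Prod>i\<in>UNIV. ?b $ i - ?a $ i)" using s(1) by (intro prod_pos) simp
    from mult_pos_pos[OF half_gt_zero[OF gz] this] show False
      using le unfolding zero mult_zero_right not_le[symmetric] by (rule notE)
  qed
  show ?thesis
  proof (cases "0 < x $ bdir")
    case False
    let ?x = "\<lambda>n. x + (1 / real (Suc n)) *\<^sub>R axis bdir 1"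
    obtain U where U: "open U" "W = halfspace \<inter> U" using W by (auto simp: openin_open)
    have "(\<lambda>n. 1 / real (Suc n)) \<longlonglongrightarrow> 0" using LIMSEQ_inverse_real_of_nat by (simp add: inverse_eq_divide)
    from tendsto_add[OF tendsto_const[of x] tendsto_scaleR[OF this tendsto_const[of "axis bdir 1"]]]
    have lim: "?x \<longlonglongrightarrow> x" by (simp only: scaleR_zero_left add_0_right)
    have "\<forall>\<^sub>F n in sequentially. ?x n \<in> U" using lim U x by (intro topological_tendstoD[OF lim]) auto
    then have ev: "\<forall>\<^sub>F n in sequentially. ?x n \<in> W \<and> 0 < ?x n $ bdir"
    proof (rule eventually_mono)
      fix n assume "?x n \<in> U"
      moreover have "0 < ?x n $ bdir" using x U(2) by (simp add: halfspace_def add_nonneg_pos)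
      ultimately show "?x n \<in> W \<and> 0 < ?x n $ bdir" by (simp add: U(2) halfspace_def)
    qed
    then have "(\<lambda>n. h (?x n)) \<longlonglongrightarrow> h x"
      using continuous_on_tendsto_compose[OF h lim x] by (simp add: eventually_conj_iff)
    moreover have "(\<lambda>n. h (?x n)) \<longlonglongrightarrow> 0"
      by (rule Lim_transform_eventually[OF tendsto_const]) (use ev interior in \<open>auto elim!: eventually_mono\<close>)
    ultimately show ?thesis using LIMSEQ_unique by blast
  qed (use interior x in auto)
qed

context riemannian begin

definition admissible :: "('m, 'n) chart \<Rightarrow> 'n vect \<Rightarrow> real \<Rightarrow> bool" where
  "admissible \<kappa> x r \<longleftrightarrow> \<kappa> \<in> atlas M \<and> 0 < r \<and> cball x r \<inter> halfspace \<subseteq> img \<kappa>"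

lemma bump_supported:
  assumes "admissible \<kappa> x r"
  obtains S where "compactin (mspace M) S" "S \<subseteq> fst \<kappa>" "snd \<kappa> ` S = cball x r \<inter> halfspace"
    "\<And>g q. (\<And>y. y \<in> halfspace \<Longrightarrow> y \<notin> cball x r \<Longrightarrow> g y = 0) \<Longrightarrow> q \<notin> S \<Longrightarrow> lift_fun \<kappa> g q = 0"
    "\<And>X \<kappa>' q. (\<And>y. y \<in> halfspace \<Longrightarrow> y \<notin> cball x r \<Longrightarrow> X y = 0) \<Longrightarrow> q \<notin> S \<Longrightarrow> lift_field \<kappa> X \<kappa>' q = 0"
proof
  let ?K = "cball x r \<inter> halfspace"
  let ?S = "chart_inv \<kappa> ` ?K"
  have \<kappa>: "\<kappa> \<in> atlas M" and K: "?K \<subseteq> img \<kappa>" using assms by (auto simp: admissible_def)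
  show "compactin (mspace M) ?S" "?S \<subseteq> fst \<kappa>"
    by (rule compactin_chart_inv[OF \<kappa> compact_cball_halfspace K])+
  have "snd \<kappa> ` ?S = (\<lambda>y. y) ` ?K"
    unfolding image_image by (rule image_cong[OF refl]) (use K snd_chart_inv in blast)
  then show "snd \<kappa> ` ?S = ?K" by simp
  show "lift_fun \<kappa> g q = 0" if "\<And>y. y \<in> halfspace \<Longrightarrow> y \<notin> cball x r \<Longrightarrow> g y = 0" "q \<notin> ?S" for g q
    by (rule lift_fun_zero[OF \<kappa> _ that(2)]) (use that(1) img_halfspace[OF \<kappa>] in auto)
  show "lift_field \<kappa> X \<kappa>' q = 0" if "\<And>y. y \<in> halfspace \<Longrightarrow> y \<notin> cball x r \<Longrightarrow> X y = 0" "q \<notin> ?S" for X \<kappa>' q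
    by (rule lift_field_zero[OF \<kappa> _ that(2)]) (use that(1) img_halfspace[OF \<kappa>] in auto)
qed

lemma admissible_bump_C_inf: "admissible \<kappa> x r \<Longrightarrow> lift_fun \<kappa> (bump x r) \<in> C_inf M"
  by (auto simp: admissible_def intro: lift_bump_C_inf)

text \<open>
  A continuous function orthogonal to all interior bumps vanishes. The product with the bump is passed
  as a separate function \<open>f\<close>, because \<open>g\<close> may be meaningful in one chart only.
\<close>

lemma weak_zero:
  assumes \<kappa>: "\<kappa> \<in> atlas M" and U: "openin (mspace M) U" "U \<subseteq> fst \<kappa>"
    and g: "continuous_on (snd \<kappa> ` U) (g \<circ> chart_inv \<kappa>)"
    and test: "\<And>x r. admissible \<kappa> x r \<Longrightarrow> cball x r \<subseteq> snd \<kappa> ` U \<Longrightarrow> (\<And>y. y \<in> cball x r \<Longrightarrow> 0 < y $ bdir) \<Longrightarrow>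
      \<exists>f. mcont f \<and> mint M f = 0 \<and> (\<forall>q\<in>topspace (mspace M). f q = lift_fun \<kappa> (bump x r) q * g q)"
    and p: "p \<in> U"
  shows "g p = 0"
proof -
  have pk: "p \<in> fst \<kappa>" using p U(2) by blast
  have "weighted \<kappa> g (snd \<kappa> p) = 0"
  proof (rule fundamental_lemma[OF hopen_image[OF \<kappa> U]])
    have "continuous_on (snd \<kappa> ` U) (\<lambda>y. (g \<circ> chart_inv \<kappa>) y * (vol_density M \<kappa> \<circ> chart_inv \<kappa>) y)"
      by (rule continuous_on_mult[OF g continuous_on_subset[OF smooth_on_imp_continuous_on[OF smooth_vol_density[OF \<kappa>]]]])
        (use U(2) in blast)
    then show "continuous_on (snd \<kappa> ` U) (weighted \<kappa> g)" by (simp add: comp_def)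
    show "snd \<kappa> p \<in> snd \<kappa> ` U" using p by blast
    fix x r assume r: "0 < r" and sub: "cball x r \<subseteq> snd \<kappa> ` U" and int: "\<And>y. y \<in> cball x r \<Longrightarrow> 0 < y $ bdir"
    have sub1: "cball x r \<subseteq> img \<kappa>" using sub U(2) by blast
    have adm: "admissible \<kappa> x r" using r sub1 \<kappa> by (auto simp: admissible_def)
    obtain f where f: "mcont f" "mint M f = 0" "\<And>q. q \<in> topspace (mspace M) \<Longrightarrow> f q = lift_fun \<kappa> (bump x r) q * g q"
      using test[OF adm sub int] by blast
    show "(LINT y:cball x r|lborel. bump x r y * weighted \<kappa> g y) = 0"
    proof (rule bump_supported[OF adm])
      fix S assume S: "compactin (mspace M) S" "S \<subseteq> fst \<kappa>" and sS: "snd \<kappa> ` S = cball x r \<inter> halfspace"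
        and s: "\<And>g q. (\<And>y. y \<in> halfspace \<Longrightarrow> y \<notin> cball x r \<Longrightarrow> g y = 0) \<Longrightarrow> q \<notin> S \<Longrightarrow> lift_fun \<kappa> g q = 0"
      have K: "snd \<kappa> ` S = cball x r" using sS sub1 img_halfspace[OF \<kappa>] by blast
      have f0: "f q = 0" if "q \<in> topspace (mspace M)" "q \<notin> S" for q
      proof -
        have "lift_fun \<kappa> (bump x r) q = 0" by (rule s[OF _ that(2)]) (use r in \<open>auto intro: bump_zero\<close>)
        then show ?thesis using f(3)[OF that(1)] by simp
      qed
      have "0 = (LINT y:img \<kappa>|lborel. weighted \<kappa> f y)"
        using mint_chart[OF \<kappa> f(1) S f0] f(2) by simp
      also have "\<dots> = (LINT y:cball x r|lborel. weighted \<kappa> f y)"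
        unfolding K[symmetric] by (rule chart_integral(2)[OF \<kappa> f(1) S]) (use f0 domain_subset[OF \<kappa>] in blast)
      also have "\<dots> = (LINT y:cball x r|lborel. bump x r y * weighted \<kappa> g y)"
      proof (rule set_integral_eqI)
        fix y assume "y \<in> cball x r"
        then have y: "y \<in> img \<kappa>" using sub1 by blast
        have "chart_inv \<kappa> y \<in> topspace (mspace M)" using chart_inv_in[OF y] domain_subset[OF \<kappa>] by blast
        then show "weighted \<kappa> f y = bump x r y * weighted \<kappa> g y"
          by (simp add: f(3) lift_fun_def chart_inv_in[OF y] snd_chart_inv[OF y])
      qed
      finally show ?thesis by simp
    qed
  qed
  then show ?thesis using vol_density_pos[OF \<kappa> pk] by (simp add: chart_inv_snd[OF \<kappa> pk])
qed

text \<open>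
  In these terms the divergence has no zeroth-order part, up to the factor \<open>vol_density\<close>.
\<close>

definition flux :: "('m, 'n) chart \<Rightarrow> ('m, 'n) vfield \<Rightarrow> 'n \<Rightarrow> 'n vect \<Rightarrow> real" where
  "flux \<kappa> w i = (\<lambda>q. vol_density M \<kappa> q * w \<kappa> q $ i) \<circ> chart_inv \<kappa>"

definition chart_div :: "('m, 'n) chart \<Rightarrow> ('m, 'n) vfield \<Rightarrow> 'm \<Rightarrow> real" where
  "chart_div \<kappa> w p = (\<Sum>i\<in>UNIV. partial i (flux \<kappa> w i) (snd \<kappa> p)) / vol_density M \<kappa> p"

lemma mdiv_chart_at: "mdiv M w p = chart_div (chart_at M p) w p"
  by (simp add: mdiv_def chart_div_def flux_def Let_def)

lemma smooth_flux:
  assumes "w \<in> vector_fields M" "\<kappa> \<in> atlas M" shows "smooth_on (flux \<kappa> w i) (img \<kappa>)"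
proof -
  have "smooth_on (\<lambda>x. (vol_density M \<kappa> \<circ> chart_inv \<kappa>) x * (w \<kappa> \<circ> chart_inv \<kappa>) x $ i) (img \<kappa>)"
    by (intro smooth_on_mult smooth_on_vec_nth smooth_vol_density vector_fieldD(1) assms)
  then show ?thesis by (simp add: flux_def comp_def)
qed

lemma smooth_chart_div:
  assumes "w \<in> vector_fields M" "\<kappa> \<in> atlas M" shows "smooth_on (chart_div \<kappa> w \<circ> chart_inv \<kappa>) (img \<kappa>)"
proof -
  have "smooth_on (\<lambda>x. (\<Sum>i\<in>UNIV. partial i (flux \<kappa> w i) x) / (vol_density M \<kappa> \<circ> chart_inv \<kappa>) x) (img \<kappa>)"
    using vol_density_pos[OF assms(2) chart_inv_in]
    by (intro smooth_on_divide smooth_on_sum smooth_on_partial smooth_flux smooth_vol_density hopen_img assms) auto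
  then show ?thesis
    by (rule smooth_on_transform) (simp add: chart_div_def snd_chart_inv)
qed

lemma chart_div_cong:
  assumes \<kappa>: "\<kappa> \<in> atlas M" and U: "openin (mspace M) U" "U \<subseteq> fst \<kappa>" "p \<in> U"
    and eq: "\<And>q. q \<in> U \<Longrightarrow> w \<kappa> q = w' \<kappa> q"
  shows "chart_div \<kappa> w p = chart_div \<kappa> w' p"
proof -
  have "partial i (flux \<kappa> w i) (snd \<kappa> p) = partial i (flux \<kappa> w' i) (snd \<kappa> p)" for i
    using U(3) by (intro partial_cong[OF hopen_image[OF \<kappa> U(1,2)]])
      (use eq U(2) chart_inv_snd[OF \<kappa>] in \<open>auto simp: flux_def subset_iff\<close>)
  then show ?thesis by (simp add: chart_div_def)
qed

definition scale_field :: "('m \<Rightarrow> real) \<Rightarrow> ('m, 'n) vfield \<Rightarrow> ('m, 'n) vfield" where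
  "scale_field f w \<kappa> p = f p *\<^sub>R w \<kappa> p"

definition add_field :: "('m, 'n) vfield \<Rightarrow> ('m, 'n) vfield \<Rightarrow> ('m, 'n) vfield" where
  "add_field v w \<kappa> p = v \<kappa> p + w \<kappa> p"

lemma scale_field_vector_field:
  assumes f: "f \<in> C_inf M" and w: "w \<in> vector_fields M" shows "scale_field f w \<in> vector_fields M"
  unfolding vector_fields_def smooth_components_def mem_Collect_eq
proof (intro conjI ballI)
  fix \<kappa> assume \<kappa>: "\<kappa> \<in> atlas M"
  have "smooth_on (\<lambda>x. (f \<circ> chart_inv \<kappa>) x *\<^sub>R (w \<kappa> \<circ> chart_inv \<kappa>) x) (img \<kappa>)"
    by (intro smooth_on_bilinear[OF bounded_bilinear_scaleR] C_infD vector_fieldD(1) f w \<kappa>)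
  then show "smooth_on (scale_field f w \<kappa> \<circ> chart_inv \<kappa>) (img \<kappa>)" by (simp add: scale_field_def comp_def)
  show "scale_field f w \<kappa>' p = transition_jac \<kappa> \<kappa>' p *v scale_field f w \<kappa> p"
    if "\<kappa>' \<in> atlas M" "p \<in> fst \<kappa> \<inter> fst \<kappa>'" for \<kappa>' p
    using vector_fieldD(2)[OF w \<kappa> that] by (simp add: scale_field_def matrix_vector_mult_scaleR)
qed

lemma add_field_vector_field:
  assumes v: "v \<in> vector_fields M" and w: "w \<in> vector_fields M" shows "add_field v w \<in> vector_fields M"
  unfolding vector_fields_def smooth_components_def mem_Collect_eq
proof (intro conjI ballI)
  fix \<kappa> assume \<kappa>: "\<kappa> \<in> atlas M"
  have "smooth_on (\<lambda>x. (v \<kappa> \<circ> chart_inv \<kappa>) x + (w \<kappa> \<circ> chart_inv \<kappa>) x) (img \<kappa>)"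
    by (intro smooth_on_add vector_fieldD(1) v w \<kappa>)
  then show "smooth_on (add_field v w \<kappa> \<circ> chart_inv \<kappa>) (img \<kappa>)" by (simp add: add_field_def comp_def)
  show "add_field v w \<kappa>' p = transition_jac \<kappa> \<kappa>' p *v add_field v w \<kappa> p"
    if "\<kappa>' \<in> atlas M" "p \<in> fst \<kappa> \<inter> fst \<kappa>'" for \<kappa>' p
    using vector_fieldD(2)[OF v \<kappa> that] vector_fieldD(2)[OF w \<kappa> that]
    by (simp add: add_field_def matrix_vector_right_distrib)
qed

lemma chart_div_scale:
  assumes f: "f \<in> C_inf M" and w: "w \<in> vector_fields M" and \<kappa>: "\<kappa> \<in> atlas M" and p: "p \<in> fst \<kappa>"
  shows "chart_div \<kappa> (scale_field f w) p = mdifferential f \<kappa> p \<bullet> w \<kappa> p + f p * chart_div \<kappa> w p"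
proof -
  have x: "snd \<kappa> p \<in> img \<kappa>" using p by blast
  have "partial i (flux \<kappa> (scale_field f w) i) (snd \<kappa> p) =
      f p * partial i (flux \<kappa> w i) (snd \<kappa> p) + mdifferential f \<kappa> p $ i * (vol_density M \<kappa> p * w \<kappa> p $ i)" for i
  proof -
    have "flux \<kappa> (scale_field f w) i = (\<lambda>x. (f \<circ> chart_inv \<kappa>) x * flux \<kappa> w i x)"
      by (simp add: flux_def scale_field_def fun_eq_iff mult_ac)
    then show ?thesis
      using partial_mult[OF C_infD[OF f \<kappa>] smooth_flux[OF w \<kappa>] hopen_img[OF \<kappa>] x, of i i] chart_inv_snd[OF \<kappa> p]
      by (simp add: mdifferential_def flux_def)
  qed
  then have "(\<Sum>i\<in>UNIV. partial i (flux \<kappa> (scale_field f w) i) (snd \<kappa> p)) =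
      f p * (\<Sum>i\<in>UNIV. partial i (flux \<kappa> w i) (snd \<kappa> p)) + vol_density M \<kappa> p * (mdifferential f \<kappa> p \<bullet> w \<kappa> p)"
    by (simp add: sum.distrib sum_distrib_left inner_vec_def mult_ac)
  then show ?thesis using vol_density_pos[OF \<kappa> p] by (simp add: chart_div_def field_simps)
qed

lemma chart_div_add:
  assumes v: "v \<in> vector_fields M" and w: "w \<in> vector_fields M" and \<kappa>: "\<kappa> \<in> atlas M" and p: "p \<in> fst \<kappa>"
  shows "chart_div \<kappa> (add_field v w) p = chart_div \<kappa> v p + chart_div \<kappa> w p"
proof -
  have x: "snd \<kappa> p \<in> img \<kappa>" using p by blast
  have "flux \<kappa> (add_field v w) i = (\<lambda>x. flux \<kappa> v i x + flux \<kappa> w i x)" for i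
    by (simp add: flux_def add_field_def fun_eq_iff algebra_simps)
  then show ?thesis
    using partial_add[OF smooth_flux[OF v \<kappa>] smooth_flux[OF w \<kappa>] hopen_img[OF \<kappa>] x]
    by (simp add: chart_div_def sum.distrib add_divide_distrib)
qed

subsection \<open>The divergence theorem in a chart\<close>

definition flux_ext :: "('m, 'n) chart \<Rightarrow> ('m, 'n) vfield \<Rightarrow> 'n \<Rightarrow> 'n vect \<Rightarrow> real" where
  "flux_ext \<kappa> w i x = (if x \<in> img \<kappa> then flux \<kappa> w i x else 0)"

definition chart_div_ext :: "('m, 'n) chart \<Rightarrow> ('m, 'n) vfield \<Rightarrow> 'm \<Rightarrow> real" where
  "chart_div_ext \<kappa> w p = (if p \<in> fst \<kappa> then chart_div \<kappa> w p else 0)"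

context
  fixes \<kappa> w S
  assumes \<kappa>: "\<kappa> \<in> atlas M" and w: "w \<in> vector_fields M" and S: "compactin (mspace M) S" "S \<subseteq> fst \<kappa>"
    and supp: "\<And>p. p \<in> fst \<kappa> \<Longrightarrow> p \<notin> S \<Longrightarrow> w \<kappa> p = 0"
begin

lemma flux_zero: "x \<in> img \<kappa> \<Longrightarrow> x \<notin> snd \<kappa> ` S \<Longrightarrow> flux \<kappa> w i x = 0"
proof -
  assume x: "x \<in> img \<kappa>" "x \<notin> snd \<kappa> ` S"
  then have "chart_inv \<kappa> x \<notin> S" using snd_chart_inv by (metis image_eqI)
  then show ?thesis using supp[OF chart_inv_in[OF x(1)]] by (simp add: flux_def)
qed

lemma flux_compactly_supported: "compactly_supported (flux_ext \<kappa> w i) (snd \<kappa> ` S)"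
proof
  show C: "compact (snd \<kappa> ` S)" by (rule compact_image[OF \<kappa> S])
  show "snd \<kappa> ` S \<subseteq> halfspace" using S(2) img_halfspace[OF \<kappa>] by blast
  show zero: "flux_ext \<kappa> w i x = 0" if "x \<notin> snd \<kappa> ` S" for x
    using flux_zero that by (simp add: flux_ext_def)
  show "smooth_on (flux_ext \<kappa> w i) halfspace"
  proof (rule smooth_on_local)
    fix x :: "'n vect" assume x: "x \<in> halfspace"
    show "\<exists>U. open U \<and> x \<in> U \<and> smooth_on (flux_ext \<kappa> w i) (halfspace \<inter> U)"
    proof (cases "x \<in> img \<kappa>")
      case True
      obtain U where U: "open U" "img \<kappa> = halfspace \<inter> U" using hopen_img[OF \<kappa>] by (auto simp: openin_open)
      have "smooth_on (flux_ext \<kappa> w i) (halfspace \<inter> U)"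
        unfolding U(2)[symmetric] by (rule smooth_on_transform[OF smooth_flux[OF w \<kappa>]]) (simp add: flux_ext_def)
      then show ?thesis using U True by blast
    next
      case False
      have "smooth_on (flux_ext \<kappa> w i) (halfspace \<inter> - (snd \<kappa> ` S))"
        by (rule smooth_on_transform[OF smooth_on_const[of 0]]) (use zero in auto)
      moreover have "open (- (snd \<kappa> ` S))" using C by (simp add: compact_imp_closed open_Compl)
      moreover have "x \<in> - (snd \<kappa> ` S)" using False S(2) by blast
      ultimately show ?thesis by blast
    qed
  qed
qed

lemma chart_div_zero: "p \<in> fst \<kappa> \<Longrightarrow> p \<notin> S \<Longrightarrow> chart_div \<kappa> w p = 0"
proof -
  assume p: "p \<in> fst \<kappa>" "p \<notin> S"
  have "chart_div \<kappa> w p = chart_div \<kappa> (\<lambda>\<kappa> p. 0) p"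
    using openin_diff[OF openin_domain[OF \<kappa>] closedin_compactin[OF S(1)]]
    by (rule chart_div_cong[OF \<kappa>]) (use p supp in auto)
  also have "\<dots> = 0" using img_halfspace[OF \<kappa>] p by (auto simp: chart_div_def flux_def comp_def)
  finally show ?thesis .
qed

lemma chart_div_ext_C_inf: "chart_div_ext \<kappa> w \<in> C_inf M"
proof -
  have "lift_fun \<kappa> (chart_div \<kappa> w \<circ> chart_inv \<kappa>) \<in> C_inf M"
  proof (rule lift_fun_C_inf[OF \<kappa> smooth_chart_div[OF w \<kappa>] compact_image[OF \<kappa> S]])
    show "snd \<kappa> ` S \<subseteq> img \<kappa>" using S(2) by blast
    fix x assume x: "x \<in> img \<kappa>" "x \<notin> snd \<kappa> ` S"
    then have "chart_inv \<kappa> x \<notin> S" using snd_chart_inv by (metis image_eqI)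
    then show "(chart_div \<kappa> w \<circ> chart_inv \<kappa>) x = 0" using chart_div_zero[OF chart_inv_in[OF x(1)]] by simp
  qed
  moreover have "lift_fun \<kappa> (chart_div \<kappa> w \<circ> chart_inv \<kappa>) = chart_div_ext \<kappa> w"
    by (auto simp: lift_fun_def chart_div_ext_def chart_inv_snd[OF \<kappa>] fun_eq_iff)
  ultimately show ?thesis by simp
qed

text \<open>
  The components tangential to the boundary integrate to zero; the normal one is left unevaluated.
\<close>

lemma divergence_theorem_chart:
  "mint M (chart_div_ext \<kappa> w) = (LINT x:halfspace|lborel. partial bdir (flux_ext \<kappa> w bdir) x)"
proof -
  let ?C = "snd \<kappa> ` S"
  have C: "compact ?C" "?C \<subseteq> img \<kappa>" "?C \<subseteq> halfspace"
    using compact_image[OF \<kappa> S] S(2) img_halfspace[OF \<kappa>] by auto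
  have pc: "continuous_on ?C (partial i (flux_ext \<kappa> w i))" for i
    using compactly_supported.continuous_partial[OF flux_compactly_supported] C(3) by (rule continuous_on_subset)
  have ps: "partial i (flux_ext \<kappa> w i) x = 0" if "x \<in> halfspace" "x \<notin> ?C" for x i
    by (rule compactly_supported.partial_supp[OF flux_compactly_supported that])
  have "mint M (chart_div_ext \<kappa> w) = (LINT x:img \<kappa>|lborel. weighted \<kappa> (chart_div_ext \<kappa> w) x)"
    by (rule mint_chart[OF \<kappa> C_inf_mcont[OF chart_div_ext_C_inf] S]) (simp add: chart_div_ext_def chart_div_zero)
  also have "\<dots> = (LINT x:img \<kappa>|lborel. \<Sum>i\<in>UNIV. partial i (flux_ext \<kappa> w i) x)"
  proof (rule set_integral_eqI)
    fix x assume x: "x \<in> img \<kappa>"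
    have "partial i (flux_ext \<kappa> w i) x = partial i (flux \<kappa> w i) x" for i
      by (rule partial_cong[OF hopen_img[OF \<kappa>] x]) (simp add: flux_ext_def)
    then show "weighted \<kappa> (chart_div_ext \<kappa> w) x = (\<Sum>i\<in>UNIV. partial i (flux_ext \<kappa> w i) x)"
      using vol_density_pos[OF \<kappa> chart_inv_in[OF x]] chart_inv_in[OF x] snd_chart_inv[OF x]
      by (simp add: chart_div_ext_def chart_div_def)
  qed
  also have "\<dots> = (LINT x:?C|lborel. \<Sum>i\<in>UNIV. partial i (flux_ext \<kappa> w i) x)"
    using C pc ps img_halfspace[OF \<kappa>]
    by (intro set_integral_compact_support(2) continuous_on_sum sum.neutral) auto
  also have "\<dots> = (\<Sum>i\<in>UNIV. LINT x:?C|lborel. partial i (flux_ext \<kappa> w i) x)"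
    unfolding set_lebesgue_integral_def scaleR_sum_right
    by (intro Bochner_Integration.integral_sum borel_integrable_compact C pc)
  also have "\<dots> = (\<Sum>i\<in>UNIV. LINT x:halfspace|lborel. partial i (flux_ext \<kappa> w i) x)"
    by (intro sum.cong refl set_integral_compact_support(2)[symmetric] C pc ps)
  also have "\<dots> = (\<Sum>i\<in>(UNIV :: 'n set). if i = bdir then LINT x:halfspace|lborel. partial bdir (flux_ext \<kappa> w bdir) x else 0)"
  proof (rule sum.cong[OF refl])
    fix i :: 'n
    show "(LINT x:halfspace|lborel. partial i (flux_ext \<kappa> w i) x) =
        (if i = bdir then LINT x:halfspace|lborel. partial bdir (flux_ext \<kappa> w bdir) x else 0)"
      using compactly_supported.integral_partial_tangential[OF flux_compactly_supported, of i i] by simp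
  qed
  finally show ?thesis by simp
qed

end

subsection \<open>Independence of the chart\<close>

text \<open>
  Tested against a bump in the overlap, the coordinate divergences in two charts have the same
  integral, because by the divergence theorem both are minus the integral of the invariant pairing
  of the differential of the bump with the field. No second derivatives of the transition map enter.
\<close>

lemma chart_div_invariant:
  assumes \<kappa>: "\<kappa> \<in> atlas M" and \<kappa>': "\<kappa>' \<in> atlas M" and w: "w \<in> vector_fields M"
    and p: "p \<in> fst \<kappa>" "p \<in> fst \<kappa>'"
  shows "chart_div \<kappa> w p = chart_div \<kappa>' w p"
proof -
  let ?d = "\<lambda>q. chart_div \<kappa> w q - chart_div \<kappa>' w q"
  have "?d p = 0"
  proof (rule weak_zero[OF \<kappa> openin_Int[OF openin_domain[OF \<kappa>] openin_domain[OF \<kappa>']] Int_lower1])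
    have "smooth_on (chart_div \<kappa> w \<circ> chart_inv \<kappa>) (overlap \<kappa> \<kappa>')"
      by (rule smooth_on_subset[OF smooth_chart_div[OF w \<kappa>]]) auto
    moreover have "smooth_on (chart_div \<kappa>' w \<circ> chart_inv \<kappa>) (overlap \<kappa> \<kappa>')"
      by (rule smooth_transport[OF \<kappa> \<kappa>' smooth_on_subset[OF smooth_chart_div[OF w \<kappa>']]]) auto
    ultimately have "continuous_on (overlap \<kappa> \<kappa>') (\<lambda>x. (chart_div \<kappa> w \<circ> chart_inv \<kappa>) x - (chart_div \<kappa>' w \<circ> chart_inv \<kappa>) x)"
      by (intro continuous_intros smooth_on_imp_continuous_on)
    then show "continuous_on (overlap \<kappa> \<kappa>') (?d \<circ> chart_inv \<kappa>)" by (simp add: comp_def)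
    show "p \<in> fst \<kappa> \<inter> fst \<kappa>'" using p by blast
    fix x r assume adm: "admissible \<kappa> x r" and sub: "cball x r \<subseteq> overlap \<kappa> \<kappa>'" and int: "\<And>y. y \<in> cball x r \<Longrightarrow> 0 < y $ bdir"
    define \<phi> where "\<phi> = lift_fun \<kappa> (bump x r)"
    have r: "0 < r" using adm by (simp add: admissible_def)
    obtain S where S: "compactin (mspace M) S" "S \<subseteq> fst \<kappa>" and sS: "snd \<kappa> ` S = cball x r \<inter> halfspace"
      and \<phi>0: "\<And>q. q \<notin> S \<Longrightarrow> \<phi> q = 0"
    proof (rule bump_supported[OF adm])
      fix S assume S: "compactin (mspace M) S" "S \<subseteq> fst \<kappa>" "snd \<kappa> ` S = cball x r \<inter> halfspace"
        and s: "\<And>g q. (\<And>y. y \<in> halfspace \<Longrightarrow> y \<notin> cball x r \<Longrightarrow> g y = 0) \<Longrightarrow> q \<notin> S \<Longrightarrow> lift_fun \<kappa> g q = 0"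
      show thesis
        by (rule that[OF S]) (unfold \<phi>_def, rule s, use r in \<open>auto intro: bump_zero\<close>)
    qed
    have S': "S \<subseteq> fst \<kappa>'"
    proof
      fix q assume q: "q \<in> S"
      then have "snd \<kappa> q \<in> overlap \<kappa> \<kappa>'" using sS sub by blast
      then obtain q' where "q' \<in> fst \<kappa> \<inter> fst \<kappa>'" "snd \<kappa> q = snd \<kappa> q'" by blast
      then show "q \<in> fst \<kappa>'" using inj_onD[OF chart_inj[OF \<kappa>]] q S(2) by blast
    qed
    have \<phi>: "\<phi> \<in> C_inf M" unfolding \<phi>_def by (rule admissible_bump_C_inf[OF adm])
    let ?u = "scale_field \<phi> w"
    have u: "?u \<in> vector_fields M" by (rule scale_field_vector_field[OF \<phi> w])
    have supp: "?u \<mu> q = 0" if "q \<notin> S" for q \<mu> using \<phi>0[OF that] by (simp add: scale_field_def)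
    have zero: "mint M (chart_div_ext \<mu> ?u) = 0" and smooth: "chart_div_ext \<mu> ?u \<in> C_inf M"
      if \<mu>: "\<mu> \<in> atlas M" "S \<subseteq> fst \<mu>" for \<mu>
    proof -
      show "chart_div_ext \<mu> ?u \<in> C_inf M" by (rule chart_div_ext_C_inf[OF \<mu>(1) u S(1) \<mu>(2) supp])
      have bd: "flux_ext \<mu> ?u bdir y = 0" if y: "y $ bdir = 0" for y
      proof (cases "y \<in> img \<mu>")
        case True
        then obtain q where q: "q \<in> fst \<mu>" "y = snd \<mu> q" by blast
        \<comment> \<open>At a boundary point the bump vanishes, because being a boundary point does not depend on the chart.\<close>
        have "q \<notin> S"
        proof
          assume "q \<in> S"
          then have "snd \<kappa> q $ bdir = 0" using boundary_invariant[OF \<kappa> \<mu>(1)] q y S(2) by blast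
          moreover have "snd \<kappa> q \<in> cball x r" using \<open>q \<in> S\<close> sS by blast
          ultimately show False using int by force
        qed
        then show ?thesis using supp q by (simp add: flux_ext_def flux_def chart_inv_snd[OF \<mu>(1)])
      qed (simp add: flux_ext_def)
      show "mint M (chart_div_ext \<mu> ?u) = 0"
        using compactly_supported.integral_partial_zero[OF flux_compactly_supported[OF \<mu>(1) u S(1) \<mu>(2) supp] bd]
          divergence_theorem_chart[OF \<mu>(1) u S(1) \<mu>(2) supp] by simp
    qed
    \<comment> \<open>The derivative of the bump enters through an invariant pairing and cancels.\<close>
    have diff: "chart_div_ext \<kappa> ?u q + - 1 * chart_div_ext \<kappa>' ?u q = \<phi> q * ?d q" for q
    proof (cases "q \<in> S")
      case True
      then have q: "q \<in> fst \<kappa>" "q \<in> fst \<kappa>'" using S(2) S' by auto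
      show ?thesis
        using chart_div_scale[OF \<phi> w \<kappa> q(1)] chart_div_scale[OF \<phi> w \<kappa>' q(2)] mdifferential_pairing[OF \<phi> w \<kappa> \<kappa>', of q] q
        by (simp add: chart_div_ext_def algebra_simps)
    next
      case False
      then show ?thesis
        using chart_div_zero[OF \<kappa> u S supp, of q] chart_div_zero[OF \<kappa>' u S(1) S' supp, of q] \<phi>0[OF False]
        by (simp add: chart_div_ext_def)
    qed
    let ?f = "\<lambda>q. chart_div_ext \<kappa> ?u q + - 1 * chart_div_ext \<kappa>' ?u q"
    note m = C_inf_mcont[OF smooth[OF \<kappa> S(2)]] mcont_mult[OF mcont_const C_inf_mcont[OF smooth[OF \<kappa>' S']], of "- 1"]
    have "mint M ?f = 0"
      unfolding mint_add[OF m] mint_cmult zero[OF \<kappa> S(2)] zero[OF \<kappa>' S'] by simp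
    then show "\<exists>f. mcont f \<and> mint M f = 0 \<and> (\<forall>q\<in>topspace (mspace M). f q = lift_fun \<kappa> (bump x r) q * ?d q)"
      using mcont_add[OF m] diff unfolding \<phi>_def[symmetric] by (intro exI[of _ ?f] conjI ballI)
  qed
  then show ?thesis by simp
qed

lemma mdiv_chart:
  assumes "w \<in> vector_fields M" "\<kappa> \<in> atlas M" "p \<in> fst \<kappa>"
  shows "mdiv M w p = chart_div \<kappa> w p"
proof -
  have "p \<in> topspace (mspace M)" using assms domain_subset by blast
  then show ?thesis
    unfolding mdiv_chart_at using assms chart_at by (intro chart_div_invariant) auto
qed

lemma mdiv_C_inf: 
  assumes "w \<in> vector_fields M" shows "mdiv M w \<in> C_inf M"
proof (rule C_infI)
  fix \<kappa> assume \<kappa>: "\<kappa> \<in> atlas M"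
  show "smooth_on (mdiv M w \<circ> chart_inv \<kappa>) (img \<kappa>)"
    by (rule smooth_on_transform[OF smooth_chart_div[OF assms \<kappa>]])
      (metis assms \<kappa> chart_inv_in comp_apply mdiv_chart)
qed

lemma mdiv_scale:
  assumes f: "f \<in> C_inf M" and w: "w \<in> vector_fields M" and p: "p \<in> topspace (mspace M)"
  shows "mdiv M (scale_field f w) p = ginner M (grad M f) w p + f p * mdiv M w p"
  unfolding mdiv_chart_at chart_div_scale[OF f w chart_at[OF p]] ginner_grad[OF f w chart_at[OF p]] ..

lemma mdiv_add:
  assumes "v \<in> vector_fields M" "w \<in> vector_fields M" "p \<in> topspace (mspace M)"
  shows "mdiv M (add_field v w) p = mdiv M v p + mdiv M w p"
  unfolding mdiv_chart_at using assms chart_at by (intro chart_div_add) auto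

text \<open>
  By the product rule this function is a difference of two divergences.
\<close>

lemma ginner_grad_C_inf:
  assumes f: "f \<in> C_inf M" and w: "w \<in> vector_fields M"
  shows "ginner M (grad M f) w \<in> C_inf M"
proof -
  have "(\<lambda>p. mdiv M (scale_field f w) p + (- 1) * (f p * mdiv M w p)) \<in> C_inf M"
    by (intro C_inf_add C_inf_mult C_inf_const mdiv_C_inf scale_field_vector_field f w)
  moreover have "mdiv M (scale_field f w) p + (- 1) * (f p * mdiv M w p) = ginner M (grad M f) w p"
    if "p \<in> topspace (mspace M)" for p using mdiv_scale[OF f w that] by simp
  ultimately show ?thesis using C_inf_cong[of "\<lambda>p. mdiv M (scale_field f w) p + (- 1) * (f p * mdiv M w p)"] by simp
qed

lemma mdiv_zero:
  assumes S: "closedin (mspace M) S" and w: "\<And>\<kappa> q. \<kappa> \<in> atlas M \<Longrightarrow> q \<in> fst \<kappa> \<Longrightarrow> q \<notin> S \<Longrightarrow> w \<kappa> q = 0"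
    and p: "p \<in> topspace (mspace M)" "p \<notin> S"
  shows "mdiv M w p = 0"
proof -
  note \<kappa> = chart_at[OF p(1)]
  have "chart_div (chart_at M p) w p = chart_div (chart_at M p) (\<lambda>\<kappa> p. 0) p"
    using openin_diff[OF openin_domain[OF \<kappa>(1)] S]
    by (rule chart_div_cong[OF \<kappa>(1)]) (use p w \<kappa> in auto)
  also have "\<dots> = 0" using img_halfspace[OF \<kappa>(1)] \<kappa>(2) by (auto simp: chart_div_def flux_def comp_def)
  finally show ?thesis by (simp add: mdiv_chart_at)
qed

context
  fixes \<kappa> w S
  assumes \<kappa>: "\<kappa> \<in> atlas M" and w: "w \<in> vector_fields M" and S: "compactin (mspace M) S" "S \<subseteq> fst \<kappa>"
    and supp: "\<And>\<kappa>' q. \<kappa>' \<in> atlas M \<Longrightarrow> q \<in> fst \<kappa>' \<Longrightarrow> q \<notin> S \<Longrightarrow> w \<kappa>' q = 0"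
begin

lemma divergence_theorem:
  "mint M (mdiv M w) = (LINT x:halfspace|lborel. partial bdir (flux_ext \<kappa> w bdir) x)"
proof -
  have "mint M (mdiv M w) = mint M (chart_div_ext \<kappa> w)"
  proof (rule mint_cong)
    fix p assume p: "p \<in> topspace (mspace M)"
    show "mdiv M w p = chart_div_ext \<kappa> w p"
    proof (cases "p \<in> fst \<kappa>")
      case True
      then show ?thesis using mdiv_chart[OF w \<kappa>] by (simp add: chart_div_ext_def)
    next
      case False
      then have "p \<notin> S" using S(2) by blast
      have "mdiv M w p = 0" by (rule mdiv_zero[OF closedin_compactin[OF S(1)] supp p \<open>p \<notin> S\<close>])
      then show ?thesis using False by (simp add: chart_div_ext_def)
    qed
  qed
  then show ?thesis using divergence_theorem_chart[OF \<kappa> w S supp[OF \<kappa>]] by simp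
qed

lemma integral_mdiv_zero:
  assumes "\<And>p. p \<in> fst \<kappa> \<Longrightarrow> snd \<kappa> p $ bdir = 0 \<Longrightarrow> w \<kappa> p $ bdir = 0"
  shows "mint M (mdiv M w) = 0"
  unfolding divergence_theorem
  by (rule compactly_supported.integral_partial_zero[OF flux_compactly_supported[OF \<kappa> w S supp[OF \<kappa>]]])
    (auto simp: flux_ext_def flux_def chart_inv_snd[OF \<kappa>] assms)

lemma integral_mdiv_negative:
  assumes "\<And>p. p \<in> fst \<kappa> \<Longrightarrow> 0 \<le> w \<kappa> p $ bdir" "p0 \<in> fst \<kappa>" "snd \<kappa> p0 $ bdir = 0" "0 < w \<kappa> p0 $ bdir"
  shows "mint M (mdiv M w) < 0"
proof -
  note cs = flux_compactly_supported[OF \<kappa> w S supp[OF \<kappa>]]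
  have nonneg:  "0 \<le> flux_ext \<kappa> w bdir x" for x
    using assms(1) vol_density_pos[OF \<kappa>] by (auto simp: flux_ext_def flux_def chart_inv_snd[OF \<kappa>] less_imp_le)
  have pos: "0 < flux_ext \<kappa> w bdir (snd \<kappa> p0)"
    using assms(2,4) vol_density_pos[OF \<kappa>] by (auto simp: flux_ext_def flux_def chart_inv_snd[OF \<kappa>])
  show ?thesis
    unfolding divergence_theorem
    using compactly_supported.integral_partial_negative[OF cs nonneg assms(3) pos] by simp
qed

end

end

section \<open>First variations\<close>

text \<open>
  The choice \<open>\<epsilon> = - a / (2 (\<bar>b\<bar> + 1))\<close> makes the right-hand side negative unless \<open>a = 0\<close>.
\<close>

lemma quadratic_nonneg_linear_zero:
  fixes a b :: real
  assumes "\<And>\<epsilon>. 0 \<le> \<epsilon> * a + \<epsilon>\<^sup>2 * b" shows "a = 0"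
proof (rule ccontr)
  assume a: "a \<noteq> 0"
  define B where "B = \<bar>b\<bar> + 1"
  have B: "b \<le> B" "0 < B" by (auto simp: B_def)
  have "0 \<le> (- a / (2 * B)) * a + (- a / (2 * B))\<^sup>2 * b" by (rule assms)
  also have "\<dots> \<le> (- a / (2 * B)) * a + (- a / (2 * B))\<^sup>2 * B"
    using B by (intro add_left_mono mult_left_mono) auto
  also have "\<dots> = - (a\<^sup>2 / (4 * B))" using B by (simp add: field_simps power2_eq_square)
  also have "\<dots> < 0" using a B by simp
  finally show False by simp
qed

lemma quadratic_error_derivative:
  fixes f :: "real \<Rightarrow> real"
  assumes "\<And>x. \<bar>x\<bar> \<le> 1 \<Longrightarrow> \<bar>f x - f 0 - x * d\<bar> \<le> K * x\<^sup>2"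
  shows "(f has_real_derivative d) (at 0)"
proof -
  have "((\<lambda>h. (f h - f 0) / h - d) \<longlongrightarrow> 0) (at 0)"
  proof (rule Lim_null_comparison)
    have "((\<lambda>h::real. K * \<bar>h\<bar>) \<longlongrightarrow> K * \<bar>0\<bar>) (at 0)" by (intro tendsto_intros)
    then show "((\<lambda>h::real. K * \<bar>h\<bar>) \<longlongrightarrow> 0) (at 0)" by simp
    have "norm ((f h - f 0) / h - d) \<le> K * \<bar>h\<bar>" if "h \<noteq> 0" "\<bar>h\<bar> < 1" for h
    proof -
      have "\<bar>(f h - f 0) / h - d\<bar> = \<bar>f h - f 0 - h * d\<bar> / \<bar>h\<bar>"
        using that(1) by (simp add: field_simps flip: abs_divide)
      also have "\<dots> \<le> K * h\<^sup>2 / \<bar>h\<bar>" using assms[of h] that by (intro divide_right_mono) auto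
      also have "\<dots> = K * \<bar>h\<bar>"
        using that(1) by (simp add: power2_eq_square abs_mult_self_eq[of h, symmetric] del: abs_mult_self_eq)
      finally show ?thesis by simp
    qed
    then show "\<forall>\<^sub>F h in at 0. norm ((f h - f 0) / h - d) \<le> K * \<bar>h\<bar>"
      unfolding eventually_at by (intro exI[of _ 1]) (auto simp: dist_real_def)
  qed
  then show ?thesis by (simp add: DERIV_def LIM_zero_iff)
qed

lemma smooth_real_deriv:
  fixes F :: "real \<Rightarrow> real"
  assumes "smooth_on F UNIV"
  shows "(F has_real_derivative deriv F x) (at x)" "smooth_on (deriv F) UNIV"
proof -
  have C: "Ck_on (Suc k) F UNIV" for k using assms by (simp add: smooth_on_open)
  have d: "F differentiable (at x)" for x using C[of 0] by simp
  then show D: "(F has_real_derivative deriv F x) (at x)" for x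
    by (simp add: DERIV_deriv_iff_real_differentiable)
  have "frechet_derivative F (at x) = (*) (deriv F x)" for x
    using frechet_derivative_at[OF D[unfolded has_field_derivative_def]] by metis
  then have "deriv F = (\<lambda>x. frechet_derivative F (at x) 1)" by (simp add: fun_eq_iff)
  then have "Ck_on k (deriv F) UNIV" for k using C[of k] by simp
  then show "smooth_on (deriv F) UNIV" by (rule smooth_on_Ck)
qed

lemma first_order_remainder:
  fixes F :: "real \<Rightarrow> real"
  assumes F: "smooth_on F UNIV"
  obtains K where "0 \<le> K" "\<And>s t. \<bar>s\<bar> \<le> a \<Longrightarrow> \<bar>t\<bar> \<le> b \<Longrightarrow> \<bar>F (s + t) - F s - t * deriv F s\<bar> \<le> K * t\<^sup>2"
proof -
  note F1 = smooth_real_deriv[OF F]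
  note F2 = smooth_real_deriv[OF F1(2)]
  have "continuous_on {-(a + b)..a + b} (deriv (deriv F))"
    using smooth_on_imp_continuous_on[OF F2(2)] by (rule continuous_on_subset) simp
  then have "bounded (deriv (deriv F) ` {-(a + b)..a + b})"
    by (intro compact_imp_bounded compact_continuous_image) auto
  then obtain K where "\<forall>y\<in>deriv (deriv F) ` {-(a + b)..a + b}. \<bar>y\<bar> \<le> K" unfolding bounded_real by blast
  then have K: "\<bar>deriv (deriv F) x\<bar> \<le> K" if "\<bar>x\<bar> \<le> a + b" for x using that by (auto simp: abs_le_iff)
  have "\<bar>F (s + t) - F s - t * deriv F s\<bar> \<le> max K 0 * t\<^sup>2" if st: "\<bar>s\<bar> \<le> a" "\<bar>t\<bar> \<le> b" for s t
  proof -
    let ?I = "{-\<bar>t\<bar>..\<bar>t\<bar>}"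
    have 1: "\<bar>deriv F (s + u) - deriv F s\<bar> \<le> max K 0 * \<bar>t\<bar>" if u: "u \<in> ?I" for u
    proof -
      have "norm (deriv F (s + u) - deriv F s) \<le> max K 0 * norm (s + u - s)"
      proof (rule field_differentiable_bound[where S="{-(a+b)..a+b}" and f'="deriv (deriv F)"])
        show "(deriv F has_field_derivative deriv (deriv F) z) (at z within {-(a+b)..a+b})" for z
          using F2(1) by (rule has_field_derivative_at_within)
        show "norm (deriv (deriv F) z) \<le> max K 0" if "z \<in> {-(a+b)..a+b}" for z
          using K[of z] that by (auto simp: abs_le_iff max.coboundedI1)
      qed (use st u in \<open>auto simp: abs_le_iff\<close>)
      also have "\<dots> \<le> max K 0 * \<bar>t\<bar>" using u by (intro mult_left_mono) auto
      finally show ?thesis by simp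
    qed
    let ?g = "\<lambda>u. F (s + u) - u * deriv F s"
    have "norm (?g t - ?g 0) \<le> max K 0 * \<bar>t\<bar> * norm (t - 0)"
    proof (rule field_differentiable_bound[where S="?I" and f'="\<lambda>u. deriv F (s + u) - deriv F s"])
      show "(?g has_field_derivative deriv F (s + u) - deriv F s) (at u within ?I)" for u
      proof -
        have "((\<lambda>u. F (u + s)) has_field_derivative deriv F (u + s)) (at u)"
          using F1(1)[of "u + s"] by (simp only: DERIV_shift)
        then have "((\<lambda>u. F (s + u)) has_field_derivative deriv F (s + u)) (at u)" by (simp only: add.commute)
        then have "(?g has_field_derivative deriv F (s + u) - 1 * deriv F s) (at u)"
          by (intro DERIV_diff DERIV_cmult_right DERIV_ident)
        then show ?thesis using has_field_derivative_at_within by simp blast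
      qed
    qed (use 1 in auto)
    then show ?thesis by (simp add: power2_eq_square mult.assoc)
  qed
  then show thesis by (intro that[of "max K 0"]) auto
qed

context riemannian begin

lemma mdifferential_add_cmult:
  assumes "f \<in> C_inf M" "g \<in> C_inf M" "\<kappa> \<in> atlas M" "p \<in> fst \<kappa>"
  shows "mdifferential (\<lambda>p. f p + a * g p) \<kappa> p = mdifferential f \<kappa> p + a *\<^sub>R mdifferential g \<kappa> p"
proof -
  have x: "snd \<kappa> p \<in> img \<kappa>" using assms(4) by blast
  note S = C_infD[OF assms(1,3)] C_infD[OF assms(2,3)] hopen_img[OF assms(3)]
  have "partial i ((\<lambda>p. f p + a * g p) \<circ> chart_inv \<kappa>) (snd \<kappa> p) =
      partial i (f \<circ> chart_inv \<kappa>) (snd \<kappa> p) + a * partial i (g \<circ> chart_inv \<kappa>) (snd \<kappa> p)" for i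
    using partial_add[OF S(1) smooth_on_mult[OF smooth_on_const S(2)] S(3) x, of i a] partial_cmult[OF S(2,3) x, of i a]
    by (simp add: comp_def)
  then show ?thesis by (simp add: mdifferential_def vec_eq_iff)
qed

lemma mdifferential_cong:
  assumes "\<And>p. p \<in> topspace (mspace M) \<Longrightarrow> f p = g p" "\<kappa> \<in> atlas M" "p \<in> fst \<kappa>"
  shows "mdifferential f \<kappa> p = mdifferential g \<kappa> p"
proof -
  have "partial i (f \<circ> chart_inv \<kappa>) (snd \<kappa> p) = partial i (g \<circ> chart_inv \<kappa>) (snd \<kappa> p)" for i
  proof (rule partial_cong[OF hopen_img[OF assms(2)]])
    show "snd \<kappa> p \<in> img \<kappa>" using assms(3) by blast
    fix y assume "y \<in> img \<kappa>"
    then have "chart_inv \<kappa> y \<in> topspace (mspace M)" using chart_inv_in domain_subset[OF assms(2)] by blast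
    then show "(f \<circ> chart_inv \<kappa>) y = (g \<circ> chart_inv \<kappa>) y" using assms(1) by simp
  qed
  then show ?thesis by (simp add: mdifferential_def)
qed

text \<open>
  Along the line through \<open>c\<close> in the direction \<open>h\<close> the gradient energy is a quadratic polynomial,
  and the potential energy has a quadratic remainder that is uniform on the manifold, since \<open>c\<close> and
  \<open>h\<close> are bounded.
\<close>

lemma differential_ginzburg_landau:
  assumes F: "smooth_on F UNIV" and c: "c \<in> C_inf M" and h: "h \<in> C_inf M"
  shows "differential (ginzburg_landau M \<alpha> F) c h =
    mint M (\<lambda>p. \<alpha> * ginner M (grad M h) (grad M c) p + deriv F (c p) * h p)"
proof -
  let ?g = "\<lambda>f g. ginner M (grad M f) (grad M g)"
  have gC: "mcont (?g f g)" if "f \<in> C_inf M" "g \<in> C_inf M" for f g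
    by (intro C_inf_mcont ginner_grad_C_inf grad_vector_field that)
  have ce: "(\<lambda>p. c p + \<epsilon> * h p) \<in> C_inf M" for \<epsilon> by (intro C_inf_add C_inf_mult C_inf_const c h)
  have FC: "mcont (\<lambda>p. F (c p + \<epsilon> * h p))" for \<epsilon> by (intro C_inf_mcont C_inf_compose[OF F ce])
  have F'C: "mcont (\<lambda>p. deriv F (c p) * h p)"
    by (intro mcont_mult C_inf_mcont C_inf_compose[OF smooth_real_deriv(2)[OF F]] c h)
  have quad: "?g (\<lambda>p. c p + \<epsilon> * h p) (\<lambda>p. c p + \<epsilon> * h p) p = ?g c c p + (2 * \<epsilon> * ?g h c p + \<epsilon>\<^sup>2 * ?g h h p)"
    if p: "p \<in> topspace (mspace M)" for p \<epsilon>
  proof -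
    note k = chart_at[OF p]
    have gr: "grad M (\<lambda>p. c p + \<epsilon> * h p) (chart_at M p) p = grad M c (chart_at M p) p + \<epsilon> *\<^sub>R grad M h (chart_at M p) p"
      by (simp add: grad_def mdifferential_add_cmult[OF c h k] matrix_vector_right_distrib matrix_vector_mult_scaleR)
    show ?thesis
      using spd_inner_commute[OF gram_spd[OF k], of "grad M c (chart_at M p) p" "grad M h (chart_at M p) p"]
      by (simp add: ginner_def Let_def gr matrix_vector_right_distrib matrix_vector_mult_scaleR inner_add_left inner_add_right
          algebra_simps power2_eq_square)
  qed
  have GL: "ginzburg_landau M \<alpha> F (\<lambda>p. c p + \<epsilon> * h p) =
      \<alpha> / 2 * (mint M (?g c c) + (2 * \<epsilon> * mint M (?g h c) + \<epsilon>\<^sup>2 * mint M (?g h h))) + mint M (\<lambda>p. F (c p + \<epsilon> * h p))" for \<epsilon>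
  proof -
    have "ginzburg_landau M \<alpha> F (\<lambda>p. c p + \<epsilon> * h p) =
        mint M (\<lambda>p. \<alpha> / 2 * (?g c c p + (2 * \<epsilon> * ?g h c p + \<epsilon>\<^sup>2 * ?g h h p)) + F (c p + \<epsilon> * h p))"
      unfolding ginzburg_landau_def by (rule mint_cong) (simp add: quad)
    also have "\<dots> = \<alpha> / 2 * (mint M (?g c c) + (2 * \<epsilon> * mint M (?g h c) + \<epsilon>\<^sup>2 * mint M (?g h h))) + mint M (\<lambda>p. F (c p + \<epsilon> * h p))"
      using gC[OF c c] gC[OF h c] gC[OF h h] FC
      by (simp only: mint_add mint_cmult mcont_add mcont_mult mcont_const)
    finally show ?thesis .
  qed
  have D: "((\<lambda>\<epsilon>. mint M (\<lambda>p. F (c p + \<epsilon> * h p))) has_real_derivative mint M (\<lambda>p. deriv F (c p) * h p)) (at 0)"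
  proof -
    obtain a b where ab: "\<And>p. p \<in> topspace (mspace M) \<Longrightarrow> \<bar>c p\<bar> \<le> a" "\<And>p. p \<in> topspace (mspace M) \<Longrightarrow> \<bar>h p\<bar> \<le> b" "0 \<le> b"
      using mcont_bounded[OF C_inf_mcont[OF c]] mcont_bounded[OF C_inf_mcont[OF h]] by metis
    obtain K where K: "0 \<le> K" "\<And>s t. \<bar>s\<bar> \<le> a \<Longrightarrow> \<bar>t\<bar> \<le> b \<Longrightarrow> \<bar>F (s + t) - F s - t * deriv F s\<bar> \<le> K * t\<^sup>2"
      using first_order_remainder[OF F] by blast
    show ?thesis
    proof (rule quadratic_error_derivative)
      fix \<epsilon> :: real assume \<epsilon>: "\<bar>\<epsilon>\<bar> \<le> 1"
      let ?r = "\<lambda>p. F (c p + \<epsilon> * h p) + ((- 1) * F (c p + 0 * h p) + (- \<epsilon>) * (deriv F (c p) * h p))"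
      have "mint M ?r = mint M (\<lambda>p. F (c p + \<epsilon> * h p)) + ((- 1) * mint M (\<lambda>p. F (c p + 0 * h p)) + (- \<epsilon>) * mint M (\<lambda>p. deriv F (c p) * h p))"
        using FC[of \<epsilon>] FC[of 0] F'C by (simp only: mint_add mint_cmult mcont_add mcont_mult mcont_const)
      moreover have "\<bar>mint M ?r\<bar> \<le> (K * (\<epsilon>\<^sup>2 * b\<^sup>2)) * mint M (\<lambda>p. 1)"
      proof (rule mint_abs_bound)
        show "mcont ?r" using FC[of \<epsilon>] FC[of 0] F'C by (intro mcont_add mcont_mult[OF mcont_const])
        fix p assume p: "p \<in> topspace (mspace M)"
        have "\<bar>\<epsilon> * h p\<bar> \<le> 1 * b" unfolding abs_mult using \<epsilon> ab(2)[OF p] by (intro mult_mono) auto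
        then have "\<bar>F (c p + \<epsilon> * h p) - F (c p) - \<epsilon> * h p * deriv F (c p)\<bar> \<le> K * (\<epsilon> * h p)\<^sup>2"
          using K(2)[OF ab(1)[OF p]] by simp
        also have "\<dots> \<le> K * (\<epsilon>\<^sup>2 * b\<^sup>2)"
          unfolding power_mult_distrib using ab(2,3) p K(1)
          by (intro mult_left_mono) (auto simp: abs_le_square_iff[symmetric])
        finally show "\<bar>?r p\<bar> \<le> K * (\<epsilon>\<^sup>2 * b\<^sup>2)" by (simp add: algebra_simps)
      qed
      ultimately show "\<bar>mint M (\<lambda>p. F (c p + \<epsilon> * h p)) - mint M (\<lambda>p. F (c p + 0 * h p)) - \<epsilon> * mint M (\<lambda>p. deriv F (c p) * h p)\<bar>
          \<le> (K * b\<^sup>2 * mint M (\<lambda>p. 1)) * \<epsilon>\<^sup>2"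
        by (simp add: algebra_simps)
    qed
  qed
  have "((\<lambda>\<epsilon>. ginzburg_landau M \<alpha> F (\<lambda>p. c p + \<epsilon> * h p)) has_real_derivative
      \<alpha> / 2 * (0 + (2 * 1 * mint M (?g h c) + 0)) + mint M (\<lambda>p. deriv F (c p) * h p)) (at 0)"
    unfolding GL by (rule derivative_eq_intros D refl | simp)+
  then have "differential (ginzburg_landau M \<alpha> F) c h = \<alpha> * mint M (?g h c) + mint M (\<lambda>p. deriv F (c p) * h p)"
    unfolding differential_def by (simp add: DERIV_imp_deriv)
  also have "\<dots> = mint M (\<lambda>p. \<alpha> * ?g h c p + deriv F (c p) * h p)"
    using gC[OF h c] F'C by (simp only: mint_add mint_cmult mcont_mult mcont_const)
  finally show ?thesis .
qed

lemma chem_potential_C_inf: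
  assumes "smooth_on F UNIV" "c \<in> C_inf M" shows "chem_potential M \<alpha> F c \<in> C_inf M"
proof -
  have "(\<lambda>p. - \<alpha> * mdiv M (grad M c) p + deriv F (c p)) \<in> C_inf M"
    by (intro C_inf_add C_inf_mult C_inf_const mdiv_C_inf grad_vector_field C_inf_compose[OF smooth_real_deriv(2)] assms)
  then show ?thesis by (simp add: chem_potential_def[abs_def] laplacian_def)
qed

text \<open>Integration by parts, with the boundary integral kept as the integral of a divergence.\<close>

lemma differential_by_parts:
  assumes F: "smooth_on F UNIV" and c: "c \<in> C_inf M" and h: "h \<in> C_inf M"
  shows "differential (ginzburg_landau M \<alpha> F) c h =
    \<alpha> * mint M (mdiv M (scale_field h (grad M c))) + mint M (\<lambda>p. h p * chem_potential M \<alpha> F c p)"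
proof -
  have g: "grad M c \<in> vector_fields M" by (rule grad_vector_field[OF c])
  have "differential (ginzburg_landau M \<alpha> F) c h =
      mint M (\<lambda>p. \<alpha> * mdiv M (scale_field h (grad M c)) p + h p * chem_potential M \<alpha> F c p)"
    unfolding differential_ginzburg_landau[OF F c h]
    by (rule mint_cong) (simp add: mdiv_scale[OF h g] chem_potential_def laplacian_def algebra_simps)
  also have "\<dots> = \<alpha> * mint M (mdiv M (scale_field h (grad M c))) + mint M (\<lambda>p. h p * chem_potential M \<alpha> F c p)"
    using C_inf_mcont[OF mdiv_C_inf[OF scale_field_vector_field[OF h g]]] C_inf_mcont[OF h]
      C_inf_mcont[OF chem_potential_C_inf[OF F c]]
    by (simp only: mint_add mint_cmult mcont_mult mcont_const)
  finally show ?thesis .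
qed

lemma differential_add_cmult:
  assumes F: "smooth_on F UNIV" and c: "c \<in> C_inf M" and h: "h \<in> C_inf M" and k: "k \<in> C_inf M"
    and eq: "\<And>p. p \<in> topspace (mspace M) \<Longrightarrow> f p = h p + \<epsilon> * k p"
  shows "differential (ginzburg_landau M \<alpha> F) c f =
    differential (ginzburg_landau M \<alpha> F) c h + \<epsilon> * differential (ginzburg_landau M \<alpha> F) c k"
proof -
  let ?L = "\<lambda>h p. \<alpha> * ginner M (grad M h) (grad M c) p + deriv F (c p) * h p"
  have hk: "(\<lambda>p. h p + \<epsilon> * k p) \<in> C_inf M" by (intro C_inf_add C_inf_mult C_inf_const h k)
  then have f: "f \<in> C_inf M" using C_inf_cong[of f "\<lambda>p. h p + \<epsilon> * k p"] eq by simp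
  have cont: "mcont (?L h)" if "h \<in> C_inf M" for h
    by (intro mcont_add mcont_mult mcont_const C_inf_mcont ginner_grad_C_inf grad_vector_field
        C_inf_compose[OF smooth_real_deriv(2)[OF F]] c that)
  have "differential (ginzburg_landau M \<alpha> F) c f = mint M (\<lambda>p. ?L h p + \<epsilon> * ?L k p)"
    unfolding differential_ginzburg_landau[OF F c f]
  proof (rule mint_cong)
    fix p assume p: "p \<in> topspace (mspace M)"
    note \<kappa> = chart_at[OF p]
    have "mdifferential f (chart_at M p) p = mdifferential h (chart_at M p) p + \<epsilon> *\<^sub>R mdifferential k (chart_at M p) p"
      using mdifferential_cong[OF eq \<kappa>] mdifferential_add_cmult[OF h k \<kappa>, of \<epsilon>] by simp
    then show "?L f p = ?L h p + \<epsilon> * ?L k p"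
      using eq[OF p] by (simp add: ginner_grad[OF _ grad_vector_field[OF c] \<kappa>] f h k inner_add_left algebra_simps)
  qed
  also have "\<dots> = mint M (?L h) + \<epsilon> * mint M (?L k)"
    using cont[OF h] cont[OF k] by (subst mint_add) (auto intro!: mcont_mult mcont_const simp: mint_cmult)
  finally show ?thesis by (simp add: differential_ginzburg_landau[OF F c] h k)
qed

subsection \<open>Tangency at the boundary\<close>

lemma mdiv_cmult:
  assumes w: "w \<in> vector_fields M" and p: "p \<in> topspace (mspace M)"
  shows "mdiv M (scale_field (\<lambda>p. a) w) p = a * mdiv M w p"
proof -
  have "mdifferential (\<lambda>p. a) (chart_at M p) p = 0"
    using img_halfspace[OF chart_at(1)[OF p]] chart_at(2)[OF p] by (auto simp: mdifferential_def comp_def vec_eq_iff)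
  then show ?thesis
    using mdiv_scale[OF C_inf_const w p, of a] ginner_grad[OF C_inf_const w chart_at[OF p], of a] by simp
qed

text \<open>
  If the normal component were positive at a boundary point, a bump around it would give a negative
  integral; if it were negative, the same applies to the opposite field.
\<close>

lemma weakly_tangent:
  assumes X: "X \<in> vector_fields M"
    and test: "\<And>\<kappa> x r. admissible \<kappa> x r \<Longrightarrow> mint M (mdiv M (scale_field (lift_fun \<kappa> (bump x r)) X)) = 0"
    and p: "\<kappa> \<in> atlas M" "p \<in> fst \<kappa>" "snd \<kappa> p $ bdir = 0"
  shows "X \<kappa> p $ bdir = 0"
proof -
  have not_pos: "\<not> 0 < Y \<kappa> p $ bdir"
    if Y: "Y \<in> vector_fields M" and zero: "\<And>x r. admissible \<kappa> x r \<Longrightarrow> mint M (mdiv M (scale_field (lift_fun \<kappa> (bump x r)) Y)) = 0" for Y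
  proof
    assume pos: "0 < Y \<kappa> p $ bdir"
    let ?y = "\<lambda>x. (Y \<kappa> \<circ> chart_inv \<kappa>) x $ bdir"
    have x: "snd \<kappa> p \<in> img \<kappa>" using p(2) by blast
    have "continuous_on (img \<kappa>) ?y"
      by (intro smooth_on_imp_continuous_on smooth_on_vec_nth vector_fieldD(1) Y p(1))
    moreover have "0 < ?y (snd \<kappa> p)" using pos by (simp add: chart_inv_snd[OF p(1,2)])
    ultimately obtain e where e: "0 < e" "\<And>y. y \<in> img \<kappa> \<Longrightarrow> dist y (snd \<kappa> p) < e \<Longrightarrow> dist (?y y) (?y (snd \<kappa> p)) < ?y (snd \<kappa> p)"
      using x unfolding continuous_on_iff by metis
    obtain d where d: "0 < d" "cball (snd \<kappa> p) d \<inter> halfspace \<subseteq> img \<kappa>"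
      using cball_in_hopen[OF hopen_img[OF p(1)] x] by blast
    define r where "r = min d e"
    have r: "0 < r" "r \<le> e" "cball (snd \<kappa> p) r \<inter> halfspace \<subseteq> img \<kappa>" using d e(1) by (auto simp: r_def)
    have adm: "admissible \<kappa> (snd \<kappa> p) r" using r p(1) by (simp add: admissible_def)
    define \<phi> where "\<phi> = lift_fun \<kappa> (bump (snd \<kappa> p) r)"
    define S where "S = chart_inv \<kappa> ` (cball (snd \<kappa> p) r \<inter> halfspace)"
    have \<phi>: "\<phi> \<in> C_inf M" unfolding \<phi>_def by (rule lift_bump_C_inf[OF p(1) r(1,3)])
    have S: "compactin (mspace M) S" "S \<subseteq> fst \<kappa>"
      unfolding S_def by (rule compactin_chart_inv[OF p(1) compact_cball_halfspace r(3)])+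
    have \<phi>0: "\<phi> q = 0" if "q \<notin> S" for q
      unfolding \<phi>_def
      by (rule lift_fun_zero[OF p(1) _ that[unfolded S_def]]) (use img_halfspace[OF p(1)] bump_zero_off[OF r(1)] in blast)
    have "mint M (mdiv M (scale_field \<phi> Y)) < 0"
    proof (rule integral_mdiv_negative[OF p(1) scale_field_vector_field[OF \<phi> Y] S _ _ p(2,3)])
      show "scale_field \<phi> Y \<kappa>' q = 0" if "q \<notin> S" for \<kappa>' q using \<phi>0[OF that] by (simp add: scale_field_def)
      show "0 < scale_field \<phi> Y \<kappa> p $ bdir"
        using pos r(1) p(2) by (simp add: scale_field_def \<phi>_def lift_fun_def bump_pos_iff)
      show "0 \<le> scale_field \<phi> Y \<kappa> q $ bdir" if q: "q \<in> fst \<kappa>" for q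
      proof (cases "dist (snd \<kappa> p) (snd \<kappa> q) < r")
        case True
        then have "dist (?y (snd \<kappa> q)) (?y (snd \<kappa> p)) < ?y (snd \<kappa> p)" using q r(2) by (intro e(2)) (auto simp: dist_commute)
        then have "0 \<le> ?y (snd \<kappa> q)" unfolding dist_real_def by linarith
        then show ?thesis using q by (simp add: scale_field_def \<phi>_def lift_fun_def bump_nonneg chart_inv_snd[OF p(1)])
      next
        case False
        then show ?thesis using q r(1) by (simp add: scale_field_def \<phi>_def lift_fun_def bump_zero)
      qed
    qed
    then show False using zero[OF adm] by (simp add: \<phi>_def)
  qed
  let ?m = "scale_field (\<lambda>p. - 1) X"
  have "\<not> 0 < ?m \<kappa> p $ bdir"
  proof (rule not_pos[OF scale_field_vector_field[OF C_inf_const X]])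
    fix x r assume adm: "admissible \<kappa> x r"
    let ?\<phi> = "lift_fun \<kappa> (bump x r)"
    have \<phi>: "?\<phi> \<in> C_inf M" using adm by (auto simp: admissible_def intro: lift_bump_C_inf)
    have "scale_field ?\<phi> ?m = scale_field (\<lambda>p. - 1) (scale_field ?\<phi> X)" by (auto simp: scale_field_def fun_eq_iff)
    moreover have "mint M (mdiv M (scale_field (\<lambda>p. - 1) (scale_field ?\<phi> X))) = mint M (\<lambda>p. - 1 * mdiv M (scale_field ?\<phi> X) p)"
    proof (rule mint_cong)
      fix q assume q: "q \<in> topspace (mspace M)"
      show "mdiv M (scale_field (\<lambda>p. - 1) (scale_field ?\<phi> X)) q = - 1 * mdiv M (scale_field ?\<phi> X) q"
        by (rule mdiv_cmult[OF scale_field_vector_field[OF \<phi> X] q])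
    qed
    ultimately show "mint M (mdiv M (scale_field ?\<phi> ?m)) = 0" using test[OF adm] by (simp only: mint_cmult mult_zero_right)
  qed
  moreover have "\<not> 0 < X \<kappa> p $ bdir" using X test by (rule not_pos)
  ultimately show ?thesis by (simp add: scale_field_def)
qed

section \<open>Minimisers of the Rayleighian\<close>

text \<open>
  The velocity is determined by the process variable on the manifold only, not off it.
\<close>

lemma has_curve_derivative_cong:
  assumes d: "has_curve_derivative M c d t I" and eq: "\<And>p. p \<in> topspace (mspace M) \<Longrightarrow> d p = d' p"
  shows "has_curve_derivative M c d' t I"
  unfolding has_curve_derivative_def
proof (intro conjI ballI allI impI)
  show "d' \<in> C_inf M" using d C_inf_cong[of d d'] eq by (simp add: has_curve_derivative_def)
  fix \<kappa> S "is" assume \<kappa>: "\<kappa> \<in> atlas M" and S: "compactin (mspace M) S \<and> S \<subseteq> fst \<kappa>"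
  have ul: "uniform_limit S (\<lambda>s p. partials is ((\<lambda>q. (c s q - c t q) / (s - t)) \<circ> chart_inv \<kappa>) (snd \<kappa> p))
      (\<lambda>p. partials is (d \<circ> chart_inv \<kappa>) (snd \<kappa> p)) (at t within I)"
    using d \<kappa> S unfolding has_curve_derivative_def by blast
  have "partials is (d' \<circ> chart_inv \<kappa>) (snd \<kappa> p) = partials is (d \<circ> chart_inv \<kappa>) (snd \<kappa> p)" if "p \<in> S" for p
  proof (rule partials_cong[OF hopen_img[OF \<kappa>]])
    show "snd \<kappa> p \<in> img \<kappa>" using that S by blast
    fix y assume "y \<in> img \<kappa>"
    then have "chart_inv \<kappa> y \<in> topspace (mspace M)" using chart_inv_in domain_subset[OF \<kappa>] by blast
    then show "(d' \<circ> chart_inv \<kappa>) y = (d \<circ> chart_inv \<kappa>) y" using eq by simp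
  qed
  then show "uniform_limit S (\<lambda>s p. partials is ((\<lambda>q. (c s q - c t q) / (s - t)) \<circ> chart_inv \<kappa>) (snd \<kappa> p))
      (\<lambda>p. partials is (d' \<circ> chart_inv \<kappa>) (snd \<kappa> p)) (at t within I)"
    using ul unfolding uniform_limit_iff by (simp cong: ball_cong)
qed

lemma integral_mdiv_scale_zero:
  assumes \<kappa>: "\<kappa> \<in> atlas M" and S: "compactin (mspace M) S" "S \<subseteq> fst \<kappa>"
    and \<phi>: "\<phi> \<in> C_inf M" "\<And>q. q \<in> topspace (mspace M) \<Longrightarrow> q \<notin> S \<Longrightarrow> \<phi> q = 0" 
    and bd: "\<And>q. q \<in> fst \<kappa> \<Longrightarrow> snd \<kappa> q $ bdir = 0 \<Longrightarrow> \<phi> q = 0" and X: "X \<in> vector_fields M"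
  shows "mint M (mdiv M (scale_field \<phi> X)) = 0"
proof (rule integral_mdiv_zero[OF \<kappa> scale_field_vector_field[OF \<phi>(1) X] S])
  show "scale_field \<phi> X \<kappa>' q = 0" if "\<kappa>' \<in> atlas M" "q \<in> fst \<kappa>'" "q \<notin> S" for \<kappa>' q
    using \<phi>(2)[of q] that domain_subset[of \<kappa>'] by (auto simp: scale_field_def)
  show "scale_field \<phi> X \<kappa> q $ bdir = 0" if "q \<in> fst \<kappa>" "snd \<kappa> q $ bdir = 0" for q
    using bd[OF that] by (simp add: scale_field_def)
qed

subsection \<open>Allen--Cahn\<close>

lemma allen_cahn_first_variation:
  assumes F: "smooth_on F UNIV" and c: "c \<in> C_inf M" and v: "v \<in> C_inf M"
    and min: "\<And>w. w \<in> C_inf M \<Longrightarrow>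
      rayleighian (ginzburg_landau M \<alpha> F) (AC_dissipation M) (\<lambda>_ w. w) c v
        \<le> rayleighian (ginzburg_landau M \<alpha> F) (AC_dissipation M) (\<lambda>_ w. w) c w"
    and h: "h \<in> C_inf M"
  shows "\<alpha> * mint M (mdiv M (scale_field h (grad M c))) + mint M (\<lambda>p. h p * (chem_potential M \<alpha> F c p + v p)) = 0"
proof -
  let ?d = "differential (ginzburg_landau M \<alpha> F) c"
  let ?g = "\<lambda>p. chem_potential M \<alpha> F c p + v p"
  note \<mu> = chem_potential_C_inf[OF F c, of \<alpha>]
  note cont = C_inf_mcont[OF h] C_inf_mcont[OF v] C_inf_mcont[OF \<mu>]
  have "0 \<le> \<epsilon> * (?d h + mint M (\<lambda>p. h p * v p)) + \<epsilon>\<^sup>2 * (1 / 2 * mint M (\<lambda>p. h p * h p))" for \<epsilon>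
  proof -
    let ?w = "\<lambda>p. v p + \<epsilon> * h p"
    have "?w \<in> C_inf M" by (intro C_inf_add C_inf_mult C_inf_const h v)
    from min[OF this] have "?d v + 1 / 2 * mint M (\<lambda>p. (v p)\<^sup>2) \<le> ?d ?w + 1 / 2 * mint M (\<lambda>p. (?w p)\<^sup>2)"
      by (simp add: rayleighian_def AC_dissipation_def)
    moreover have "?d ?w = ?d v + \<epsilon> * ?d h" by (rule differential_add_cmult[OF F c v h]) simp
    moreover have "mint M (\<lambda>p. (?w p)\<^sup>2) =
        mint M (\<lambda>p. v p * v p) + (2 * \<epsilon> * mint M (\<lambda>p. h p * v p) + \<epsilon>\<^sup>2 * mint M (\<lambda>p. h p * h p))"
    proof -
      have "mint M (\<lambda>p. (?w p)\<^sup>2) = mint M (\<lambda>p. v p * v p + (2 * \<epsilon> * (h p * v p) + \<epsilon>\<^sup>2 * (h p * h p)))"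
        by (rule mint_cong) (simp add: power2_eq_square algebra_simps)
      then show ?thesis using cont by (simp only: mint_add mint_cmult mcont_add mcont_mult mcont_const)
    qed
    ultimately show ?thesis by (simp add: power2_eq_square algebra_simps)
  qed
  then have "?d h + mint M (\<lambda>p. h p * v p) = 0" by (rule quadratic_nonneg_linear_zero)
  moreover have "mint M (\<lambda>p. h p * ?g p) = mint M (\<lambda>p. h p * chem_potential M \<alpha> F c p) + mint M (\<lambda>p. h p * v p)"
    using cont by (simp only: distrib_left mint_add mcont_mult)
  ultimately show ?thesis using differential_by_parts[OF F c h, of \<alpha>] by linarith
qed

text \<open>
  Interior bumps see only the second integral of the first variation. Once its integrand vanishes, the
  first integral is left, now for all bumps.
\<close>

lemma allen_cahn_stationary:
  assumes \<alpha>: "0 < \<alpha>" and F: "smooth_on F UNIV" and c: "c \<in> C_inf M" and v: "v \<in> C_inf M"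
    and min: "\<And>w. w \<in> C_inf M \<Longrightarrow>
      rayleighian (ginzburg_landau M \<alpha> F) (AC_dissipation M) (\<lambda>_ w. w) c v
        \<le> rayleighian (ginzburg_landau M \<alpha> F) (AC_dissipation M) (\<lambda>_ w. w) c w"
  shows "\<And>p. p \<in> topspace (mspace M) \<Longrightarrow> v p = \<alpha> * laplacian M c p - deriv F (c p)"
    and "\<And>p. p \<in> mboundary M \<Longrightarrow> normal_deriv M c p = 0"
proof -
  let ?g = "\<lambda>p. chem_potential M \<alpha> F c p + v p"
  note \<mu> = chem_potential_C_inf[OF F c, of \<alpha>]
  have g: "?g \<in> C_inf M" by (intro C_inf_add \<mu> v)
  have grad: "grad M c \<in> vector_fields M" by (rule grad_vector_field[OF c])
  have var: "\<alpha> * mint M (mdiv M (scale_field h (grad M c))) + mint M (\<lambda>p. h p * ?g p) = 0" if "h \<in> C_inf M" for h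
    by (rule allen_cahn_first_variation[OF F c v _ that]) (rule min)
  have g0: "?g p = 0" if p: "p \<in> topspace (mspace M)" for p
  proof (rule weak_zero[OF chart_at(1)[OF p] openin_domain[OF chart_at(1)[OF p]] subset_refl _ _ chart_at(2)[OF p]])
    let ?\<kappa> = "chart_at M p"
    show "continuous_on (img ?\<kappa>) (?g \<circ> chart_inv ?\<kappa>)"
      using C_inf_mcont[OF g] chart_at(1)[OF p] unfolding mcont_def by blast
    fix x r assume adm: "admissible ?\<kappa> x r" and int: "\<And>y. y \<in> cball x r \<Longrightarrow> 0 < y $ bdir"
    let ?\<phi> = "lift_fun ?\<kappa> (bump x r)"
    note \<phi> = admissible_bump_C_inf[OF adm]
    have r: "0 < r" using adm by (simp add: admissible_def)
    have "mint M (mdiv M (scale_field ?\<phi> (grad M c))) = 0"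
    proof (rule bump_supported[OF adm])
      fix S assume S: "compactin (mspace M) S" "S \<subseteq> fst ?\<kappa>" and sS: "snd ?\<kappa> ` S = cball x r \<inter> halfspace"
        and s: "\<And>g q. (\<And>y. y \<in> halfspace \<Longrightarrow> y \<notin> cball x r \<Longrightarrow> g y = 0) \<Longrightarrow> q \<notin> S \<Longrightarrow> lift_fun ?\<kappa> g q = 0"
      have \<phi>0: "?\<phi> q = 0" if "q \<notin> S" for q by (rule s[OF _ that]) (use r in \<open>auto intro: bump_zero\<close>)
      show ?thesis
      proof (rule integral_mdiv_scale_zero[OF chart_at(1)[OF p] S \<phi> \<phi>0 _ grad])
        show "?\<phi> q = 0" if "q \<in> fst ?\<kappa>" "snd ?\<kappa> q $ bdir = 0" for q
          by (rule \<phi>0) (use sS int[of "snd ?\<kappa> q"] that(2) in force)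
      qed
    qed
    then have "mint M (\<lambda>q. ?\<phi> q * ?g q) = 0" using var[OF \<phi>] by simp
    then show "\<exists>f. mcont f \<and> mint M f = 0 \<and> (\<forall>q\<in>topspace (mspace M). f q = ?\<phi> q * ?g q)"
      using C_inf_mcont[OF C_inf_mult[OF \<phi> g]] by (intro exI[of _ "\<lambda>q. ?\<phi> q * ?g q"]) simp
  qed
  then show "v p = \<alpha> * laplacian M c p - deriv F (c p)" if "p \<in> topspace (mspace M)" for p
    using g0[OF that] by (simp add: chem_potential_def)
  show "normal_deriv M c p = 0" if p: "p \<in> mboundary M" for p
  proof -
    have pt: "p \<in> topspace (mspace M)" by (rule mboundary_topspace[OF p])
    have "grad M c (chart_at M p) p $ bdir = 0"
    proof (rule weakly_tangent[OF grad _ chart_at[OF pt] mboundary_coordinate[OF p chart_at[OF pt]]])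
      fix \<kappa> x r assume adm: "admissible \<kappa> x r"
      let ?\<phi> = "lift_fun \<kappa> (bump x r)"
      have "mint M (\<lambda>p. ?\<phi> p * ?g p) = 0" by (rule mint_zero) (simp add: g0)
      then show "mint M (mdiv M (scale_field ?\<phi> (grad M c))) = 0"
        using var[OF admissible_bump_C_inf[OF adm]] \<alpha> by simp
    qed
    then show ?thesis unfolding normal_deriv_def ginner_normal[OF pt] .
  qed
qed

subsection \<open>Cahn--Hilliard\<close>

text \<open>
  The polarisation of \<open>inv_mobility_sqnorm\<close>.
\<close>

definition inv_pair :: "('m, 'n) mfield \<Rightarrow> ('m, 'n) vfield \<Rightarrow> ('m, 'n) vfield \<Rightarrow> 'm \<Rightarrow> real" where
  "inv_pair B u w p = (let \<kappa> = chart_at M p in u \<kappa> p \<bullet> (matrix_inv (B \<kappa> p) *v w \<kappa> p))"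

context
  fixes B assumes B: "mobility_field M B"
begin

lemma mobility_spd: "\<kappa> \<in> atlas M \<Longrightarrow> p \<in> fst \<kappa> \<Longrightarrow> spd (B \<kappa> p)"
  using B unfolding mobility_field_def by blast

lemma smooth_mobility: "\<kappa> \<in> atlas M \<Longrightarrow> smooth_on (B \<kappa> \<circ> chart_inv \<kappa>) (img \<kappa>)"
  using B unfolding mobility_field_def smooth_components_def by blast

lemma mobility_transform:
  "\<kappa> \<in> atlas M \<Longrightarrow> \<kappa>' \<in> atlas M \<Longrightarrow> p \<in> fst \<kappa> \<inter> fst \<kappa>' \<Longrightarrow>
    B \<kappa>' p = transition_jac \<kappa> \<kappa>' p ** B \<kappa> p ** transpose (transition_jac \<kappa> \<kappa>' p)"
  using B unfolding mobility_field_def by blast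

lemma inv_pair_chart:
  assumes u: "u \<in> vector_fields M" and w: "w \<in> vector_fields M" and \<kappa>': "\<kappa>' \<in> atlas M" and p': "p \<in> fst \<kappa>'"
  shows "inv_pair B u w p = u \<kappa>' p \<bullet> (matrix_inv (B \<kappa>' p) *v w \<kappa>' p)"
proof -
  have pt: "p \<in> topspace (mspace M)" using domain_subset[OF \<kappa>'] p' by blast
  let ?\<kappa> = "chart_at M p"
  note \<kappa> = chart_at(1)[OF pt]
  have p: "p \<in> fst ?\<kappa> \<inter> fst \<kappa>'" using chart_at(2)[OF pt] p' by simp
  let ?J = "transition_jac ?\<kappa> \<kappa>' p"
  let ?y = "matrix_inv (B ?\<kappa> p) *v w ?\<kappa> p"
  have JT: "invertible (transpose ?J)" by (rule transpose_invertible[OF jac_invertible[OF \<kappa> \<kappa>' p]])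
  let ?z = "matrix_inv (transpose ?J) *v ?y"
  have Jz: "transpose ?J *v ?z = ?y" by (rule matrix_inv_cancel(1)[OF JT])
  have "B \<kappa>' p *v ?z = ?J *v (B ?\<kappa> p *v (transpose ?J *v ?z))"
    unfolding mobility_transform[OF \<kappa> \<kappa>' p] by (simp only: matrix_vector_mul_assoc matrix_mul_assoc)
  also have "\<dots> = ?J *v w ?\<kappa> p"
    unfolding Jz using matrix_inv_cancel(1)[OF spd_invertible[OF mobility_spd[OF \<kappa>]]] p by simp
  also have "\<dots> = w \<kappa>' p" using vector_fieldD(2)[OF w \<kappa> \<kappa>' p] by simp
  finally have "matrix_inv (B \<kappa>' p) *v w \<kappa>' p = ?z"
    by (rule matrix_inv_eqI[OF spd_invertible[OF mobility_spd[OF \<kappa>' p']]])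
  then have "u \<kappa>' p \<bullet> (matrix_inv (B \<kappa>' p) *v w \<kappa>' p) = (?J *v u ?\<kappa> p) \<bullet> ?z"
    using vector_fieldD(2)[OF u \<kappa> \<kappa>' p] by simp
  also have "\<dots> = u ?\<kappa> p \<bullet> (transpose ?J *v ?z)"
    using inner_transpose[of ?J ?z "u ?\<kappa> p"] by (simp only: inner_commute)
  finally show ?thesis unfolding Jz by (simp add: inv_pair_def Let_def)
qed

lemma inv_pair_commute: "p \<in> topspace (mspace M) \<Longrightarrow> inv_pair B u w p = inv_pair B w u p"
  unfolding inv_pair_def Let_def by (rule spd_inv_inner_commute[OF mobility_spd[OF chart_at]])

lemma smooth_inv_mobility:
  assumes w: "w \<in> vector_fields M" and \<kappa>: "\<kappa> \<in> atlas M"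
  shows "smooth_on (\<lambda>x. matrix_inv ((B \<kappa> \<circ> chart_inv \<kappa>) x) *v (w \<kappa> \<circ> chart_inv \<kappa>) x) (img \<kappa>)"
  using spd_det_pos[OF mobility_spd[OF \<kappa> chart_inv_in]]
  by (intro smooth_on_matrix_inv smooth_mobility vector_fieldD(1) w \<kappa>) auto

lemma inv_pair_C_inf:
  assumes u: "u \<in> vector_fields M" and w: "w \<in> vector_fields M"
  shows "inv_pair B u w \<in> C_inf M"
proof (rule C_infI)
  fix \<kappa> assume \<kappa>: "\<kappa> \<in> atlas M"
  have "smooth_on (\<lambda>x. (u \<kappa> \<circ> chart_inv \<kappa>) x \<bullet> (matrix_inv ((B \<kappa> \<circ> chart_inv \<kappa>) x) *v (w \<kappa> \<circ> chart_inv \<kappa>) x)) (img \<kappa>)"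
    by (intro smooth_on_bilinear[OF bounded_bilinear_inner] vector_fieldD(1) smooth_inv_mobility u w \<kappa>)
  then show "smooth_on (inv_pair B u w \<circ> chart_inv \<kappa>) (img \<kappa>)"
    by (rule smooth_on_transform) (simp add: inv_pair_chart[OF u w \<kappa> chart_inv_in])
qed

end

lemma process_space_boundary:
  "w \<in> CH_process_space M c \<longleftrightarrow> w \<in> vector_fields M \<and> (\<forall>p\<in>mboundary M. w (chart_at M p) p $ bdir = 0)"
  unfolding CH_process_space_def using ginner_normal mboundary_topspace by blast

text \<open>
  Tangency to the boundary may be checked in the chart where the field is given, because the Jacobians
  of transition maps preserve tangent vectors.
\<close>

lemma lift_field_process_space:
  assumes \<kappa>: "\<kappa> \<in> atlas M" and X: "lift_field \<kappa> X \<in> vector_fields M"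
    and bd: "\<And>y. y \<in> img \<kappa> \<Longrightarrow> y $ bdir = 0 \<Longrightarrow> X y $ bdir = 0"
  shows "lift_field \<kappa> X \<in> CH_process_space M c"
  unfolding process_space_boundary
proof (intro conjI ballI X)
  fix p assume p: "p \<in> mboundary M"
  note \<kappa>' = chart_at[OF mboundary_topspace[OF p]]
  show "lift_field \<kappa> X (chart_at M p) p $ bdir = 0"
  proof (cases "p \<in> fst \<kappa>")
    case True
    have b: "snd \<kappa> p $ bdir = 0" by (rule mboundary_coordinate[OF p \<kappa> True])
    have "X (snd \<kappa> p) $ bdir = 0" using True b by (intro bd) auto
    then show ?thesis
      using boundary_tangent[OF \<kappa> \<kappa>'(1) _ b, of "X (snd \<kappa> p)"] True \<kappa>'(2) by (simp add: lift_field_def)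
  qed (simp add: lift_field_def)
qed

lemma process_space_chart:
  assumes w: "w \<in> CH_process_space M c" and \<kappa>: "\<kappa> \<in> atlas M" and p: "p \<in> fst \<kappa>" and b: "snd \<kappa> p $ bdir = 0"
  shows "w \<kappa> p $ bdir = 0"
proof -
  have pb: "p \<in> mboundary M" unfolding mboundary_def using \<kappa> p b by blast
  note \<kappa>' = chart_at[OF mboundary_topspace[OF pb]]
  have w': "w \<in> vector_fields M" "w (chart_at M p) p $ bdir = 0" using w pb by (auto simp: process_space_boundary)
  have p': "p \<in> fst (chart_at M p) \<inter> fst \<kappa>" using p \<kappa>'(2) by simp
  show ?thesis
    unfolding vector_fieldD(2)[OF w'(1) \<kappa>'(1) \<kappa> p']
    by (rule boundary_tangent[OF \<kappa>'(1) \<kappa> p' mboundary_coordinate[OF pb \<kappa>'] w'(2)])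
qed

definition axis_field :: "('n vect \<Rightarrow> real) \<Rightarrow> 'n \<Rightarrow> 'n vect \<Rightarrow> 'n vect" where
  "axis_field \<beta> i y = \<beta> y *\<^sub>R axis i 1"

lemma axis_field_process_space:
  assumes adm: "admissible \<kappa> x r" and \<beta>: "smooth_on \<beta> UNIV" "\<And>y. y \<notin> cball x r \<Longrightarrow> \<beta> y = 0"
    and bd: "\<And>y. y $ bdir = 0 \<Longrightarrow> i = bdir \<Longrightarrow> \<beta> y = 0"
  shows "lift_field \<kappa> (axis_field \<beta> i) \<in> CH_process_space M c"
proof (rule lift_field_process_space)
  show \<kappa>: "\<kappa> \<in> atlas M" using adm by (simp add: admissible_def)
  have "smooth_on (axis_field \<beta> i) (img \<kappa>)"
    unfolding axis_field_def[abs_def]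
    by (intro smooth_on_bilinear[OF bounded_bilinear_scaleR] smooth_on_const smooth_on_subset[OF \<beta>(1)]) auto
  moreover have "cball x r \<inter> halfspace \<subseteq> img \<kappa>" using adm by (simp add: admissible_def)
  ultimately show "lift_field \<kappa> (axis_field \<beta> i) \<in> vector_fields M"
    using img_halfspace[OF \<kappa>]
    by (intro lift_field_vector_field[OF \<kappa> _ compact_cball_halfspace]) (auto simp: axis_field_def \<beta>(2))
  show "axis_field \<beta> i y $ bdir = 0" if "y $ bdir = 0" for y
    using bd[OF that] by (simp add: axis_field_def axis_def)
qed

lemma partial_bdir_coordinate:
  fixes x :: "'n vect" shows "x \<in> halfspace \<Longrightarrow> partial bdir (\<lambda>x. x $ bdir) x = 1"
proof -
  assume x: "x \<in> halfspace"
  have "((\<lambda>x::'n vect. x $ bdir) has_derivative (\<lambda>x. x $ bdir)) (at x within halfspace)"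
    by (rule bounded_linear_imp_has_derivative[OF bounded_linear_vec_nth])
  from partial_eqI[OF this x] show ?thesis by simp
qed

text \<open>
  The field with first component \<open>x_1 * bump\<close> is tangent to the boundary, but its divergence
  is the bump there. This produces arbitrary boundary values of the divergence.
\<close>

lemma mdiv_boundary_bump:
  assumes adm: "admissible \<kappa> x r" and p: "p \<in> fst \<kappa>" "snd \<kappa> p $ bdir = 0"
    and vf: "lift_field \<kappa> (axis_field (\<lambda>y. y $ bdir * bump x r y) bdir) \<in> vector_fields M"
  shows "mdiv M (lift_field \<kappa> (axis_field (\<lambda>y. y $ bdir * bump x r y) bdir)) p = lift_fun \<kappa> (bump x r) p"
proof -
  let ?w = "lift_field \<kappa> (axis_field (\<lambda>y. y $ bdir * bump x r y) bdir)"
  have \<kappa>: "\<kappa> \<in> atlas M" using adm by (simp add: admissible_def)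
  have y: "snd \<kappa> p \<in> img \<kappa>" using p(1) by blast
  then have yH: "snd \<kappa> p \<in> halfspace" using img_halfspace[OF \<kappa>] by blast
  let ?V = "vol_density M \<kappa> \<circ> chart_inv \<kappa>"
  let ?g = "\<lambda>y. ?V y * bump x r y"
  have V: "smooth_on ?g (img \<kappa>)" by (intro smooth_on_mult smooth_vol_density[OF \<kappa>] smooth_bump)
  have c: "smooth_on (\<lambda>y::'n vect. y $ bdir) (img \<kappa>)" by (intro smooth_on_linear bounded_linear_vec_nth)
  have "partial i (flux \<kappa> ?w i) (snd \<kappa> p) = (if i = bdir then ?g (snd \<kappa> p) else 0)" for i
  proof (cases "i = bdir")
    case True
    have "partial bdir (flux \<kappa> ?w bdir) (snd \<kappa> p) = partial bdir (\<lambda>y. y $ bdir * ?g y) (snd \<kappa> p)"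
      by (rule partial_cong[OF hopen_img[OF \<kappa>] y])
        (auto simp: flux_def lift_field_chart[OF \<kappa>] axis_field_def chart_inv_snd[OF \<kappa>])
    also have "\<dots> = ?g (snd \<kappa> p)"
      unfolding partial_mult[OF c V hopen_img[OF \<kappa>] y] partial_bdir_coordinate[OF yH] p(2) by simp
    finally show ?thesis using True by simp
  next
    case False
    have "partial i (flux \<kappa> ?w i) (snd \<kappa> p) = partial i (\<lambda>y. 0) (snd \<kappa> p)"
      by (rule partial_cong[OF hopen_img[OF \<kappa>] y])
        (use False in \<open>auto simp: flux_def lift_field_chart[OF \<kappa>] axis_field_def axis_def chart_inv_snd[OF \<kappa>]\<close>)
    then show ?thesis using False yH by simp
  qed
  then have "chart_div \<kappa> ?w p = ?g (snd \<kappa> p) / vol_density M \<kappa> p" by (simp add: chart_div_def)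
  also have "\<dots> = bump x r (snd \<kappa> p)" using vol_density_pos[OF \<kappa> p(1)] by (simp add: chart_inv_snd[OF \<kappa> p(1)])
  finally show ?thesis using p(1) by (simp add: mdiv_chart[OF vf \<kappa> p(1)] lift_fun_def)
qed

lemma cahn_hilliard_first_variation:
  assumes F: "smooth_on F UNIV" and B: "mobility_field M B" and c: "c \<in> C_inf M"
    and v: "v \<in> CH_process_space M c"
    and min: "\<And>w. w \<in> CH_process_space M c \<Longrightarrow>
      rayleighian (ginzburg_landau M \<alpha> F) (CH_dissipation M B) (\<lambda>_ w p. - mdiv M w p) c v
        \<le> rayleighian (ginzburg_landau M \<alpha> F) (CH_dissipation M B) (\<lambda>_ w p. - mdiv M w p) c w"
    and w: "w \<in> CH_process_space M c"
  shows "\<alpha> * mint M (mdiv M (scale_field (\<lambda>p. - mdiv M w p) (grad M c))) +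
    mint M (\<lambda>p. - mdiv M w p * chem_potential M \<alpha> F c p) + mint M (inv_pair B w v) = 0"
proof -
  let ?d = "differential (ginzburg_landau M \<alpha> F) c"
  have vf: "w \<in> vector_fields M" if "w \<in> CH_process_space M c" for w using that by (simp add: CH_process_space_def)
  note v' = vf[OF v] and w' = vf[OF w]
  have hC: "(\<lambda>p. - mdiv M w p) \<in> C_inf M" if "w \<in> vector_fields M" for w
    using C_inf_mult[OF C_inf_const mdiv_C_inf[OF that], of "- 1"] by simp
  note cont = C_inf_mcont[OF inv_pair_C_inf[OF B v' v']] C_inf_mcont[OF inv_pair_C_inf[OF B w' v']]
    C_inf_mcont[OF inv_pair_C_inf[OF B w' w']]
  have "0 \<le> \<epsilon> * (?d (\<lambda>p. - mdiv M w p) + mint M (inv_pair B w v)) + \<epsilon>\<^sup>2 * (1 / 2 * mint M (inv_pair B w w))" for \<epsilon>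
  proof -
    let ?s = "scale_field (\<lambda>p. \<epsilon>) w"
    let ?u = "add_field v ?s"
    have s: "?s \<in> vector_fields M" by (rule scale_field_vector_field[OF C_inf_const w'])
    have "?u \<in> CH_process_space M c"
      using v w add_field_vector_field[OF v' s] by (auto simp: process_space_boundary add_field_def scale_field_def)
    from min[OF this] have "?d (\<lambda>p. - mdiv M v p) + 1 / 2 * mint M (inv_pair B v v) \<le>
        ?d (\<lambda>p. - mdiv M ?u p) + 1 / 2 * mint M (inv_pair B ?u ?u)"
      by (simp add: rayleighian_def CH_dissipation_def inv_mobility_sqnorm_def[abs_def] inv_pair_def[abs_def])
    moreover have "?d (\<lambda>p. - mdiv M ?u p) = ?d (\<lambda>p. - mdiv M v p) + \<epsilon> * ?d (\<lambda>p. - mdiv M w p)"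
      by (rule differential_add_cmult[OF F c hC[OF v'] hC[OF w']]) (simp add: mdiv_add[OF v' s] mdiv_cmult[OF w'])
    moreover have "mint M (inv_pair B ?u ?u) =
        mint M (inv_pair B v v) + (2 * \<epsilon> * mint M (inv_pair B w v) + \<epsilon>\<^sup>2 * mint M (inv_pair B w w))"
    proof -
      have "mint M (inv_pair B ?u ?u) =
          mint M (\<lambda>p. inv_pair B v v p + (2 * \<epsilon> * inv_pair B w v p + \<epsilon>\<^sup>2 * inv_pair B w w p))"
      proof (rule mint_cong)
        fix p assume p: "p \<in> topspace (mspace M)"
        have "inv_pair B ?u ?u p = inv_pair B v v p + \<epsilon> * inv_pair B v w p + \<epsilon> * inv_pair B w v p + \<epsilon>\<^sup>2 * inv_pair B w w p"
          by (simp add: inv_pair_def Let_def add_field_def scale_field_def matrix_vector_right_distrib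
              matrix_vector_mult_scaleR inner_add_left inner_add_right power2_eq_square algebra_simps)
        then show "inv_pair B ?u ?u p = inv_pair B v v p + (2 * \<epsilon> * inv_pair B w v p + \<epsilon>\<^sup>2 * inv_pair B w w p)"
          using inv_pair_commute[OF B p, of v w] by simp
      qed
      then show ?thesis using cont by (simp only: mint_add mint_cmult mcont_add mcont_mult mcont_const)
    qed
    ultimately show ?thesis by (simp add: algebra_simps)
  qed
  then have "?d (\<lambda>p. - mdiv M w p) + mint M (inv_pair B w v) = 0" by (rule quadratic_nonneg_linear_zero)
  then show ?thesis using differential_by_parts[OF F c hC[OF w'], of \<alpha>] by simp
qed

text \<open>
  The multiple \<open>\<mu> w\<close> of a test field is again tangent to the boundary, so the term with \<open>\<mu> div w\<close>
  can be integrated by parts without a boundary contribution.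
\<close>

lemma cahn_hilliard_stationary:
  assumes \<alpha>: "0 < \<alpha>" and F: "smooth_on F UNIV" and B: "mobility_field M B" and c: "c \<in> C_inf M"
    and v: "v \<in> CH_process_space M c"
    and min: "\<And>w. w \<in> CH_process_space M c \<Longrightarrow>
      rayleighian (ginzburg_landau M \<alpha> F) (CH_dissipation M B) (\<lambda>_ w p. - mdiv M w p) c v
        \<le> rayleighian (ginzburg_landau M \<alpha> F) (CH_dissipation M B) (\<lambda>_ w p. - mdiv M w p) c w"
  shows "\<And>\<kappa> p. \<kappa> \<in> atlas M \<Longrightarrow> p \<in> fst \<kappa> \<Longrightarrow> v \<kappa> p = - mobility_flux B (chem_potential M \<alpha> F c) \<kappa> p"
    and "\<And>p. p \<in> mboundary M \<Longrightarrow> normal_deriv M c p = 0"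
proof -
  let ?d = "differential (ginzburg_landau M \<alpha> F) c"
  let ?\<mu> = "chem_potential M \<alpha> F c"
  let ?E = "CH_process_space M c"
  note \<mu> = chem_potential_C_inf[OF F c, of \<alpha>]
  note grad = grad_vector_field[OF c]
  have vf: "w \<in> vector_fields M" if "w \<in> ?E" for w using that by (simp add: CH_process_space_def)
  note v' = vf[OF v]
  have hC: "(\<lambda>p. - mdiv M w p) \<in> C_inf M" if "w \<in> vector_fields M" for w
    using C_inf_mult[OF C_inf_const mdiv_C_inf[OF that], of "- 1"] by simp
  have var: "\<alpha> * mint M (mdiv M (scale_field (\<lambda>p. - mdiv M w p) (grad M c))) +
      mint M (\<lambda>p. - mdiv M w p * ?\<mu> p) + mint M (inv_pair B w v) = 0" if "w \<in> ?E" for w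
    by (rule cahn_hilliard_first_variation[OF F B c v _ that]) (rule min)
  let ?f = "\<lambda>w p. ginner M (grad M ?\<mu>) w p + inv_pair B w v p"
  let ?G = "\<lambda>\<kappa> p. mdifferential ?\<mu> \<kappa> p + matrix_inv (B \<kappa> p) *v v \<kappa> p"
  have f: "?f w p = w \<kappa> p \<bullet> ?G \<kappa> p" if "w \<in> vector_fields M" "\<kappa> \<in> atlas M" "p \<in> fst \<kappa>" for w \<kappa> p
    using ginner_grad[OF \<mu> that] inv_pair_chart[OF B that(1) v' that(2,3)] by (simp add: inner_add_right inner_commute)
  have fC: "?f w \<in> C_inf M" if "w \<in> vector_fields M" for w
    by (intro C_inf_add ginner_grad_C_inf inv_pair_C_inf \<mu> B that v')
  have var': "\<alpha> * mint M (mdiv M (scale_field (\<lambda>p. - mdiv M w p) (grad M c))) + mint M (?f w) = 0"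
    if w: "w \<in> ?E" and \<kappa>: "\<kappa> \<in> atlas M" and S: "compactin (mspace M) S" "S \<subseteq> fst \<kappa>"
      and supp: "\<And>\<kappa>' q. q \<notin> S \<Longrightarrow> w \<kappa>' q = 0" for w \<kappa> S
  proof -
    note w' = vf[OF w]
    have m: "scale_field ?\<mu> w \<in> vector_fields M" by (rule scale_field_vector_field[OF \<mu> w'])
    have "mint M (mdiv M (scale_field ?\<mu> w)) = 0"
      by (rule integral_mdiv_zero[OF \<kappa> m S]) (simp_all add: scale_field_def supp process_space_chart[OF w \<kappa>])
    moreover have "mint M (ginner M (grad M ?\<mu>) w) = mint M (\<lambda>p. mdiv M (scale_field ?\<mu> w) p + - mdiv M w p * ?\<mu> p)"
      by (rule mint_cong) (simp add: mdiv_scale[OF \<mu> w'])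
    moreover have "\<dots> = mint M (mdiv M (scale_field ?\<mu> w)) + mint M (\<lambda>p. - mdiv M w p * ?\<mu> p)"
      by (intro mint_add C_inf_mcont mdiv_C_inf m C_inf_mult hC w' \<mu>)
    moreover have "mint M (?f w) = mint M (ginner M (grad M ?\<mu>) w) + mint M (inv_pair B w v)"
      by (intro mint_add C_inf_mcont ginner_grad_C_inf inv_pair_C_inf[OF B] \<mu> w' v')
    ultimately show ?thesis using var[OF w] by linarith
  qed
  have G0: "?G \<kappa> p = 0" if \<kappa>: "\<kappa> \<in> atlas M" and p: "p \<in> fst \<kappa>" for \<kappa> p
  proof -
    have "?G \<kappa> p $ i = 0" for i
    proof (rule weak_zero[OF \<kappa> openin_domain[OF \<kappa>] subset_refl _ _ p])
      have "smooth_on (\<lambda>x. ((mdifferential ?\<mu> \<kappa> \<circ> chart_inv \<kappa>) x +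
          matrix_inv ((B \<kappa> \<circ> chart_inv \<kappa>) x) *v (v \<kappa> \<circ> chart_inv \<kappa>) x) $ i) (img \<kappa>)"
        by (intro smooth_on_vec_nth smooth_on_add smooth_mdifferential \<mu> smooth_inv_mobility[OF B v'] \<kappa>)
      then show "continuous_on (img \<kappa>) ((\<lambda>q. ?G \<kappa> q $ i) \<circ> chart_inv \<kappa>)"
        by (intro smooth_on_imp_continuous_on) (simp add: comp_def)
      fix x r assume adm: "admissible \<kappa> x r" and int: "\<And>y. y \<in> cball x r \<Longrightarrow> 0 < y $ bdir"
      have r: "0 < r" using adm by (simp add: admissible_def)
      define w where "w = lift_field \<kappa> (axis_field (bump x r) i)"
      have b0: "bump x r y = 0" if "y \<notin> cball x r" for y using that r by (intro bump_zero) auto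
      have w: "w \<in> ?E"
        unfolding w_def using int b0 by (intro axis_field_process_space[OF adm smooth_bump]) fastforce+
      obtain S where S: "compactin (mspace M) S" "S \<subseteq> fst \<kappa>" "snd \<kappa> ` S = cball x r \<inter> halfspace"
        and supp: "\<And>\<kappa>' q. q \<notin> S \<Longrightarrow> w \<kappa>' q = 0"
      proof (rule bump_supported[OF adm])
        fix S assume S: "compactin (mspace M) S" "S \<subseteq> fst \<kappa>" "snd \<kappa> ` S = cball x r \<inter> halfspace"
          and s: "\<And>X \<kappa>' q. (\<And>y. y \<in> halfspace \<Longrightarrow> y \<notin> cball x r \<Longrightarrow> X y = 0) \<Longrightarrow> q \<notin> S \<Longrightarrow> lift_field \<kappa> X \<kappa>' q = 0"
        show thesis
        proof (rule that[OF S])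
          show "w \<kappa>' q = 0" if "q \<notin> S" for \<kappa>' q unfolding w_def by (rule s[OF _ that]) (simp add: axis_field_def b0)
        qed
      qed
      have md: "mdiv M w q = 0" if "q \<in> topspace (mspace M)" "q \<notin> S" for q
        by (rule mdiv_zero[OF closedin_compactin[OF S(1)] supp that])
      have fw: "?f w q = 0" if "q \<in> topspace (mspace M)" "q \<notin> S" for q
        unfolding f[OF vf[OF w] chart_at[OF that(1)]] supp[OF that(2)] by simp
      have "mint M (mdiv M (scale_field (\<lambda>p. - mdiv M w p) (grad M c))) = 0"
      proof (rule integral_mdiv_scale_zero[OF \<kappa> S(1,2) hC[OF vf[OF w]] _ _ grad])
        show "- mdiv M w q = 0" if "q \<in> topspace (mspace M)" "q \<notin> S" for q using md[OF that] by simp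
        show "- mdiv M w q = 0" if "q \<in> fst \<kappa>" "snd \<kappa> q $ bdir = 0" for q
        proof -
          have "q \<notin> S" using S(3) int[of "snd \<kappa> q"] that(2) by force
          then show ?thesis using md[of q] domain_subset[OF \<kappa>] that(1) by auto
        qed
      qed
      then have int0: "mint M (?f w) = 0" using var'[OF w \<kappa> S(1,2) supp] by simp
      have "?f w q = lift_fun \<kappa> (bump x r) q * ?G \<kappa> q $ i" if q: "q \<in> topspace (mspace M)" for q
      proof (cases "q \<in> fst \<kappa>")
        case True
        show ?thesis
          unfolding f[OF vf[OF w] \<kappa> True]
          unfolding w_def lift_field_chart[OF \<kappa> True]
          using True by (simp add: axis_field_def inner_axis' lift_fun_def)
      next
        case False
        then show ?thesis using fw[OF q] S(2) by (auto simp: lift_fun_def)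
      qed
      then show "\<exists>f. mcont f \<and> mint M f = 0 \<and> (\<forall>q\<in>topspace (mspace M). f q = lift_fun \<kappa> (bump x r) q * ?G \<kappa> q $ i)"
        using C_inf_mcont[OF fC[OF vf[OF w]]] int0 by (intro exI[of _ "?f w"]) simp
    qed
    then show ?thesis by (simp add: vec_eq_iff)
  qed
  show "v \<kappa> p = - mobility_flux B ?\<mu> \<kappa> p" if \<kappa>: "\<kappa> \<in> atlas M" and p: "p \<in> fst \<kappa>" for \<kappa> p
  proof -
    have "mdifferential ?\<mu> \<kappa> p = - (matrix_inv (B \<kappa> p) *v v \<kappa> p)"
      using G0[OF \<kappa> p] by (simp add: eq_neg_iff_add_eq_0)
    then have "mobility_flux B ?\<mu> \<kappa> p = - (B \<kappa> p *v (matrix_inv (B \<kappa> p) *v v \<kappa> p))"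
      using matrix_vector_mult_scaleR[of "B \<kappa> p" "- 1" "matrix_inv (B \<kappa> p) *v v \<kappa> p"] by (simp add: mobility_flux_def)
    then show ?thesis by (simp add: matrix_inv_cancel[OF spd_invertible[OF mobility_spd[OF B \<kappa> p]]])
  qed
  show "normal_deriv M c p = 0" if p: "p \<in> mboundary M" for p
  proof -
    have pt: "p \<in> topspace (mspace M)" by (rule mboundary_topspace[OF p])
    have "grad M c (chart_at M p) p $ bdir = 0"
    proof (rule weakly_tangent[OF grad _ chart_at[OF pt] mboundary_coordinate[OF p chart_at[OF pt]]])
      fix \<kappa> x r assume adm: "admissible \<kappa> x r"
      have \<kappa>: "\<kappa> \<in> atlas M" and r: "0 < r" using adm by (simp_all add: admissible_def)
      let ?\<phi> = "lift_fun \<kappa> (bump x r)"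
      let ?\<beta> = "\<lambda>y. y $ bdir * bump x r y"
      define w where "w = lift_field \<kappa> (axis_field ?\<beta> bdir)"
      have b0: "bump x r y = 0" if "y \<notin> cball x r" for y using that r by (intro bump_zero) auto
      have w: "w \<in> ?E"
        unfolding w_def using b0
        by (intro axis_field_process_space[OF adm] smooth_on_mult smooth_bump smooth_on_linear bounded_linear_vec_nth) auto
      obtain S where S: "compactin (mspace M) S" "S \<subseteq> fst \<kappa>"
        and supp: "\<And>\<kappa>' q. q \<notin> S \<Longrightarrow> w \<kappa>' q = 0" and supp\<phi>: "\<And>q. q \<notin> S \<Longrightarrow> ?\<phi> q = 0"
      proof (rule bump_supported[OF adm])
        fix S assume S: "compactin (mspace M) S" "S \<subseteq> fst \<kappa>"
          and s1: "\<And>g q. (\<And>y. y \<in> halfspace \<Longrightarrow> y \<notin> cball x r \<Longrightarrow> g y = 0) \<Longrightarrow> q \<notin> S \<Longrightarrow> lift_fun \<kappa> g q = 0"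
          and s2: "\<And>X \<kappa>' q. (\<And>y. y \<in> halfspace \<Longrightarrow> y \<notin> cball x r \<Longrightarrow> X y = 0) \<Longrightarrow> q \<notin> S \<Longrightarrow> lift_field \<kappa> X \<kappa>' q = 0"
        show thesis
        proof (rule that[OF S])
          show "w \<kappa>' q = 0" if "q \<notin> S" for \<kappa>' q unfolding w_def by (rule s2[OF _ that]) (simp add: axis_field_def b0)
          show "?\<phi> q = 0" if "q \<notin> S" for q by (rule s1[OF _ that]) (rule b0)
        qed
      qed
      let ?h = "\<lambda>p. - mdiv M w p"
      note h = hC[OF vf[OF w]]
      have \<phi>: "?\<phi> \<in> C_inf M" by (rule admissible_bump_C_inf[OF adm])
      have "mint M (?f w) = 0"
        by (rule mint_zero) (simp only: f[OF vf[OF w] chart_at] G0[OF chart_at] inner_zero_right)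
      then have "mint M (mdiv M (scale_field ?h (grad M c))) = 0" using var'[OF w \<kappa> S supp] \<alpha> by simp
      \<comment> \<open>The divergence of the test field and the bump agree at the boundary, so one may be replaced by the other.\<close>
      moreover have "mint M (mdiv M (scale_field (\<lambda>p. ?\<phi> p + ?h p) (grad M c))) = 0"
      proof (rule integral_mdiv_scale_zero[OF \<kappa> S C_inf_add[OF \<phi> h] _ _ grad])
        show "?\<phi> q + ?h q = 0" if "q \<in> topspace (mspace M)" "q \<notin> S" for q
          using mdiv_zero[OF closedin_compactin[OF S(1)] supp that] supp\<phi>[OF that(2)] by simp
        show "?\<phi> q + ?h q = 0" if "q \<in> fst \<kappa>" "snd \<kappa> q $ bdir = 0" for q
          using mdiv_boundary_bump[OF adm that vf[OF w, unfolded w_def]] by (simp add: w_def)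
      qed
      moreover have "scale_field (\<lambda>p. ?\<phi> p + ?h p) (grad M c) = add_field (scale_field ?\<phi> (grad M c)) (scale_field ?h (grad M c))"
        by (simp add: scale_field_def add_field_def fun_eq_iff scaleR_left_diff_distrib)
      moreover have "mint M (mdiv M (add_field (scale_field ?\<phi> (grad M c)) (scale_field ?h (grad M c)))) =
          mint M (mdiv M (scale_field ?\<phi> (grad M c))) + mint M (mdiv M (scale_field ?h (grad M c)))"
      proof -
        note s = scale_field_vector_field[OF \<phi> grad] scale_field_vector_field[OF h grad]
        show ?thesis
          unfolding mint_add[OF C_inf_mcont[OF mdiv_C_inf[OF s(1)]] C_inf_mcont[OF mdiv_C_inf[OF s(2)]], symmetric]
          by (rule mint_cong) (rule mdiv_add[OF s])
      qed
      ultimately show "mint M (mdiv M (scale_field ?\<phi> (grad M c))) = 0" by simp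
    qed
    then show ?thesis unfolding normal_deriv_def ginner_normal[OF pt] .
  qed
qed

end

theorem theorem2p4:
  fixes M :: "('m, 'n::{finite,wellorder}) rmanifold"
    and \<alpha> :: real and F :: "real \<Rightarrow> real"
    and I :: "real set" and c :: "real \<Rightarrow> 'm \<Rightarrow> real"
  assumes "compact_riemannian_manifold M"
    and "0 < \<alpha>"
    and "smooth_on F UNIV"
    and "is_interval I" and "interior I \<noteq> {}"
  shows
    "(OVP_solution M (C_inf M) (\<lambda>_. C_inf M)
        (ginzburg_landau M \<alpha> F) (AC_dissipation M) (\<lambda>_ w. w) I c
      \<longrightarrow> (\<forall>t\<in>I.
            has_curve_derivative M c (\<lambda>p. \<alpha> * laplacian M (c t) p - deriv F (c t p)) t I \<and>
            (\<forall>p\<in>mboundary M. normal_deriv M (c t) p = 0)))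
     \<and>
     (\<forall>B. mobility_field M B \<and>
        OVP_solution M (C_inf M) (CH_process_space M)
          (ginzburg_landau M \<alpha> F) (CH_dissipation M B) (\<lambda>_ w p. - mdiv M w p) I c
      \<longrightarrow> (\<forall>t\<in>I.
            has_curve_derivative M c (mdiv M (mobility_flux B (chem_potential M \<alpha> F (c t)))) t I \<and>
            (\<forall>p\<in>mboundary M.
               normal_deriv M (c t) p = 0 \<and>
               ginner M (mobility_flux B (chem_potential M \<alpha> F (c t))) (outward_normal M) p = 0)))"
proof -
  interpret riemannian M by unfold_locales (rule assms(1))
  let ?GL = "ginzburg_landau M \<alpha> F"
  show ?thesis
  proof (intro conjI allI impI ballI)
    fix t assume sol: "OVP_solution M (C_inf M) (\<lambda>_. C_inf M) ?GL (AC_dissipation M) (\<lambda>_ w. w) I c" and t: "t \<in> I"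
    obtain cdot v where c: "c t \<in> C_inf M" and d: "has_curve_derivative M c cdot t I" and v: "v \<in> C_inf M"
      and eq: "\<forall>p\<in>topspace (mspace M). cdot p = v p"
      and min: "\<forall>w\<in>C_inf M. rayleighian ?GL (AC_dissipation M) (\<lambda>_ w. w) (c t) v \<le>
        rayleighian ?GL (AC_dissipation M) (\<lambda>_ w. w) (c t) w"
      using sol t unfolding OVP_solution_def by blast
    have AC: "p \<in> topspace (mspace M) \<Longrightarrow> v p = \<alpha> * laplacian M (c t) p - deriv F (c t p)"
      "p \<in> mboundary M \<Longrightarrow> normal_deriv M (c t) p = 0" for p
      by (rule allen_cahn_stationary[OF assms(2,3) c v], rule bspec[OF min], assumption+)+
    show "has_curve_derivative M c (\<lambda>p. \<alpha> * laplacian M (c t) p - deriv F (c t p)) t I"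
      using d by (rule has_curve_derivative_cong) (simp add: eq AC(1))
    show "normal_deriv M (c t) p = 0" if "p \<in> mboundary M" for p using AC(2)[OF that] .
  next
    fix B t assume sol: "mobility_field M B \<and>
        OVP_solution M (C_inf M) (CH_process_space M) ?GL (CH_dissipation M B) (\<lambda>_ w p. - mdiv M w p) I c"
      and t: "t \<in> I"
    then have B: "mobility_field M B" by blast
    obtain cdot v where c: "c t \<in> C_inf M" and d: "has_curve_derivative M c cdot t I" and v: "v \<in> CH_process_space M (c t)"
      and eq: "\<forall>p\<in>topspace (mspace M). cdot p = - mdiv M v p"
      and min: "\<forall>w\<in>CH_process_space M (c t). rayleighian ?GL (CH_dissipation M B) (\<lambda>_ w p. - mdiv M w p) (c t) v \<le>
        rayleighian ?GL (CH_dissipation M B) (\<lambda>_ w p. - mdiv M w p) (c t) w"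
      using sol t unfolding OVP_solution_def by blast
    let ?j = "mobility_flux B (chem_potential M \<alpha> F (c t))"
    have CH: "\<kappa> \<in> atlas M \<Longrightarrow> p \<in> fst \<kappa> \<Longrightarrow> v \<kappa> p = - ?j \<kappa> p"
      "p \<in> mboundary M \<Longrightarrow> normal_deriv M (c t) p = 0" for \<kappa> p
      by (rule cahn_hilliard_stationary[OF assms(2,3) B c v], rule bspec[OF min], assumption+)+
    have v': "v \<in> vector_fields M" using v by (simp add: CH_process_space_def)
    have j: "?j \<kappa> p = scale_field (\<lambda>p. - 1) v \<kappa> p" if "\<kappa> \<in> atlas M" "p \<in> fst \<kappa>" for \<kappa> p
      using CH(1)[OF that] by (simp add: scale_field_def)
    show "has_curve_derivative M c (mdiv M ?j) t I"
    proof (rule has_curve_derivative_cong[OF d])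
      fix p assume p: "p \<in> topspace (mspace M)"
      have "mdiv M ?j p = mdiv M (scale_field (\<lambda>p. - 1) v) p"
        unfolding mdiv_chart_at
        by (rule chart_div_cong[OF chart_at(1)[OF p] openin_domain[OF chart_at(1)[OF p]] subset_refl chart_at(2)[OF p]])
          (rule j[OF chart_at(1)[OF p]])
      then show "cdot p = mdiv M ?j p" using eq p mdiv_cmult[OF v' p, of "- 1"] by simp
    qed
    fix p assume p: "p \<in> mboundary M"
    show "normal_deriv M (c t) p = 0" by (rule CH(2)[OF p])
    have "v (chart_at M p) p $ bdir = 0" using v p by (simp add: process_space_boundary)
    then show "ginner M ?j (outward_normal M) p = 0"
      unfolding ginner_normal[OF mboundary_topspace[OF p]] j[OF chart_at[OF mboundary_topspace[OF p]]]
      by (simp add: scale_field_def)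
  qed
qed

end
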